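(* Let $(M,P)$ be a beautiful pair associated to a quasiminimal class $\mathcal{C}$. If $(M,\operatorname{cl})$ is disintegrated (trivial), then $U_{Lsp}((M,P))=1$. If $(M,\operatorname{cl})$ is locally modular and not disintegrated, then $U_{Lsp}((M,P))=2$.
   Context: **Quasiminimal classes.** Let $\mathcal{L}$ be a countable language. $\operatorname{tp}$ denotes the quantifier-free $\mathcal{L}$-type of a (possibly infinite, enumerated) tuple; in the structures below it is identified with the $\mathcal{L}_{\omega_1\omega}$-type. An $\mathcal{L}$-structure $M$ equipped with a pregeometry $\operatorname{cl}$ is a *quasiminimal pregeometry structure* if: (QM1) if $\operatorname{tp}(a,\vec b)=\operatorname{tp}(a',\vec b')$ then $a\in\operatorname{cl}(\vec b)$ iff $a'\in\operatorname{cl}(\vec b')$; (QM2) $M$ is infinite-dimensional with respect to $\operatorname{cl}$; (QM3) $\operatorname{cl}(A)$ is countable for every finite $A\subseteq M$; (QM4) if $A,A'\subseteq M$ are countable closed subsets enumerated so that $\operatorname{tp}(A)=\operatorname{tp}(A')$, $a\in M\setminus A$ and $a'\in M\setminus A'$, then $\operatorname{tp}(A,a)=\operatorname{tp}(A',a')$; (QM5) if $A,A'\subseteq M$ are countable closed subsets or empty, enumerated so that $\operatorname{tp}(A)=\operatorname{tp}(A')$, $\vec b,\vec b'$ are finite tuples with $\operatorname{tp}(A,\vec b)=\operatorname{tp}(A',\vec b')$ and $a\in\operatorname{cl}(A,\vec b)$, then there is $a'\in M$ with $\operatorname{tp}(A,\vec b,a)=\operatorname{tp}(A',\vec b',a')$.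 It is a *weakly quasiminimal pregeometry structure* if all axioms except possibly QM2 hold. An embedding $\theta:M_1\to M_2$ of such structures is *closed* if $\theta(\operatorname{cl}_{M_1}(A))=\operatorname{cl}_{M_2}(\theta(A))$ for all $A\subseteq M_1$; $M_1\preceq M_2$ means that the inclusion is a closed embedding. A *quasiminimal class* $\mathcal{C}$ is the smallest class of $\mathcal{L}$-structures containing a given quasiminimal pregeometry structure and closed under isomorphism, closed substructures, and unions of chains of closed embeddings; each member is a weakly quasiminimal pregeometry structure with its pregeometry $\operatorname{cl}$. $\dim(\vec a/B)$ is the dimension of $\vec a$ in the localized pregeometry $\operatorname{cl}_B(X)=\operatorname{cl}(X\cup B)$, and $\vec a\perp^{\operatorname{cl}}_C B$ means $\dim(\vec a/B\cup C)=\dim(\vec a/C)$. **Beautiful pairs.** Let $P$ be a new unary predicate, $\mathcal{L}_P=\mathcal{L}\cup\{P\}$, $M\in\mathcal{C}$. $(M,P)$ is *dense-codense* if for all $b_1,\dots,b_n\in M$: (density) some $a\in P(M)$ realizes the unique generic type over $\operatorname{cl}(b_1,\dots,b_n)$, i.e. $a\notin\operatorname{cl}(b_1,\dots,b_n)$; (codensity) there is $a\in M$ with $a\notin\operatorname{cl}(\{b_1,\dots,b_n\}\cup P(M))$. It is a *beautiful pair* if in addition $P(M)\in\mathcal{C}$ and $P(M)\preceq M$. $\operatorname{tp}_P(\vec a/B)$ denotes the $(\mathcal{L}_P)_{\omega_1\omega}$-type of $\vec a$ over $B$ in $(M,P)$. For beautiful pairs, $(N,P)\preceq(M,P)$ means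 $(\mathcal{L}_P)_{\omega_1\omega}$-elementary substructure. **Complexity of the pregeometry.** $(M,\operatorname{cl})$ is *disintegrated* (= trivial) if $\operatorname{cl}(A)=\bigcup_{a\in A}\operatorname{cl}(\{a\})$ for all nonempty $A\subseteq M$. $(M,\operatorname{cl})$ is *modular* if for all finite tuples $\vec a,\vec b$ in $M$, $\vec a\perp^{\operatorname{cl}}_{\operatorname{cl}(\vec a)\cap\operatorname{cl}(\vec b)}\vec b$; it is *locally modular* if for every $e\in M\setminus\operatorname{cl}(\emptyset)$ the localization $(M,\operatorname{cl}_e)$, $\operatorname{cl}_e(X)=\operatorname{cl}(X\cup\{e\})$, is modular. **The rank.** For $A\subseteq B\subseteq M$, $\operatorname{tp}_P(\vec a/B)$ *Lascar splits* over $A$ if there are finite tuples $\vec b,\vec c$ in $B$ with the same Lascar strong type over $A$ (in the sense of $(M,P)$) but $\operatorname{tp}_P(\vec a\vec b/A)\ne\operatorname{tp}_P(\vec a\vec c/A)$. When $A$ is a model, equality of Lascar strong types over $A$ is the same as equality of types over $A$ (and this is the only case needed below). For $\vec a\in M$ and a beautiful pair $(N,P)\preceq(M,P)$: $U_{Lsp}(\operatorname{tp}_P(\vec a/N))\ge0$ always; $U_{Lsp}(\operatorname{tp}_P(\vec a/N))\ge n+1$ if there is a beautiful pair $(N_1,P)$ with $(N,P)\preceq(N_1,P)$ (inside the ambient structure $(M,P)$) such that $\operatorname{tp}_P(\vec a/N_1)$ Lascar splits over $N$ and $U_{Lsp}(\operatorname{tp}_P(\vec a/N_1))\ge n$. $U_{Lsp}((M,P))=1$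 means that $U_{Lsp}(\operatorname{tp}_P(a/N))\le1$ for all single elements $a\in M$ and all $(N,P)\preceq(M,P)$. $U_{Lsp}((M,P))=2$ means that $U_{Lsp}(\operatorname{tp}_P(a/N))\le2$ for all single elements $a\in M$ and all $(N,P)\preceq(M,P)$, and equality holds for some such $a$ and $N$.
   Formalization: (N,P) ⪯ (M,P) here also requires N to be closed in M (inclusion a closed embedding), not only elementary; otherwise the disintegrated case fails, e.g. for an equivalence relation with all classes countably infinite and cl(A) the union of the classes meeting A. *)

theory Defs
  imports Main "HOL-Library.Countable_Set" "HOL-Library.Extended_Nat"
begin

section \<open>Languages, structures and infinitary formulas\<close>

text \<open>Constants are function symbols of arity 0.\<close>

record ('f, 'r) lang =
  Funs :: "'f set"
  Rels :: "'r set"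
  farity :: "'f \<Rightarrow> nat"
  rarity :: "'r \<Rightarrow> nat"

definition countable_lang :: "('f, 'r) lang \<Rightarrow> bool" where
  "countable_lang L \<longleftrightarrow> countable (Funs L) \<and> countable (Rels L)"

record ('f, 'r, 'a) struct =
  univ :: "'a set"
  fint :: "'f \<Rightarrow> 'a list \<Rightarrow> 'a"
  rint :: "'r \<Rightarrow> 'a list set"

definition is_struct :: "('f, 'r) lang \<Rightarrow> ('f, 'r, 'a, 'z) struct_scheme \<Rightarrow> bool" where
  "is_struct L M \<longleftrightarrow> univ M \<noteq> {} \<and>
     (\<forall>f \<in> Funs L. \<forall>xs \<in> lists (univ M). length xs = farity L f \<longrightarrow> fint M f xs \<in> univ M)"

datatype ('f, vars: 'v) trm = Var 'v | Fn 'f "('f, 'v) trm list"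

datatype ('f, 'r, 'v) fm =
    Eq "('f, 'v) trm" "('f, 'v) trm"
  | Rel 'r "('f, 'v) trm list"
  | Neg "('f, 'r, 'v) fm"
  | Conj "nat \<Rightarrow> ('f, 'r, 'v) fm"  \<comment> \<open>countable conjunction; finite ones are obtained by repetition\<close>
  | Ex 'v "('f, 'r, 'v) fm"

primrec wf_trm :: "('f, 'r) lang \<Rightarrow> ('f, 'v) trm \<Rightarrow> bool" where
  "wf_trm L (Var v) \<longleftrightarrow> True"
| "wf_trm L (Fn f ts) \<longleftrightarrow> f \<in> Funs L \<and> length ts = farity L f \<and> list_all (wf_trm L) ts"

primrec wf_fm :: "('f, 'r) lang \<Rightarrow> ('f, 'r, 'v) fm \<Rightarrow> bool" where
  "wf_fm L (Eq s t) \<longleftrightarrow> wf_trm L s \<and> wf_trm L t"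
| "wf_fm L (Rel r ts) \<longleftrightarrow> r \<in> Rels L \<and> length ts = rarity L r \<and> list_all (wf_trm L) ts"
| "wf_fm L (Neg \<phi>) \<longleftrightarrow> wf_fm L \<phi>"
| "wf_fm L (Conj F) \<longleftrightarrow> (\<forall>n. wf_fm L (F n))"
| "wf_fm L (Ex v \<phi>) \<longleftrightarrow> wf_fm L \<phi>"

primrec fv :: "('f, 'r, 'v) fm \<Rightarrow> 'v set" where
  "fv (Eq s t) = vars s \<union> vars t"
| "fv (Rel r ts) = (\<Union>t \<in> set ts. vars t)"
| "fv (Neg \<phi>) = fv \<phi>"
| "fv (Conj F) = (\<Union>n. fv (F n))"
| "fv (Ex v \<phi>) = fv \<phi> - {v}"

text \<open>First-order (finitary) quantifier-free formulas.\<close>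

primrec qfree :: "('f, 'r, 'v) fm \<Rightarrow> bool" where
  "qfree (Eq s t) \<longleftrightarrow> True"
| "qfree (Rel r ts) \<longleftrightarrow> True"
| "qfree (Neg \<phi>) \<longleftrightarrow> qfree \<phi>"
| "qfree (Conj F) \<longleftrightarrow> finite (range F) \<and> (\<forall>n. qfree (F n))"
| "qfree (Ex v \<phi>) \<longleftrightarrow> False"

primrec tval :: "('f, 'r, 'a, 'z) struct_scheme \<Rightarrow> ('v \<Rightarrow> 'a) \<Rightarrow> ('f, 'v) trm \<Rightarrow> 'a" where
  "tval M s (Var v) = s v"
| "tval M s (Fn f ts) = fint M f (map (tval M s) ts)"

primrec sat :: "('f, 'r, 'a, 'z) struct_scheme \<Rightarrow> ('f, 'r, 'v) fm \<Rightarrow> ('v \<Rightarrow> 'a) \<Rightarrow> bool" where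
  "sat M (Eq t u) = (\<lambda>s. tval M s t = tval M s u)"
| "sat M (Rel r ts) = (\<lambda>s. map (tval M s) ts \<in> rint M r)"
| "sat M (Neg \<phi>) = (\<lambda>s. \<not> sat M \<phi> s)"
| "sat M (Conj F) = (\<lambda>s. \<forall>n. sat M (F n) s)"
| "sat M (Ex v \<phi>) = (\<lambda>s. \<exists>x \<in> univ M. sat M \<phi> (s(v := x)))"


section \<open>Types\<close>

text \<open>A possibly infinite tuple is a partial map from an index type; an enumeration of a
  countable set \<open>A\<close> is a partial map on \<^typ>\<open>nat\<close> with range \<open>A\<close>. Since \<open>Eq (Var i) (Var i)\<close>
  belongs to the type exactly for \<open>i\<close> in the domain, equality of types includes equality of
  the index sets.\<close>

definition qftp :: "('f, 'r) lang \<Rightarrow> ('f, 'r, 'a, 'z) struct_scheme \<Rightarrow> ('i \<rightharpoonup> 'a) \<Rightarrow> ('f, 'r, 'i) fm set"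
  where "qftp L M t = {\<phi>. wf_fm L \<phi> \<and> qfree \<phi> \<and> fv \<phi> \<subseteq> dom t \<and> sat M \<phi> (\<lambda>i. the (t i))}"

definition list_tuple :: "'a list \<Rightarrow> nat \<rightharpoonup> 'a" where
  "list_tuple xs = (\<lambda>i. if i < length xs then Some (xs ! i) else None)"

definition join_tuple :: "(nat \<rightharpoonup> 'a) \<Rightarrow> 'a list \<Rightarrow> nat + nat \<rightharpoonup> 'a" where
  "join_tuple t xs = case_sum t (list_tuple xs)"

text \<open>The infinitary type of a finite tuple \<open>xs\<close> over \<open>B\<close>. As usual, formulas of
  \<open>L\<^bsub>\<omega>\<^sub>1\<omega>\<^esub>\<close> have finitely many free variables; the parameters \<open>cs\<close> are substituted for the
  variables following those of \<open>xs\<close>. Tuples with equal types have equal lengths.\<close>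

definition itp :: "('f, 'r) lang \<Rightarrow> ('f, 'r, 'a, 'z) struct_scheme \<Rightarrow> 'a list \<Rightarrow> 'a set
    \<Rightarrow> (('f, 'r, nat) fm \<times> 'a list) set" where
  "itp L M xs B = {(\<phi>, cs). wf_fm L \<phi> \<and> set cs \<subseteq> B \<and> fv \<phi> \<subseteq> {..<length xs + length cs} \<and>
     sat M \<phi> (\<lambda>i. (xs @ cs) ! i)}"

definition elem_sub :: "('f, 'r) lang \<Rightarrow> ('f, 'r, 'a, 'z) struct_scheme
    \<Rightarrow> ('f, 'r, 'a, 'y) struct_scheme \<Rightarrow> bool" where
  "elem_sub L N M \<longleftrightarrow> univ N \<subseteq> univ M \<and>
     (\<forall>\<phi> :: ('f, 'r, nat) fm. \<forall>s. wf_fm L \<phi> \<longrightarrow> finite (fv \<phi>) \<longrightarrow> range s \<subseteq> univ N \<longrightarrow>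
        (sat N \<phi> s \<longleftrightarrow> sat M \<phi> s))"


section \<open>Pregeometries\<close>

definition pregeometry :: "'a set \<Rightarrow> ('a set \<Rightarrow> 'a set) \<Rightarrow> bool" where
  "pregeometry U c \<longleftrightarrow>
     (\<forall>A. A \<subseteq> U \<longrightarrow> A \<subseteq> c A \<and> c A \<subseteq> U \<and> c (c A) = c A) \<and>
     (\<forall>A B. A \<subseteq> B \<longrightarrow> B \<subseteq> U \<longrightarrow> c A \<subseteq> c B) \<and>
     (\<forall>A x. A \<subseteq> U \<longrightarrow> x \<in> c A \<longrightarrow> (\<exists>F. finite F \<and> F \<subseteq> A \<and> x \<in> c F)) \<and>
     (\<forall>A x y. A \<subseteq> U \<longrightarrow> x \<in> U \<longrightarrow> y \<in> U \<longrightarrow>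
        x \<in> c (insert y A) \<longrightarrow> x \<notin> c A \<longrightarrow> y \<in> c (insert x A))"

definition localize :: "('a set \<Rightarrow> 'a set) \<Rightarrow> 'a set \<Rightarrow> 'a set \<Rightarrow> 'a set" where
  "localize c B = (\<lambda>X. c (X \<union> B))"

definition basis_of :: "('a set \<Rightarrow> 'a set) \<Rightarrow> 'a set \<Rightarrow> 'a set \<Rightarrow> bool" where
  "basis_of c Y X \<longleftrightarrow> Y \<subseteq> X \<and> X \<subseteq> c Y \<and> (\<forall>y \<in> Y. y \<notin> c (Y - {y}))"

text \<open>Dimension of a finite set; all bases have the same cardinality in a pregeometry.\<close>

definition fdim :: "('a set \<Rightarrow> 'a set) \<Rightarrow> 'a set \<Rightarrow> nat" where
  "fdim c X = (THE n. \<exists>Y. basis_of c Y X \<and> card Y = n)"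

definition dim_over :: "('a set \<Rightarrow> 'a set) \<Rightarrow> 'a list \<Rightarrow> 'a set \<Rightarrow> nat" where
  "dim_over c as B = fdim (localize c B) (set as)"

definition infinite_dimensional :: "'a set \<Rightarrow> ('a set \<Rightarrow> 'a set) \<Rightarrow> bool" where
  "infinite_dimensional U c \<longleftrightarrow> (\<exists>Y. basis_of c Y U \<and> infinite Y)"

definition indep_over :: "('a set \<Rightarrow> 'a set) \<Rightarrow> 'a list \<Rightarrow> 'a set \<Rightarrow> 'a set \<Rightarrow> bool" where
  "indep_over c as C B \<longleftrightarrow> dim_over c as (B \<union> C) = dim_over c as C"

definition disintegrated :: "'a set \<Rightarrow> ('a set \<Rightarrow> 'a set) \<Rightarrow> bool" where
  "disintegrated U c \<longleftrightarrow> (\<forall>A. A \<subseteq> U \<longrightarrow> A \<noteq> {} \<longrightarrow> c A = (\<Union>a \<in> A. c {a}))"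

definition modular :: "'a set \<Rightarrow> ('a set \<Rightarrow> 'a set) \<Rightarrow> bool" where
  "modular U c \<longleftrightarrow> (\<forall>as bs. set as \<subseteq> U \<longrightarrow> set bs \<subseteq> U \<longrightarrow>
     indep_over c as (c (set as) \<inter> c (set bs)) (set bs))"

definition locally_modular :: "'a set \<Rightarrow> ('a set \<Rightarrow> 'a set) \<Rightarrow> bool" where
  "locally_modular U c \<longleftrightarrow> (\<forall>e \<in> U - c {}. modular U (localize c {e}))"


section \<open>Quasiminimal classes\<close>

record ('f, 'r, 'a) pgstruct = "('f, 'r, 'a) struct" +
  clo :: "'a set \<Rightarrow> 'a set"

definition is_pgstruct :: "('f, 'r) lang \<Rightarrow> ('f, 'r, 'a) pgstruct \<Rightarrow> bool" where
  "is_pgstruct L M \<longleftrightarrow> is_struct L M \<and> pregeometry (univ M) (clo M)"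

definition closed_in :: "('f, 'r, 'a) pgstruct \<Rightarrow> 'a set \<Rightarrow> bool" where
  "closed_in M A \<longleftrightarrow> A \<subseteq> univ M \<and> clo M A = A"

definition QM1 :: "('f, 'r) lang \<Rightarrow> ('f, 'r, 'a) pgstruct \<Rightarrow> bool" where
  "QM1 L M \<longleftrightarrow> (\<forall>a a' bs bs'.
     a \<in> univ M \<longrightarrow> a' \<in> univ M \<longrightarrow> set bs \<subseteq> univ M \<longrightarrow> set bs' \<subseteq> univ M \<longrightarrow>
     qftp L M (list_tuple (a # bs)) = qftp L M (list_tuple (a' # bs')) \<longrightarrow>
     (a \<in> clo M (set bs) \<longleftrightarrow> a' \<in> clo M (set bs')))"

definition QM2 :: "('f, 'r, 'a) pgstruct \<Rightarrow> bool" where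
  "QM2 M \<longleftrightarrow> infinite_dimensional (univ M) (clo M)"

definition QM3 :: "('f, 'r, 'a) pgstruct \<Rightarrow> bool" where
  "QM3 M \<longleftrightarrow> (\<forall>A. finite A \<longrightarrow> A \<subseteq> univ M \<longrightarrow> countable (clo M A))"

text \<open>Below \<open>t\<close> and \<open>t'\<close> are enumerations of the countable sets \<open>A = ran t\<close> and \<open>A' = ran t'\<close>.\<close>

definition QM4 :: "('f, 'r) lang \<Rightarrow> ('f, 'r, 'a) pgstruct \<Rightarrow> bool" where
  "QM4 L M \<longleftrightarrow> (\<forall>(t :: nat \<rightharpoonup> 'a) t' a a'.
     closed_in M (ran t) \<longrightarrow> closed_in M (ran t') \<longrightarrow> qftp L M t = qftp L M t' \<longrightarrow>
     a \<in> univ M - ran t \<longrightarrow> a' \<in> univ M - ran t' \<longrightarrow>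
     qftp L M (join_tuple t [a]) = qftp L M (join_tuple t' [a']))"

definition QM5 :: "('f, 'r) lang \<Rightarrow> ('f, 'r, 'a) pgstruct \<Rightarrow> bool" where
  "QM5 L M \<longleftrightarrow> (\<forall>(t :: nat \<rightharpoonup> 'a) t' bs bs' a.
     (closed_in M (ran t) \<or> ran t = {}) \<longrightarrow> (closed_in M (ran t') \<or> ran t' = {}) \<longrightarrow>
     qftp L M t = qftp L M t' \<longrightarrow>
     set bs \<subseteq> univ M \<longrightarrow> set bs' \<subseteq> univ M \<longrightarrow>
     qftp L M (join_tuple t bs) = qftp L M (join_tuple t' bs') \<longrightarrow>
     a \<in> clo M (ran t \<union> set bs) \<longrightarrow>
     (\<exists>a' \<in> univ M. qftp L M (join_tuple t (bs @ [a])) = qftp L M (join_tuple t' (bs' @ [a']))))"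

definition quasiminimal_pg :: "('f, 'r) lang \<Rightarrow> ('f, 'r, 'a) pgstruct \<Rightarrow> bool" where
  "quasiminimal_pg L M \<longleftrightarrow> is_pgstruct L M \<and> QM1 L M \<and> QM2 M \<and> QM3 M \<and> QM4 L M \<and> QM5 L M"

definition closed_embedding :: "('f, 'r) lang \<Rightarrow> ('a \<Rightarrow> 'b) \<Rightarrow> ('f, 'r, 'a) pgstruct
    \<Rightarrow> ('f, 'r, 'b) pgstruct \<Rightarrow> bool" where
  "closed_embedding L \<theta> M N \<longleftrightarrow> is_pgstruct L M \<and> is_pgstruct L N \<and>
     inj_on \<theta> (univ M) \<and> \<theta> ` univ M \<subseteq> univ N \<and>
     (\<forall>f \<in> Funs L. \<forall>xs \<in> lists (univ M). length xs = farity L f \<longrightarrow>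
        \<theta> (fint M f xs) = fint N f (map \<theta> xs)) \<and>
     (\<forall>r \<in> Rels L. \<forall>xs \<in> lists (univ M). length xs = rarity L r \<longrightarrow>
        (xs \<in> rint M r \<longleftrightarrow> map \<theta> xs \<in> rint N r)) \<and>
     (\<forall>A. A \<subseteq> univ M \<longrightarrow> \<theta> ` clo M A = clo N (\<theta> ` A))"

definition pg_iso :: "('f, 'r) lang \<Rightarrow> ('a \<Rightarrow> 'b) \<Rightarrow> ('f, 'r, 'a) pgstruct
    \<Rightarrow> ('f, 'r, 'b) pgstruct \<Rightarrow> bool" where
  "pg_iso L \<theta> M N \<longleftrightarrow> closed_embedding L \<theta> M N \<and> \<theta> ` univ M = univ N"

definition closed_sub :: "('f, 'r) lang \<Rightarrow> ('f, 'r, 'a) pgstruct \<Rightarrow> ('f, 'r, 'a) pgstruct \<Rightarrow> bool" where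
  "closed_sub L M N \<longleftrightarrow> closed_embedding L (\<lambda>x. x) M N"

text \<open>The pregeometry on the union of a chain is determined by the requirement that the
  members of the chain are closed in it, because of finite character.\<close>

definition chain_union :: "('f, 'r) lang \<Rightarrow> ('f, 'r, 'a) pgstruct set \<Rightarrow> ('f, 'r, 'a) pgstruct \<Rightarrow> bool"
  where
  "chain_union L \<K> U \<longleftrightarrow> \<K> \<noteq> {} \<and>
     (\<forall>K \<in> \<K>. \<forall>K' \<in> \<K>. closed_sub L K K' \<or> closed_sub L K' K) \<and>
     is_pgstruct L U \<and> univ U = (\<Union>K \<in> \<K>. univ K) \<and> (\<forall>K \<in> \<K>. closed_sub L K U)"

text \<open>The members of the class whose underlying set consists of elements of \<^typ>\<open>'a\<close>.
  Since closed substructures and isomorphic copies are available, building chains inside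
  a larger type would not produce further members with underlying set in \<^typ>\<open>'a\<close>.\<close>

inductive_set qm_class :: "('f, 'r) lang \<Rightarrow> ('f, 'r, 'a) pgstruct \<Rightarrow> ('f, 'r, 'a) pgstruct set"
  for L M0 where
  base: "M0 \<in> qm_class L M0"
| iso: "M \<in> qm_class L M0 \<Longrightarrow> pg_iso L \<theta> M N \<Longrightarrow> N \<in> qm_class L M0"
| sub: "M \<in> qm_class L M0 \<Longrightarrow> closed_sub L N M \<Longrightarrow> N \<in> qm_class L M0"
| chain: "(\<And>K. K \<in> \<K> \<Longrightarrow> K \<in> qm_class L M0) \<Longrightarrow> chain_union L \<K> U \<Longrightarrow> U \<in> qm_class L M0"

definition quasiminimal_class :: "('f, 'r) lang \<Rightarrow> ('f, 'r, 'a) pgstruct set \<Rightarrow> bool" where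
  "quasiminimal_class L \<C> \<longleftrightarrow> (\<exists>M0. quasiminimal_pg L M0 \<and> \<C> = qm_class L M0)"


section \<open>Beautiful pairs\<close>

text \<open>The new predicate \<open>P\<close> is the symbol \<^const>\<open>None\<close>.\<close>

definition lang_P :: "('f, 'r) lang \<Rightarrow> ('f, 'r option) lang" where
  "lang_P L = \<lparr>Funs = Funs L, Rels = insert None (Some ` Rels L),
     farity = farity L, rarity = case_option 1 (rarity L)\<rparr>"

definition struct_P :: "('f, 'r, 'a) pgstruct \<Rightarrow> 'a set \<Rightarrow> ('f, 'r option, 'a) struct" where
  "struct_P M P = \<lparr>univ = univ M, fint = fint M, rint = case_option ((\<lambda>x. [x]) ` P) (rint M)\<rparr>"

text \<open>The substructure on \<open>N\<close>, with the inherited closure operator.\<close>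

definition restr :: "('f, 'r, 'a) pgstruct \<Rightarrow> 'a set \<Rightarrow> ('f, 'r, 'a) pgstruct" where
  "restr M N = M\<lparr>univ := N\<rparr>"

definition dense_codense :: "('f, 'r, 'a) pgstruct \<Rightarrow> 'a set \<Rightarrow> bool" where
  "dense_codense M P \<longleftrightarrow> (\<forall>bs. set bs \<subseteq> univ M \<longrightarrow>
     (\<exists>a \<in> P. a \<notin> clo M (set bs)) \<and>
     (\<exists>a \<in> univ M. a \<notin> clo M (set bs \<union> P)))"

definition beautiful_pair :: "('f, 'r) lang \<Rightarrow> ('f, 'r, 'a) pgstruct set \<Rightarrow> ('f, 'r, 'a) pgstruct
    \<Rightarrow> 'a set \<Rightarrow> bool" where
  "beautiful_pair L \<C> M P \<longleftrightarrow> M \<in> \<C> \<and> P \<subseteq> univ M \<and> dense_codense M P \<and>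
     restr M P \<in> \<C> \<and> closed_sub L (restr M P) M"

definition tp_P :: "('f, 'r) lang \<Rightarrow> ('f, 'r, 'a) pgstruct \<Rightarrow> 'a set \<Rightarrow> 'a list \<Rightarrow> 'a set
    \<Rightarrow> (('f, 'r option, nat) fm \<times> 'a list) set" where
  "tp_P L M P as B = itp (lang_P L) (struct_P M P) as B"

text \<open>\<open>(N, P) \<preceq> (M, P)\<close> for beautiful pairs. The pair \<open>(N, P \<inter> N)\<close> carries the pregeometry
  inherited from \<open>M\<close>, that is, \<open>N\<close> is closed in \<open>M\<close>. This does not follow from elementarity:
  in an equivalence relation all of whose classes are countably infinite, with the classes as
  closures of points, an elementary substructure may meet classes in proper infinite subsets.\<close>

definition sub_pair :: "('f, 'r) lang \<Rightarrow> ('f, 'r, 'a) pgstruct set \<Rightarrow> ('f, 'r, 'a) pgstruct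
    \<Rightarrow> 'a set \<Rightarrow> 'a set \<Rightarrow> bool" where
  "sub_pair L \<C> M P N \<longleftrightarrow> beautiful_pair L \<C> M P \<and> beautiful_pair L \<C> (restr M N) (P \<inter> N) \<and>
     closed_sub L (restr M N) M \<and>
     elem_sub (lang_P L) (struct_P (restr M N) (P \<inter> N)) (struct_P M P)"


section \<open>Lascar splitting and the rank\<close>

text \<open>Splitting over \<open>A\<close>, for \<open>A\<close> a model: over models, having the same Lascar strong type
  means having the same type.\<close>

definition lascar_splits :: "('f, 'r) lang \<Rightarrow> ('f, 'r, 'a) pgstruct \<Rightarrow> 'a set
    \<Rightarrow> 'a list \<Rightarrow> 'a set \<Rightarrow> 'a set \<Rightarrow> bool" where
  "lascar_splits L M P as B A \<longleftrightarrow> (\<exists>bs cs. set bs \<subseteq> B \<and> set cs \<subseteq> B \<and>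
     tp_P L M P bs A = tp_P L M P cs A \<and>
     tp_P L M P (as @ bs) A \<noteq> tp_P L M P (as @ cs) A)"

primrec ULsp_ge :: "('f, 'r) lang \<Rightarrow> ('f, 'r, 'a) pgstruct set \<Rightarrow> ('f, 'r, 'a) pgstruct
    \<Rightarrow> 'a set \<Rightarrow> 'a list \<Rightarrow> nat \<Rightarrow> 'a set \<Rightarrow> bool" where
  "ULsp_ge L \<C> M P as 0 = (\<lambda>N. True)"
| "ULsp_ge L \<C> M P as (Suc n) = (\<lambda>N. \<exists>N1. sub_pair L \<C> M P N1 \<and>
     sub_pair L \<C> (restr M N1) (P \<inter> N1) N \<and>
     lascar_splits L M P as N1 N \<and> ULsp_ge L \<C> M P as n N1)"

definition ULsp :: "('f, 'r) lang \<Rightarrow> ('f, 'r, 'a) pgstruct set \<Rightarrow> ('f, 'r, 'a) pgstruct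
    \<Rightarrow> 'a set \<Rightarrow> 'a list \<Rightarrow> 'a set \<Rightarrow> enat" where
  "ULsp L \<C> M P as N = Sup (enat ` {n. ULsp_ge L \<C> M P as n N})"

text \<open>By convention \<open>U\<^bsub>Lsp\<^esub>((M, P)) = 1\<close> only bounds the rank, while \<open>U\<^bsub>Lsp\<^esub>((M, P)) = 2\<close>
  also requires that the bound is attained.\<close>

definition ULsp_pair_eq_1 :: "('f, 'r) lang \<Rightarrow> ('f, 'r, 'a) pgstruct set \<Rightarrow> ('f, 'r, 'a) pgstruct
    \<Rightarrow> 'a set \<Rightarrow> bool" where
  "ULsp_pair_eq_1 L \<C> M P \<longleftrightarrow>
     (\<forall>a \<in> univ M. \<forall>N. sub_pair L \<C> M P N \<longrightarrow> ULsp L \<C> M P [a] N \<le> 1)"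

definition ULsp_pair_eq_2 :: "('f, 'r) lang \<Rightarrow> ('f, 'r, 'a) pgstruct set \<Rightarrow> ('f, 'r, 'a) pgstruct
    \<Rightarrow> 'a set \<Rightarrow> bool" where
  "ULsp_pair_eq_2 L \<C> M P \<longleftrightarrow>
     (\<forall>a \<in> univ M. \<forall>N. sub_pair L \<C> M P N \<longrightarrow> ULsp L \<C> M P [a] N \<le> 2) \<and>
     (\<exists>a \<in> univ M. \<exists>N. sub_pair L \<C> M P N \<and> ULsp L \<C> M P [a] N = 2)"

end

theory Submission
  imports Defs
begin

text \<open>The type of a tuple in the pair \<open>(M, P)\<close> is understood through a back-and-forth argument inside
\<open>M\<close>, into which an elementary sub-pair enters only through its underlying closed set \<open>N\<close>.

\<^bold>\<open>Homogeneity.\<close> For finite partial isomorphisms of \<open>M\<close>, closure is preserved, elements of the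
closure of the domain can be added, and elements outside the closures of domain and range can be
added in any way (\<open>finitely_homogeneous\<close>). For the structure that generates the class these are
QM1, QM5 over the empty set, and a consequence of QM4: a finite partial isomorphism extends to one
between the closures, which are countable and closed. All three statements concern closures of
finite sets only, and such a closure inside any member of the class embeds in the generating
structure; hence they hold for every member.

\<^bold>\<open>Pairs.\<close> Call \<open>B\<close> free over \<open>P\<close> if adding \<open>B\<close> to a subset of \<open>P\<close> puts no new elements of \<open>P\<close> in
its closure. A finite partial isomorphism between tuples spanned by elements of \<open>P\<close> together with a
set that is free over \<open>P\<close> preserves \<open>P\<close> automatically, and density and codensity allow such maps
to be extended back and forth. So they preserve all \<open>(L\<^sub>P)\<^bsub>\<omega>\<^sub>1\<omega>\<^esub>\<close>-formulas (\<open>pair_iso_sat\<close>). Choosing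
the images inside a closed set \<open>N\<close> that is itself dense and codense and independent from \<open>P\<close>
over \<open>P \<inter> N\<close> gives the Tarski-Vaught test for \<open>N\<close>; so sub-pairs are exactly these
\<^emph>\<open>rich\<close> sets (\<open>sub_pair_rich\<close>, \<open>rich_sub_pair\<close>). That sub-pairs are independent from \<open>P\<close> uses
that the language is countable: the quantifier-free type of a finite tuple is then a single formula.

\<^bold>\<open>Non-splitting.\<close> Let \<open>N \<subseteq> N1\<close> be rich. If for every finite \<open>F \<subseteq> N1\<close> some \<open>a' \<in> N\<close> has the same type
over \<open>F\<close> as \<open>a\<close>, then the type of \<open>a\<close> over \<open>N1\<close> does not split over \<open>N\<close>, because \<open>a'\<close> may serve as
a parameter (\<open>coheir_not_splits\<close>). Such \<open>a'\<close> exist if \<open>a \<in> N\<close>; if \<open>a\<close> is not in the closure of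
\<open>P \<union> N1\<close>; and if \<open>a \<notin> N1\<close> lies in the closure of one \<open>q \<in> P\<close> and finitely many elements of \<open>N\<close>.
If \<open>M\<close> is disintegrated, every element of the closure of \<open>P \<union> N1\<close> is in \<open>N1\<close> or in the closure of
one element of \<open>P\<close>, so splitting over \<open>N\<close> forces \<open>a \<in> N1\<close>, and nothing splits afterwards.
If \<open>M\<close> is locally modular, a first splitting that leaves \<open>a\<close> outside \<open>N1\<close> puts \<open>a\<close> in the closure
of \<open>P \<union> N1\<close>, and modularity reduces the elements of \<open>P\<close> involved to a single one; then a second
splitting forces \<open>a\<close> into the larger model, and there is no third.

\<^bold>\<open>Two splittings.\<close> If \<open>M\<close> is not disintegrated, there is an irredundant dependence
\<open>a \<in> cl {q, m, w\<^sub>1, \<dots>, w\<^sub>k}\<close>. By homogeneity one may take \<open>q\<close> and all \<open>w\<^sub>i\<close> in \<open>P\<close> and \<open>m\<close> outside the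
closure of \<open>P \<union> N\<close>, for a rich \<open>N\<close> that contains all \<open>w\<^sub>i\<close>. If \<open>N1\<close> contains \<open>m\<close> and an independent
\<open>m'\<close>, then \<open>m\<close> and \<open>m'\<close> have the same type over \<open>N\<close>, but \<open>a\<close> is in the closure of \<open>P \<union> N \<union> {m}\<close> and
not of \<open>P \<union> N \<union> {m'}\<close>. Over \<open>N1\<close> the same happens with \<open>q\<close> and an independent \<open>q' \<in> P\<close>.\<close>


section \<open>Renaming variables in formulas\<close>

lemma tval_cong: "(\<And>v. v \<in> vars t \<Longrightarrow> s v = s' v) \<Longrightarrow> tval M s t = tval M s' t"
proof (induction t)
  case (Fn f ts)
  then have "tval M s t = tval M s' t" if "t \<in> set ts" for t
    using that by auto
  then show ?case by (simp cong: map_cong)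
qed simp

lemma sat_cong: "(\<And>v. v \<in> fv \<phi> \<Longrightarrow> s v = s' v) \<Longrightarrow> sat M \<phi> s \<longleftrightarrow> sat M \<phi> s'"
proof (induction \<phi> arbitrary: s s')
  case (Eq t u)
  then show ?case using tval_cong[of t s s' M] tval_cong[of u s s' M] by simp
next
  case (Rel r ts)
  have "map (tval M s) ts = map (tval M s') ts"
  proof (rule map_cong)
    fix t assume "t \<in> set ts"
    then show "tval M s t = tval M s' t" by (intro tval_cong Rel) auto
  qed simp
  then show ?case by (simp only: sat.simps)
next
  case (Neg \<phi>)
  have "sat M \<phi> s \<longleftrightarrow> sat M \<phi> s'"
    by (rule Neg.IH) (use Neg.prems in simp)
  then show ?case by (simp only: sat.simps)
next
  case (Conj F)
  have "sat M (F n) s \<longleftrightarrow> sat M (F n) s'" for n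
    by (rule Conj.IH) (use Conj.prems in auto)
  then show ?case by simp
next
  case (Ex v \<phi>)
  have "sat M \<phi> (s(v := x)) \<longleftrightarrow> sat M \<phi> (s'(v := x))" for x
    by (rule Ex.IH) (use Ex.prems in auto)
  then show ?case by simp
qed

lemma finite_vars: "finite (vars t)"
  by (induction t) auto

lemma finite_fv_qfree: "qfree \<phi> \<Longrightarrow> finite (fv \<phi>)"
proof (induction \<phi>)
  case (Conj F)
  have "fv (Conj F) = \<Union> (fv ` range F)" by auto
  moreover have "finite \<dots>"
  proof (rule finite_Union)
    show "finite (fv ` range F)" using Conj.prems by simp
  qed (use Conj in auto)
  ultimately show ?case by metis
qed (auto simp: finite_vars)

abbreviation rename :: "('v \<Rightarrow> 'w) \<Rightarrow> ('f, 'r, 'v) fm \<Rightarrow> ('f, 'r, 'w) fm" where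
  "rename \<equiv> map_fm (\<lambda>f. f) (\<lambda>r. r)"

lemma tval_map_trm: "tval M s (map_trm (\<lambda>f. f) h t) = tval M (\<lambda>v. s (h v)) t"
proof (induction t)
  case (Fn f ts)
  then have "map (tval M s) (map (map_trm (\<lambda>f. f) h) ts) = map (tval M (\<lambda>v. s (h v))) ts"
    by simp
  then show ?case by (simp del: map_map)
qed simp

lemma wf_map_trm: "wf_trm L (map_trm (\<lambda>f. f) h t) \<longleftrightarrow> wf_trm L t"
  by (induction t) (auto simp: list_all_iff)

lemma wf_map_fm: "wf_fm L (rename h \<phi>) \<longleftrightarrow> wf_fm L \<phi>"
  by (induction \<phi>) (auto simp: list_all_iff wf_map_trm)

lemma qfree_map_fm: "qfree \<phi> \<Longrightarrow> qfree (rename h \<phi>)"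
proof (induction \<phi>)
  case (Conj F)
  have "range (rename h \<circ> F) = rename h ` range F" by (simp add: image_comp)
  with Conj have "finite (range (rename h \<circ> F))" by simp
  with Conj show ?case by simp
qed simp_all

lemma fv_map_fm:
  assumes "inj h \<or> qfree \<phi>"
  shows "fv (rename h \<phi>) = h ` fv \<phi>"
  using assms
proof (induction \<phi>)
  case (Ex v \<phi>)
  then show ?case by (auto simp: inj_image_mem_iff image_set_diff)
next
  case (Conj F)
  then have "fv (rename h (F n)) = h ` fv (F n)" for n by auto
  then show ?case by (simp add: image_UN)
qed (auto simp: trm.set_map)

text \<open>Bound variables are renamed along with the free ones, so the renaming has to be injective unless
there are no quantifiers.\<close>

lemma sat_map_fm:
  assumes "inj h \<or> qfree \<phi>"
  shows "sat M (rename h \<phi>) s \<longleftrightarrow> sat M \<phi> (\<lambda>v. s (h v))"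
  using assms
proof (induction \<phi> arbitrary: s)
  case (Rel r ts)
  have "map (tval M s) (map (map_trm (\<lambda>f. f) h) ts) = map (tval M (\<lambda>v. s (h v))) ts"
    by (simp add: tval_map_trm)
  then show ?case by (simp only: sat.simps fm.map)
next
  case (Neg \<phi>)
  then show ?case by (simp only: sat.simps fm.map fv.simps qfree.simps)
next
  case (Conj F)
  then have "sat M (rename h (F n)) s \<longleftrightarrow> sat M (F n) (\<lambda>v. s (h v))" for n by auto
  then show ?case by (simp only: sat.simps fm.map comp_def)
next
  case (Ex v \<phi>)
  then have "inj h" by simp
  have "sat M (rename h \<phi>) (s(h v := x)) \<longleftrightarrow> sat M \<phi> ((\<lambda>w. s (h w))(v := x))" for x
  proof -
    have "sat M (rename h \<phi>) (s(h v := x)) \<longleftrightarrow> sat M \<phi> (\<lambda>w. (s(h v := x)) (h w))"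
      by (rule Ex.IH) (use \<open>inj h\<close> in simp)
    also have "(\<lambda>w. (s(h v := x)) (h w)) = (\<lambda>w. s (h w))(v := x)"
      using \<open>inj h\<close> by (auto simp: fun_eq_iff inj_eq)
    finally show ?thesis .
  qed
  then show ?case by (simp only: sat.simps fm.map)
qed (simp add: tval_map_trm)


section \<open>Quantifier-free types as local isomorphisms\<close>

definition atomic :: "('f, 'r, 'v) fm \<Rightarrow> bool" where
  "atomic \<phi> \<longleftrightarrow> (\<exists>t u. \<phi> = Eq t u) \<or> (\<exists>r ts. \<phi> = Rel r ts)"

text \<open>The relation \<open>S\<close> need not be a function in the definition: applied to the formula \<open>x = y\<close>, the
condition makes it one, and an injective one. Using a set of pairs instead of two tuples makes the
order and repetitions of the entries irrelevant.\<close>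

definition local_iso :: "('f, 'r) lang \<Rightarrow> ('f, 'r, 'a, 'z) struct_scheme \<Rightarrow> ('a \<times> 'a) set \<Rightarrow> bool" where
  "local_iso L M S \<longleftrightarrow> (\<forall>(\<phi> :: ('f, 'r, nat) fm) s s'. wf_fm L \<phi> \<longrightarrow> qfree \<phi> \<longrightarrow>
     (\<forall>v \<in> fv \<phi>. (s v, s' v) \<in> S) \<longrightarrow> (sat M \<phi> s \<longleftrightarrow> sat M \<phi> s'))"

lemma local_iso_mono: "local_iso L M S \<Longrightarrow> T \<subseteq> S \<Longrightarrow> local_iso L M T"
  unfolding local_iso_def by blast

lemma local_isoD:
  fixes \<phi> :: "('f, 'r, nat) fm"
  assumes "local_iso L M S" "wf_fm L \<phi>" "qfree \<phi>" "\<And>v. v \<in> fv \<phi> \<Longrightarrow> (s v, s' v) \<in> S"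
  shows "sat M \<phi> s \<longleftrightarrow> sat M \<phi> s'"
  using assms unfolding local_iso_def by blast

lemma local_iso_Id: "S \<subseteq> Id \<Longrightarrow> local_iso L M S"
  unfolding local_iso_def by (intro allI impI sat_cong) auto

lemma local_iso_converse: "local_iso L M (S\<inverse>) \<longleftrightarrow> local_iso L M S"
proof -
  have "local_iso L M T" if "local_iso L M (T\<inverse>)" for T
    unfolding local_iso_def
  proof (intro allI impI)
    fix \<phi> :: "('a, 'b, nat) fm" and s s'
    assume "wf_fm L \<phi>" "qfree \<phi>" "\<forall>v\<in>fv \<phi>. (s v, s' v) \<in> T"
    then have "sat M \<phi> s' \<longleftrightarrow> sat M \<phi> s" by (intro local_isoD[OF that]) auto
    then show "sat M \<phi> s \<longleftrightarrow> sat M \<phi> s'" ..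
  qed
  from this[of S] this[of "S\<inverse>"] show ?thesis by auto
qed

lemma local_isoI_atomic:
  fixes L :: "('f, 'r) lang"
  assumes "\<And>(\<phi> :: ('f, 'r, nat) fm) s s'. atomic \<phi> \<Longrightarrow> wf_fm L \<phi> \<Longrightarrow> (\<And>v. v \<in> fv \<phi> \<Longrightarrow> (s v, s' v) \<in> S)
      \<Longrightarrow> sat M \<phi> s \<longleftrightarrow> sat M \<phi> s'"
  shows "local_iso L M S"
proof -
  have "sat M \<phi> s \<longleftrightarrow> sat M \<phi> s'" if "wf_fm L \<phi>" "qfree \<phi>" "\<forall>v \<in> fv \<phi>. (s v, s' v) \<in> S"
    for \<phi> :: "('f, 'r, nat) fm" and s s'
    using that
  proof (induction \<phi>)
    case (Eq t u)
    show ?case by (rule assms) (use Eq in \<open>auto simp: atomic_def\<close>)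
  next
    case (Rel r ts)
    show ?case by (rule assms) (use Rel in \<open>auto simp: atomic_def\<close>)
  qed auto
  then show ?thesis unfolding local_iso_def by blast
qed

definition graph :: "('i \<rightharpoonup> 'a) \<Rightarrow> ('i \<rightharpoonup> 'a) \<Rightarrow> ('a \<times> 'a) set" where
  "graph t t' = (\<lambda>i. (the (t i), the (t' i))) ` dom t"

lemma qftp_eq_iff_local_iso:
  fixes L :: "('f, 'r) lang" and t t' :: "'i :: countable \<rightharpoonup> 'a"
  shows "qftp L M t = qftp L M t' \<longleftrightarrow> dom t = dom t' \<and> local_iso L M (graph t t')"
proof (intro iffI conjI)
  assume eq: "qftp L M t = qftp L M t'"
  have "i \<in> dom t \<longleftrightarrow> Eq (Var i) (Var i) \<in> qftp L M t" for t :: "'i \<rightharpoonup> 'a" and i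
    by (simp add: qftp_def)
  with eq show dom: "dom t = dom t'" by blast
  show "local_iso L M (graph t t')"
    unfolding local_iso_def
  proof (intro allI impI)
    fix \<phi> :: "('f, 'r, nat) fm" and s s'
    assume \<phi>: "wf_fm L \<phi>" "qfree \<phi>" and "\<forall>v\<in>fv \<phi>. (s v, s' v) \<in> graph t t'"
    then have "\<forall>v\<in>fv \<phi>. \<exists>i. i \<in> dom t \<and> s v = the (t i) \<and> s' v = the (t' i)"
      unfolding graph_def image_iff by blast
    then obtain k where k: "\<forall>v\<in>fv \<phi>. k v \<in> dom t \<and> s v = the (t (k v)) \<and> s' v = the (t' (k v))"
      unfolding bchoice_iff by blast
    have "rename k \<phi> \<in> qftp L M t \<longleftrightarrow> rename k \<phi> \<in> qftp L M t'"
      using eq by simp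
    moreover have "rename k \<phi> \<in> qftp L M t \<longleftrightarrow> sat M \<phi> (\<lambda>v. the (t (k v)))"
      "rename k \<phi> \<in> qftp L M t' \<longleftrightarrow> sat M \<phi> (\<lambda>v. the (t' (k v)))"
      using k \<phi> dom by (auto simp: qftp_def wf_map_fm qfree_map_fm fv_map_fm sat_map_fm)
    moreover have "sat M \<phi> (\<lambda>v. the (t (k v))) \<longleftrightarrow> sat M \<phi> s"
      "sat M \<phi> (\<lambda>v. the (t' (k v))) \<longleftrightarrow> sat M \<phi> s'"
      using k by (auto intro!: sat_cong)
    ultimately show "sat M \<phi> s \<longleftrightarrow> sat M \<phi> s'" by blast
  qed
next
  assume "dom t = dom t' \<and> local_iso L M (graph t t')"
  then have dom: "dom t = dom t'" and iso: "local_iso L M (graph t t')" by auto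
  have "sat M \<phi> (\<lambda>i. the (t i)) \<longleftrightarrow> sat M \<phi> (\<lambda>i. the (t' i))"
    if "wf_fm L \<phi>" "qfree \<phi>" "fv \<phi> \<subseteq> dom t" for \<phi> :: "('f, 'r, 'i) fm"
  proof -
    have "sat M (rename to_nat \<phi>) (\<lambda>n. the (t (from_nat n))) \<longleftrightarrow>
        sat M (rename to_nat \<phi>) (\<lambda>n. the (t' (from_nat n)))"
      by (rule local_isoD[OF iso])
        (use that in \<open>auto simp: wf_map_fm qfree_map_fm fv_map_fm graph_def\<close>)
    then show ?thesis using that by (simp add: sat_map_fm comp_def)
  qed
  with dom show "qftp L M t = qftp L M t'" unfolding qftp_def by auto
qed

lemma graph_list_tuple: "length xs = length ys \<Longrightarrow> graph (list_tuple xs) (list_tuple ys) = set (zip xs ys)"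
  by (auto simp: graph_def list_tuple_def dom_def set_zip image_iff)

lemma dom_list_tuple: "dom (list_tuple xs) = {..<length xs}"
  by (auto simp: list_tuple_def split: if_splits)

lemma qftp_list_tuple_eq_iff:
  "qftp L M (list_tuple xs) = qftp L M (list_tuple ys) \<longleftrightarrow>
     length xs = length ys \<and> local_iso L M (set (zip xs ys))"
  unfolding qftp_eq_iff_local_iso dom_list_tuple by (auto simp: graph_list_tuple)

lemma dom_join_tuple: "dom (join_tuple t xs) = Inl ` dom t \<union> Inr ` {..<length xs}"
proof -
  have "i \<in> dom (join_tuple t xs) \<longleftrightarrow> i \<in> Inl ` dom t \<union> Inr ` dom (list_tuple xs)" for i
    by (cases i) (auto simp: join_tuple_def)
  then show ?thesis unfolding dom_list_tuple by blast
qed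

lemma graph_join_tuple:
  "length xs = length ys \<Longrightarrow> graph (join_tuple t xs) (join_tuple t' ys) = graph t t' \<union> set (zip xs ys)"
  unfolding graph_list_tuple[symmetric] graph_def dom_join_tuple dom_list_tuple[symmetric]
  by (simp add: image_Un image_image join_tuple_def)

lemma qftp_join_tuple_eq_iff:
  "qftp L M (join_tuple t xs) = qftp L M (join_tuple t' ys) \<longleftrightarrow>
     dom t = dom t' \<and> length xs = length ys \<and> local_iso L M (graph t t' \<union> set (zip xs ys))"
proof -
  have *: "Inl ` A \<union> Inr ` B = Inl ` A' \<union> Inr ` B' \<longleftrightarrow> A = A' \<and> B = B'" 
    for A A' B B' :: "nat set" by blast
  show ?thesis
    unfolding qftp_eq_iff_local_iso dom_join_tuple * using graph_join_tuple[of xs ys t t'] by auto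
qed

lemma local_iso_zipI:
  fixes L :: "('f, 'r) lang"
  assumes "length xs = length ys"
    and "\<And>\<phi> :: ('f, 'r, nat) fm. atomic \<phi> \<Longrightarrow> wf_fm L \<phi> \<Longrightarrow> fv \<phi> \<subseteq> {..<length xs} \<Longrightarrow>
      sat M \<phi> (nth xs) \<longleftrightarrow> sat M \<phi> (nth ys)"
  shows "local_iso L M (set (zip xs ys))"
proof (rule local_isoI_atomic)
  fix \<phi> :: "('f, 'r, nat) fm" and s s'
  assume \<phi>: "atomic \<phi>" "wf_fm L \<phi>" and "\<And>v. v \<in> fv \<phi> \<Longrightarrow> (s v, s' v) \<in> set (zip xs ys)"
  then have "\<forall>v\<in>fv \<phi>. \<exists>i. i < length xs \<and> s v = xs ! i \<and> s' v = ys ! i"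
    using assms(1) by (fastforce simp: set_zip)
  then obtain k where k: "\<forall>v\<in>fv \<phi>. k v < length xs \<and> s v = xs ! k v \<and> s' v = ys ! k v"
    by metis
  have [simp]: "qfree \<phi>" using \<phi> by (auto simp: atomic_def)
  have "sat M (rename k \<phi>) (nth xs) \<longleftrightarrow> sat M (rename k \<phi>) (nth ys)"
    by (rule assms(2)) (use \<phi> k in \<open>auto simp: wf_map_fm fv_map_fm, auto simp: atomic_def\<close>)
  moreover have "sat M \<phi> (\<lambda>v. xs ! k v) \<longleftrightarrow> sat M \<phi> s" "sat M \<phi> (\<lambda>v. ys ! k v) \<longleftrightarrow> sat M \<phi> s'"
    using k by (auto intro!: sat_cong)
  ultimately show "sat M \<phi> s \<longleftrightarrow> sat M \<phi> s'" by (simp add: sat_map_fm)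
qed


section \<open>Pregeometries\<close>

locale pregeom =
  fixes U :: "'a set" and c :: "'a set \<Rightarrow> 'a set"
  assumes pregeometry: "pregeometry U c"
begin

lemma cl_subset: "A \<subseteq> U \<Longrightarrow> c A \<subseteq> U"
  and cl_ext: "A \<subseteq> U \<Longrightarrow> A \<subseteq> c A"
  and cl_idem: "A \<subseteq> U \<Longrightarrow> c (c A) = c A"
  and cl_mono: "A \<subseteq> B \<Longrightarrow> B \<subseteq> U \<Longrightarrow> c A \<subseteq> c B"
  and cl_finitary: "A \<subseteq> U \<Longrightarrow> x \<in> c A \<Longrightarrow> \<exists>F. finite F \<and> F \<subseteq> A \<and> x \<in> c F"
  using pregeometry unfolding pregeometry_def by meson+

lemma cl_exchange:
  assumes "A \<subseteq> U" "y \<in> U" "x \<in> c (insert y A)" "x \<notin> c A"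
  shows "y \<in> c (insert x A)"
proof -
  have "x \<in> U" using assms cl_subset[of "insert y A"] by auto
  then show ?thesis using assms pregeometry unfolding pregeometry_def by meson
qed

lemma cl_minimal: "A \<subseteq> c B \<Longrightarrow> B \<subseteq> U \<Longrightarrow> c A \<subseteq> c B"
  using cl_mono[of A "c B"] cl_idem[of B] cl_subset[of B] by simp

lemma cl_minimalD: "x \<in> c A \<Longrightarrow> A \<subseteq> c B \<Longrightarrow> B \<subseteq> U \<Longrightarrow> x \<in> c B"
  using cl_minimal by blast

lemma cl_monoD: "x \<in> c A \<Longrightarrow> A \<subseteq> B \<Longrightarrow> B \<subseteq> U \<Longrightarrow> x \<in> c B"
  using cl_mono by blast

lemma cl_base: "x \<in> A \<Longrightarrow> A \<subseteq> U \<Longrightarrow> x \<in> c A"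
  using cl_ext by blast

lemma cl_closed_subset: "A \<subseteq> W \<Longrightarrow> W \<subseteq> U \<Longrightarrow> c W = W \<Longrightarrow> c A \<subseteq> W"
  using cl_mono by metis

lemma cl_finitary_Un:
  assumes "A \<subseteq> U" "B \<subseteq> U" "x \<in> c (A \<union> B)"
  obtains F where "finite F" "F \<subseteq> A" "x \<in> c (F \<union> B)"
proof -
  obtain G where G: "finite G" "G \<subseteq> A \<union> B" "x \<in> c G"
    using cl_finitary[of "A \<union> B" x] assms by blast
  have "x \<in> c ((G \<inter> A) \<union> B)"
    by (rule cl_monoD[OF G(3)]) (use G assms in auto)
  then show thesis using that[of "G \<inter> A"] G by auto
qed

lemma pregeometry_localize:
  assumes B: "B \<subseteq> U"
  shows "pregeometry U (localize c B)"
  unfolding pregeometry_def localize_def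
proof (intro conjI allI impI)
  fix A assume A: "A \<subseteq> U"
  then have AB: "A \<union> B \<subseteq> U" using B by simp
  show "A \<subseteq> c (A \<union> B)" "c (A \<union> B) \<subseteq> U" using cl_ext[OF AB] cl_subset[OF AB] by auto
  have "c (A \<union> B) \<union> B = c (A \<union> B)" using cl_ext[OF AB] by auto
  then show "c (c (A \<union> B) \<union> B) = c (A \<union> B)" using cl_idem[OF AB] by simp
  show "\<exists>F. finite F \<and> F \<subseteq> A \<and> x \<in> c (F \<union> B)" if "x \<in> c (A \<union> B)" for x
    by (rule cl_finitary_Un[OF A B that]) blast
  show "y \<in> c (insert x A \<union> B)"
    if "y \<in> U" "x \<in> c (insert y A \<union> B)" "x \<notin> c (A \<union> B)" for x y
    using cl_exchange[OF AB, of y x] that by simp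
next
  fix A A' assume "A \<subseteq> A'" "A' \<subseteq> U"
  then show "c (A \<union> B) \<subseteq> c (A' \<union> B)" using B by (intro cl_mono) auto
qed

text \<open>A set inside a finite-dimensional extension of \<open>Q\<close> is spanned over \<open>Q\<close> by finitely many of its own
elements. This turns density of a set with respect to its own finite subsets into density with
respect to finite sets that lie outside it.\<close>

lemma finite_cover:
  assumes "finite F" "F \<subseteq> U" "S \<subseteq> U" "Q \<subseteq> U" "S \<subseteq> c (Q \<union> F)"
  shows "\<exists>F'. finite F' \<and> F' \<subseteq> S \<and> S \<subseteq> c (Q \<union> F')"
  using assms(1,2,4,5)
proof (induction F arbitrary: Q)
  case empty
  then show ?case by (intro exI[of _ "{}"]) simp
next
  case (insert x F)
  have QF: "Q \<union> F \<subseteq> U" using insert.prems by auto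
  show ?case
  proof (cases "S \<subseteq> c (Q \<union> F)")
    case True
    then show ?thesis using insert by auto
  next
    case False
    then obtain y where y: "y \<in> S" "y \<notin> c (Q \<union> F)" by blast
    then have "y \<in> c (insert x (Q \<union> F))" using insert.prems by auto
    then have x: "x \<in> c (insert y (Q \<union> F))" using cl_exchange[OF QF] y insert.prems by simp
    have yU: "insert y (Q \<union> F) \<subseteq> U" using y assms(3) QF by auto
    have "c (Q \<union> insert x F) \<subseteq> c (insert y (Q \<union> F))"
      using x cl_ext[OF yU] by (intro cl_minimal yU) auto
    then have "S \<subseteq> c (insert y Q \<union> F)" using insert.prems by simp
    then obtain F' where F': "finite F'" "F' \<subseteq> S" "S \<subseteq> c (insert y Q \<union> F')"
      using insert.IH[of "insert y Q"] yU insert.prems by auto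
    then show ?thesis using y by (intro exI[of _ "insert y F'"]) auto
  qed
qed

text \<open>Steinitz exchange over a set \<open>A\<close>: the elements of \<open>W\<close> are replaced one after another by elements
of \<open>Z\<close>, which then move to \<open>A\<close>.\<close>

lemma independent_card_le:
  assumes "finite W" "W \<subseteq> U" "A \<subseteq> U" "Z \<subseteq> c (W \<union> A)" "\<And>z. z \<in> Z \<Longrightarrow> z \<notin> c ((Z - {z}) \<union> A)"
  shows "finite Z \<and> card Z \<le> card W"
  using assms
proof (induction W arbitrary: A Z)
  case empty
  have "Z = {}"
  proof (rule ccontr)
    assume "Z \<noteq> {}"
    then obtain z where z: "z \<in> Z" by blast
    then have "z \<in> c A" using empty by auto
    moreover have "c A \<subseteq> c ((Z - {z}) \<union> A)" 
      using empty.prems cl_subset[of A] by (intro cl_mono) auto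
    ultimately show False using empty.prems(4)[OF z] by blast
  qed
  then show ?case by simp
next
  case (insert w W)
  show ?case
  proof (cases "Z \<subseteq> c (W \<union> A)")
    case True
    then have "finite Z \<and> card Z \<le> card W" using insert.IH[OF _ _ True] insert.prems by auto
    then show ?thesis using insert.hyps by auto
  next
    case False
    then obtain z where z: "z \<in> Z" "z \<notin> c (W \<union> A)" by blast
    have WA: "W \<union> A \<subseteq> U" "insert w (W \<union> A) \<subseteq> U" using insert.prems by auto
    have ZU: "Z \<subseteq> U" using insert.prems(3) cl_subset[OF WA(2)] by auto
    have "z \<in> c (insert w (W \<union> A))" using z insert.prems by auto
    then have w: "w \<in> c (insert z (W \<union> A))" using cl_exchange[OF WA(1)] z insert.prems by simp
    have zU: "insert z (W \<union> A) \<subseteq> U" using z ZU WA by auto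
    have "c (insert w W \<union> A) \<subseteq> c (insert z (W \<union> A))"
      using w cl_ext[OF zU] by (intro cl_minimal zU) auto
    then have "Z - {z} \<subseteq> c (W \<union> insert z A)" using insert.prems by auto
    moreover have "y \<notin> c ((Z - {z} - {y}) \<union> insert z A)" if "y \<in> Z - {z}" for y
    proof -
      have "(Z - {z} - {y}) \<union> insert z A = (Z - {y}) \<union> A" using that z by auto
      then show ?thesis using insert.prems(4)[of y] that by auto
    qed
    ultimately have "finite (Z - {z}) \<and> card (Z - {z}) \<le> card W"
      using insert.IH[of "insert z A" "Z - {z}"] insert.prems z ZU by auto
    then show ?thesis using z insert.hyps by (auto simp: card_Diff_singleton)
  qed
qed

lemma basis_exists:
  assumes "finite X" "X \<subseteq> U"
  shows "\<exists>Y. basis_of c Y X"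
  using assms
proof (induction X)
  case empty
  then show ?case by (auto simp: basis_of_def)
next
  case (insert x X)
  then obtain Y where Y: "Y \<subseteq> X" "X \<subseteq> c Y" "\<forall>y\<in>Y. y \<notin> c (Y - {y})" unfolding basis_of_def by auto
  have YU: "Y \<subseteq> U" "insert x Y \<subseteq> U" using Y insert.prems by auto
  show ?case
  proof (cases "x \<in> c Y")
    case True
    then show ?thesis using Y by (auto simp: basis_of_def)
  next
    case False
    have "y \<notin> c (insert x Y - {y})" if y: "y \<in> insert x Y" for y
    proof (cases "y = x")
      case True
      then have "insert x Y - {y} \<subseteq> Y" by auto
      then show ?thesis using False True YU cl_mono by blast
    next
      case neq: False
      then have *: "insert x Y - {y} = insert x (Y - {y})" and "y \<in> Y" using y by auto
      have "x \<in> c Y" if "y \<in> c (insert x (Y - {y}))"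
        using cl_exchange[of "Y - {y}" x y] that Y(3) \<open>y \<in> Y\<close> YU by (auto simp: insert_absorb)
      then show ?thesis using False * by auto
    qed
    moreover have "insert x X \<subseteq> c (insert x Y)"
      using Y(2) cl_mono[of Y "insert x Y"] cl_ext[of "insert x Y"] YU by auto
    ultimately show ?thesis using Y(1) unfolding basis_of_def by (intro exI[of _ "insert x Y"]) auto
  qed
qed

lemma fdim_eq_card_basis:
  assumes "finite X" "X \<subseteq> U" "basis_of c Y X"
  shows "fdim c X = card Y"
proof -
  have le: "card Z \<le> card Y" if "basis_of c Z X" "basis_of c Y X" for Y Z
  proof -
    have "Z \<subseteq> c (Y \<union> {})" "finite Y" "Y \<subseteq> U" using that assms by (auto simp: basis_of_def intro: finite_subset)
    then show ?thesis using independent_card_le[of Y "{}" Z] that by (auto simp: basis_of_def)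
  qed
  then show ?thesis unfolding fdim_def using assms(3)
    by (intro the_equality) (auto intro: antisym)
qed

text \<open>If \<open>c ps\<close> and \<open>c (a, ns)\<close> met only inside \<open>c ns\<close>, modularity would make \<open>ps\<close> independent from
\<open>a, ns\<close> over a subset of \<open>c ns\<close>; but \<open>a\<close> depends on \<open>ps\<close> over \<open>ns\<close>, so adding \<open>a\<close> lowers the dimension
of \<open>ps\<close>. A point \<open>q\<close> of the intersection outside \<open>c ns\<close> can be exchanged with \<open>a\<close>.\<close>

lemma modular_point:
  assumes mod: "modular U c" and U: "set ps \<subseteq> U" "set ns \<subseteq> U"
    and a: "a \<in> c (set ps \<union> set ns)" "a \<notin> c (set ns)"
  shows "\<exists>q \<in> c (set ps). a \<in> c (insert q (set ns))"
proof -
  let ?n = "set ns" and ?p = "set ps"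
  define C where "C = c ?p \<inter> c (insert a ?n)"
  have pn: "?p \<union> ?n \<subseteq> U" using U by auto
  have aU: "a \<in> U" using a(1) cl_subset[OF pn] by blast
  have an: "insert a ?n \<subseteq> U" using aU U by auto
  have CU: "C \<subseteq> U" using cl_subset[OF U(1)] by (auto simp: C_def)
  have anC: "insert a ?n \<union> C \<subseteq> U" using an CU by auto
  have "indep_over c ps C (set (a # ns))"
    using mod U aU unfolding modular_def C_def by (metis insert_subset list.simps(15))
  then have dims: "fdim (localize c (insert a ?n \<union> C)) ?p = fdim (localize c C) ?p"
    by (simp add: indep_over_def dim_over_def)
  have "\<not> C \<subseteq> c ?n"
  proof
    assume C: "C \<subseteq> c ?n"
    interpret C: pregeom U "localize c C" using pregeometry_localize[OF CU] by unfold_locales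
    interpret anC: pregeom U "localize c (insert a ?n \<union> C)" using pregeometry_localize[OF anC] by unfold_locales
    obtain Y where Y: "basis_of (localize c C) Y ?p" using C.basis_exists U by blast
    obtain Z where Z: "basis_of (localize c (insert a ?n \<union> C)) Z ?p" using anC.basis_exists U by blast
    have card: "card Z = card Y"
      using dims C.fdim_eq_card_basis[OF _ U(1) Y] anC.fdim_eq_card_basis[OF _ U(1) Z] by simp
    have Yp: "Y \<subseteq> ?p" "finite Y" "Y \<subseteq> U" using Y U by (auto simp: basis_of_def intro: finite_subset)
    have Yn: "Y \<union> ?n \<subseteq> U" using Yp U by auto
    have "C \<subseteq> c (Y \<union> ?n)" using C cl_mono[of ?n "Y \<union> ?n"] Yn by auto
    then have "c (Y \<union> C) \<subseteq> c (Y \<union> ?n)" using cl_ext[OF Yn] by (intro cl_minimal Yn) auto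
    then have p_Yn: "?p \<subseteq> c (Y \<union> ?n)" using Y by (auto simp: basis_of_def localize_def)
    then have "a \<in> c (Y \<union> ?n)" using a(1) cl_ext[OF Yn] by (intro cl_minimalD[OF a(1) _ Yn]) auto
    \<comment> \<open>Removing elements of \<open>Y\<close> until \<open>a\<close> stops depending on them isolates some \<open>y\<close> to exchange with \<open>a\<close>.\<close>
    then obtain y Y1 where Y1: "insert y Y1 \<subseteq> Y" "y \<notin> Y1" "a \<in> c (insert y (Y1 \<union> ?n))" "a \<notin> c (Y1 \<union> ?n)"
    proof -
      have "\<exists>y Y1. insert y Y1 \<subseteq> Y \<and> y \<notin> Y1 \<and> a \<in> c (insert y (Y1 \<union> ?n)) \<and> a \<notin> c (Y1 \<union> ?n)"
        if "a \<in> c (Y \<union> ?n)" "finite Y" for Y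
        using that(2,1)
      proof (induction Y)
        case empty
        then show ?case using a(2) by simp
      next
        case (insert y Y)
        show ?case
        proof (cases "a \<in> c (Y \<union> ?n)")
          case True
          then show ?thesis using insert.IH by blast
        next
          case False
          then show ?thesis using insert by auto
        qed
      qed
      then show thesis using that \<open>a \<in> c (Y \<union> ?n)\<close> Yp(2) by blast
    qed
    let ?W = "Y - {y}"
    have y: "y \<in> c (insert a (Y1 \<union> ?n))"
      using cl_exchange[of "Y1 \<union> ?n" y a] Y1 Yp U by auto
    have WanC: "?W \<union> (insert a ?n \<union> C) \<subseteq> U" using Yp anC by auto
    have "insert a (Y1 \<union> ?n) \<subseteq> ?W \<union> (insert a ?n \<union> C)" using Y1 by auto
    then have "y \<in> c (?W \<union> (insert a ?n \<union> C))" using y cl_mono WanC by blast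
    then have "Y \<union> ?n \<subseteq> c (?W \<union> (insert a ?n \<union> C))" using cl_ext[OF WanC] by auto
    then have "c (Y \<union> ?n) \<subseteq> c (?W \<union> (insert a ?n \<union> C))" by (intro cl_minimal WanC)
    then have "Z \<subseteq> c (?W \<union> (insert a ?n \<union> C))" using p_Yn Z by (auto simp: basis_of_def)
    then have "card Z \<le> card ?W"
      using independent_card_le[of ?W "insert a ?n \<union> C" Z] Yp anC Z
      by (auto simp: basis_of_def localize_def)
    moreover have "card ?W < card Y" using Y1 Yp by (intro psubset_card_mono) auto
    ultimately show False using card by simp
  qed
  then obtain q where q: "q \<in> c ?p" "q \<in> c (insert a ?n)" "q \<notin> c ?n" by (auto simp: C_def)
  then have "a \<in> c (insert q ?n)" using cl_exchange[OF U(2) aU] by blast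
  then show ?thesis using q(1) by blast
qed

lemma finite_subset_span:
  assumes "A \<subseteq> U" "finite F" "F \<subseteq> c A"
  shows "\<exists>G. finite G \<and> G \<subseteq> A \<and> F \<subseteq> c G"
  using assms(2,3)
proof (induction F)
  case (insert x F)
  then obtain G where G: "finite G" "G \<subseteq> A" "F \<subseteq> c G" by auto
  obtain H where H: "finite H" "H \<subseteq> A" "x \<in> c H" using cl_finitary[OF assms(1), of x] insert.prems by auto
  have GH: "G \<union> H \<subseteq> U" using G H assms(1) by auto
  have "insert x F \<subseteq> c (G \<union> H)"
    using G(3) H(3) cl_mono[OF Un_upper1 GH] cl_mono[OF Un_upper2 GH] by auto
  then show ?case using G H by (intro exI[of _ "G \<union> H"]) auto
qed auto

text \<open>Independence of each term from its predecessors already gives independence from all other terms: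
a dependence can be solved for its last term.\<close>

lemma sequentially_independent:
  fixes h :: "nat \<Rightarrow> 'a"
  assumes Q: "Q \<subseteq> U" and h: "range h \<subseteq> U" and ind: "\<And>n. h n \<notin> c (Q \<union> h ` {..<n})"
  shows "h i \<notin> c (Q \<union> h ` (UNIV - {i}))"
proof
  have sub: "Q \<union> h ` X \<subseteq> U" for X using Q h by auto
  have mono: "c (Q \<union> h ` X) \<subseteq> c (Q \<union> h ` Y)" if "X \<subseteq> Y" for X Y
    using that by (intro cl_mono sub) auto
  have fin: "h i \<notin> c (Q \<union> h ` ({..<n} - {i}))" for n
  proof (induction n)
    case 0
    then show ?case using ind[of i] mono[of "{}" "{..<i}"] by auto
  next
    case (Suc n)
    consider "n < i" | "n = i" | "i < n" by linarith
    then show ?case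
    proof cases
      case 1
      then have "{..<Suc n} - {i} \<subseteq> {..<i}" by auto
      then show ?thesis using ind[of i] mono[of "{..<Suc n} - {i}" "{..<i}"] by blast
    next
      case 2
      then have "{..<Suc n} - {i} = {..<n} - {i}" by auto
      then show ?thesis using Suc by simp
    next
      case 3
      show ?thesis
      proof
        assume "h i \<in> c (Q \<union> h ` ({..<Suc n} - {i}))"
        moreover have "{..<Suc n} - {i} = insert n ({..<n} - {i})" using 3 by auto
        ultimately have "h i \<in> c (insert (h n) (Q \<union> h ` ({..<n} - {i})))" by simp
        then have "h n \<in> c (insert (h i) (Q \<union> h ` ({..<n} - {i})))"
          using cl_exchange[OF sub] Suc h by blast
        moreover have "insert (h i) (Q \<union> h ` ({..<n} - {i})) = Q \<union> h ` {..<n}" using 3 by auto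
        ultimately show False using ind[of n] by simp
      qed
    qed
  qed
  assume "h i \<in> c (Q \<union> h ` (UNIV - {i}))"
  then have hi: "h i \<in> c (h ` (UNIV - {i}) \<union> Q)" by (simp add: Un_commute)
  have "h ` (UNIV - {i}) \<subseteq> U" using h by auto
  then obtain F where F: "finite F" "F \<subseteq> h ` (UNIV - {i})" "h i \<in> c (F \<union> Q)"
    by (rule cl_finitary_Un[OF _ Q hi])
  then obtain K where K: "K \<subseteq> UNIV - {i}" "finite K" "F = h ` K" using finite_subset_image by metis
  then obtain n where "K \<subseteq> {..<n}" using finite_nat_iff_bounded by blast
  then have "c (Q \<union> h ` K) \<subseteq> c (Q \<union> h ` ({..<n} - {i}))" using K(1) by (intro mono) auto
  then show False using F(3) K(3) fin[of n] by (auto simp: Un_commute)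
qed

lemma independent_sequence_exists:
  assumes S: "S \<subseteq> U" and Q: "Q \<subseteq> U" and ex: "\<And>F. finite F \<Longrightarrow> F \<subseteq> S \<Longrightarrow> \<exists>x \<in> S. x \<notin> c (Q \<union> F)"
  shows "\<exists>h :: nat \<Rightarrow> 'a. range h \<subseteq> S \<and> (\<forall>i. h i \<notin> c (Q \<union> h ` (UNIV - {i})))"
proof -
  have "\<exists>h :: nat \<Rightarrow> 'a. \<forall>n. h n \<in> S \<and> h n \<notin> c (Q \<union> h ` {..<n})"
  proof (rule dependent_wellorder_choice)
    fix r and f g :: "nat \<Rightarrow> 'a" and n
    assume "\<And>m. m < n \<Longrightarrow> f m = g m"
    then have "f ` {..<n} = g ` {..<n}" by auto
    then show "(r \<in> S \<and> r \<notin> c (Q \<union> f ` {..<n})) = (r \<in> S \<and> r \<notin> c (Q \<union> g ` {..<n}))" by simp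
  next
    fix n and f :: "nat \<Rightarrow> 'a"
    assume "\<And>m. m < n \<Longrightarrow> f m \<in> S \<and> f m \<notin> c (Q \<union> f ` {..<m})"
    then have "f ` {..<n} \<subseteq> S" by auto
    then show "\<exists>r. r \<in> S \<and> r \<notin> c (Q \<union> f ` {..<n})" using ex[of "f ` {..<n}"] by auto
  qed
  then obtain h :: "nat \<Rightarrow> 'a" where h: "\<And>n. h n \<in> S" "\<And>n. h n \<notin> c (Q \<union> h ` {..<n})" by blast
  have "range h \<subseteq> U" using h(1) S by auto
  then have "h i \<notin> c (Q \<union> h ` (UNIV - {i}))" for i by (rule sequentially_independent[OF Q _ h(2)])
  then show ?thesis using h(1) by (intro exI[of _ h]) auto
qed

lemma independent_not_covered:
  fixes h :: "nat \<Rightarrow> 'a"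
  assumes Q: "Q \<subseteq> U" and h: "range h \<subseteq> U" "\<And>i. h i \<notin> c (Q \<union> h ` (UNIV - {i}))"
    and I: "infinite I" and F: "finite F" "F \<subseteq> U"
  shows "\<exists>i \<in> I. h i \<notin> c (Q \<union> F)"
proof (rule ccontr)
  assume "\<not> ?thesis"
  then have cov: "h ` I \<subseteq> c (Q \<union> F)" by auto
  have "h ` I \<subseteq> U" using h by auto
  then obtain F' where F': "finite F'" "F' \<subseteq> h ` I" "h ` I \<subseteq> c (Q \<union> F')"
    using finite_cover[OF F _ Q cov] by blast
  then obtain K where K: "K \<subseteq> I" "finite K" "F' = h ` K" using finite_subset_image by metis
  obtain i where i: "i \<in> I" "i \<notin> K" using I K by (metis finite_subset subsetI)
  have "c (Q \<union> F') \<subseteq> c (Q \<union> h ` (UNIV - {i}))"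
    using K i Q h(1) by (intro cl_mono) auto
  then show False using F'(3) i(1) h(2)[of i] by blast
qed

text \<open>Among the finite sets whose closure contains a point that no single element accounts for, one of
least cardinality works.\<close>

lemma nontrivial_dependence:
  assumes "\<not> disintegrated U c"
  shows "\<exists>a A x y. finite A \<and> A \<subseteq> U \<and> x \<in> A \<and> y \<in> A \<and> x \<noteq> y \<and> a \<in> c A \<and> (\<forall>z \<in> A. a \<notin> c (A - {z}))"
proof -
  obtain A where A: "A \<subseteq> U" "A \<noteq> {}" "c A \<noteq> (\<Union>x \<in> A. c {x})"
    using assms unfolding disintegrated_def by blast
  have "c {x} \<subseteq> c A" if "x \<in> A" for x using that A(1) by (intro cl_mono) auto
  then obtain a where a: "a \<in> c A" "\<And>x. x \<in> A \<Longrightarrow> a \<notin> c {x}" using A(3) by blast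
  define Sp where "Sp F \<longleftrightarrow> finite F \<and> F \<subseteq> A \<and> a \<in> c F" for F
  obtain F0 where "Sp F0" using cl_finitary[OF A(1) a(1)] unfolding Sp_def by blast
  then obtain F where F: "Sp F" "\<And>G. Sp G \<Longrightarrow> card F \<le> card G"
    using ex_has_least_nat[of Sp F0 card] by blast
  have min: "a \<notin> c (F - {z})" if "z \<in> F" for z
  proof
    assume "a \<in> c (F - {z})"
    then have "Sp (F - {z})" using F(1) by (auto simp: Sp_def)
    then have "card F \<le> card (F - {z})" by (rule F(2))
    moreover have "card (F - {z}) < card F" using F(1) that by (intro psubset_card_mono) (auto simp: Sp_def)
    ultimately show False by simp
  qed
  obtain x0 where x0: "x0 \<in> A" using A(2) by blast
  have "c {} \<subseteq> c {x0}" using x0 A(1) by (intro cl_mono) auto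
  then have "F \<noteq> {}" using F(1) a(2)[OF x0] by (auto simp: Sp_def)
  then obtain x where x: "x \<in> F" by blast
  have "F \<noteq> {x}" using F(1) a(2)[of x] by (auto simp: Sp_def)
  then obtain y where "y \<in> F" "y \<noteq> x" using x by blast
  then show ?thesis using F(1) x min A(1) unfolding Sp_def
    by (intro exI[of _ a] exI[of _ F] exI[of _ x] exI[of _ y]) auto
qed

end


section \<open>Homogeneity of quasiminimal classes over finite sets\<close>

text \<open>What is left of QM1, QM4 and QM5 when only closures of finite sets are considered. In this form the
axioms pass to unions of chains, where an infinite countable closed set need not lie in any member
of the chain.\<close>

definition finitely_homogeneous :: "('f, 'r) lang \<Rightarrow> ('f, 'r, 'a) pgstruct \<Rightarrow> bool" where
  "finitely_homogeneous L M \<longleftrightarrow> is_pgstruct L M \<and>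
     (\<forall>S. finite S \<longrightarrow> S \<subseteq> univ M \<times> univ M \<longrightarrow> local_iso L M S \<longrightarrow>
       (\<forall>a \<in> univ M. \<forall>a' \<in> univ M. local_iso L M (insert (a, a') S) \<longrightarrow>
          (a \<in> clo M (fst ` S) \<longleftrightarrow> a' \<in> clo M (snd ` S))) \<and>
       (\<forall>a \<in> clo M (fst ` S). \<exists>a' \<in> clo M (snd ` S). local_iso L M (insert (a, a') S)) \<and>
       (\<forall>a \<in> univ M - clo M (fst ` S). \<forall>a' \<in> univ M - clo M (snd ` S).
          local_iso L M (insert (a, a') S)))"

lemma finitely_homogeneousD:
  assumes "finitely_homogeneous L M" "finite S" "S \<subseteq> univ M \<times> univ M" "local_iso L M S"
  shows homogeneous_closure_iff: "a \<in> univ M \<Longrightarrow> a' \<in> univ M \<Longrightarrow> local_iso L M (insert (a, a') S) \<Longrightarrow>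
          a \<in> clo M (fst ` S) \<longleftrightarrow> a' \<in> clo M (snd ` S)"
    and homogeneous_extend_closure: "a \<in> clo M (fst ` S) \<Longrightarrow>
          \<exists>a' \<in> clo M (snd ` S). local_iso L M (insert (a, a') S)"
    and homogeneous_extend_generic: "a \<in> univ M \<Longrightarrow> a \<notin> clo M (fst ` S) \<Longrightarrow>
          a' \<in> univ M \<Longrightarrow> a' \<notin> clo M (snd ` S) \<Longrightarrow> local_iso L M (insert (a, a') S)"
proof -
  note * = assms(1)[unfolded finitely_homogeneous_def, THEN conjunct2, THEN spec, THEN mp, THEN mp, THEN mp, OF assms(2-4)]
  show "a \<in> clo M (fst ` S) \<longleftrightarrow> a' \<in> clo M (snd ` S)"
    if "a \<in> univ M" "a' \<in> univ M" "local_iso L M (insert (a, a') S)"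
    using *[THEN conjunct1] that by blast
  show "\<exists>a' \<in> clo M (snd ` S). local_iso L M (insert (a, a') S)" if "a \<in> clo M (fst ` S)"
    using *[THEN conjunct2, THEN conjunct1] that by blast
  show "local_iso L M (insert (a, a') S)"
    if "a \<in> univ M" "a \<notin> clo M (fst ` S)" "a' \<in> univ M" "a' \<notin> clo M (snd ` S)"
    using *[THEN conjunct2, THEN conjunct2] that by blast
qed

text \<open>Enumerates a countable relation as a pair of tuples, in the form required by QM4.\<close>

lemma countable_tuples:
  assumes "countable S"
  obtains t t' :: "nat \<rightharpoonup> 'a" where "dom t = dom t'" "graph t t' = S" "ran t = fst ` S" "ran t' = snd ` S"
proof (cases "S = {}")
  case True
  then show thesis using that[of Map.empty Map.empty] by (simp add: graph_def)
next
  case False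
  let ?e = "from_nat_into S"
  have "range ?e = S" using assms False by (rule range_from_nat_into[rotated])
  have ran: "ran (\<lambda>i. Some (f (?e i))) = f ` S" for f :: "'a \<times> 'a \<Rightarrow> 'a"
  proof -
    have "ran (\<lambda>i. Some (f (?e i))) = f ` range ?e" by (auto simp: ran_def)
    with \<open>range ?e = S\<close> show ?thesis by simp
  qed
  have "graph (\<lambda>i. Some (fst (?e i))) (\<lambda>i. Some (snd (?e i))) = range ?e"
    by (simp add: graph_def dom_def)
  with \<open>range ?e = S\<close> show thesis
    using that[of "\<lambda>i. Some (fst (?e i))" "\<lambda>i. Some (snd (?e i))"] ran[of fst] ran[of snd]
    by (simp add: dom_def)
qed

lemma local_iso_chain:
  fixes L :: "('b, 'c) lang"
  assumes "\<And>n :: nat. local_iso L M (S n)" "\<And>n. S n \<subseteq> S (Suc n)"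
  shows "local_iso L M (\<Union>n. S n)"
  unfolding local_iso_def
proof (intro allI impI)
  fix \<phi> :: "('b, 'c, nat) fm" and s s'
  assume \<phi>: "wf_fm L \<phi>" "qfree \<phi>" and "\<forall>v\<in>fv \<phi>. (s v, s' v) \<in> (\<Union>n. S n)"
  then obtain k where k: "\<forall>v\<in>fv \<phi>. (s v, s' v) \<in> S (k v)" by (simp add: bchoice_iff) blast
  have fin: "finite (k ` fv \<phi>)" using finite_fv_qfree \<phi> by blast
  have "(s v, s' v) \<in> S (Max (insert 0 (k ` fv \<phi>)))" if "v \<in> fv \<phi>" for v
  proof -
    have "S (k v) \<subseteq> S (Max (insert 0 (k ` fv \<phi>)))"
      by (rule lift_Suc_mono_le[of S]) (use assms(2) fin that in auto)
    then show ?thesis using k that by blast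
  qed
  then show "sat M \<phi> s \<longleftrightarrow> sat M \<phi> s'"
    by (intro local_isoD[OF assms(1) \<phi>])
qed

lemma quasiminimal_QM1:
  assumes "QM1 L M" "finite S" "S \<subseteq> univ M \<times> univ M" "local_iso L M (insert (a, a') S)"
    and "a \<in> univ M" "a' \<in> univ M"
  shows "a \<in> clo M (fst ` S) \<longleftrightarrow> a' \<in> clo M (snd ` S)"
proof -
  obtain zs where zs: "set zs = S" using assms(2) finite_list by blast
  have "qftp L M (list_tuple (a # map fst zs)) = qftp L M (list_tuple (a' # map snd zs))"
    unfolding qftp_list_tuple_eq_iff using assms(4) by (simp add: zip_map_fst_snd zs)
  moreover have "set (map fst zs) \<subseteq> univ M" "set (map snd zs) \<subseteq> univ M"
    using assms(3) zs by auto
  ultimately have "a \<in> clo M (set (map fst zs)) \<longleftrightarrow> a' \<in> clo M (set (map snd zs))"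
    using assms(1,5,6) unfolding QM1_def by blast
  then show ?thesis by (simp add: zs)
qed

lemma quasiminimal_QM5:
  assumes "QM5 L M" "finite S" "S \<subseteq> univ M \<times> univ M" "local_iso L M S" "a \<in> clo M (fst ` S)"
  shows "\<exists>a' \<in> univ M. local_iso L M (insert (a, a') S)"
proof -
  obtain zs where zs: "set zs = S" using assms(2) finite_list by blast
  have g: "graph Map.empty Map.empty = {}" by (simp add: graph_def)
  have "qftp L M (join_tuple Map.empty (map fst zs)) = qftp L M (join_tuple Map.empty (map snd zs))"
    unfolding qftp_join_tuple_eq_iff using assms(4) by (simp add: zip_map_fst_snd zs g)
  moreover have "set (map fst zs) \<subseteq> univ M" "set (map snd zs) \<subseteq> univ M"
    using assms(3) zs by auto
  moreover have "a \<in> clo M (ran Map.empty \<union> set (map fst zs))"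
    using assms(5) zs by simp
  ultimately have "\<exists>a' \<in> univ M. qftp L M (join_tuple Map.empty (map fst zs @ [a])) =
      qftp L M (join_tuple Map.empty (map snd zs @ [a']))"
    by (intro assms(1)[unfolded QM5_def, rule_format]) simp_all
  then show ?thesis
    unfolding qftp_join_tuple_eq_iff by (auto simp: zip_map_fst_snd zs g)
qed

text \<open>QM4 compares generic elements over enumerated closed sets. A finite local isomorphism is first
extended, by QM5 and back and forth, to one between the countable closures of its domain and range.\<close>

lemma quasiminimal_generic_unique:
  assumes M: "quasiminimal_pg L M" and S: "finite S" "S \<subseteq> univ M \<times> univ M" "local_iso L M S"
    and a: "a \<in> univ M - clo M (fst ` S)" and a': "a' \<in> univ M - clo M (snd ` S)"
  shows "local_iso L M (insert (a, a') S)"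
proof -
  interpret pregeom "univ M" "clo M"
    using M by unfold_locales (simp add: quasiminimal_pg_def is_pgstruct_def)
  have QM: "QM1 L M" "QM3 M" "QM4 L M" "QM5 L M" using M by (auto simp: quasiminimal_pg_def)
  let ?A = "clo M (fst ` S)" and ?B = "clo M (snd ` S)"
  have sub: "fst ` S \<subseteq> univ M" "snd ` S \<subseteq> univ M" using S(2) by auto
  have AB: "?A \<subseteq> univ M" "?B \<subseteq> univ M" using sub cl_subset by auto
  have count: "countable ?A" "countable ?B"
    using QM(2) S(1) sub unfolding QM3_def by auto
  \<comment> \<open>The finite stages of the back-and-forth between the closures \<open>?A\<close> and \<open>?B\<close>.\<close>
  define Inv where "Inv T \<longleftrightarrow> finite T \<and> local_iso L M T \<and> S \<subseteq> T \<and> T \<subseteq> ?A \<times> ?B" for T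
  have Inv_cl: "clo M (fst ` T) = ?A" "clo M (snd ` T) = ?B" "fst ` T \<subseteq> univ M" "snd ` T \<subseteq> univ M" if "Inv T" for T
  proof -
    have "fst ` S \<subseteq> fst ` T" "snd ` S \<subseteq> snd ` T" using that unfolding Inv_def by auto
    moreover have *: "fst ` T \<subseteq> ?A" "snd ` T \<subseteq> ?B" using that unfolding Inv_def by auto
    ultimately show "clo M (fst ` T) = ?A" "clo M (snd ` T) = ?B"
      by (meson AB sub cl_minimal cl_mono order.trans subset_antisym)+
    show "fst ` T \<subseteq> univ M" "snd ` T \<subseteq> univ M" using * AB by auto
  qed
  have forth: "\<exists>y. Inv (insert (x, y) T)" if T: "Inv T" and x: "x \<in> ?A" for T x
  proof -
    have TU: "T \<subseteq> univ M \<times> univ M" using T AB unfolding Inv_def by auto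
    obtain y where y: "y \<in> univ M" "local_iso L M (insert (x, y) T)"
      using quasiminimal_QM5[OF QM(4) _ TU, of x] T x Inv_cl[OF T] unfolding Inv_def by auto
    moreover have "y \<in> ?B"
      using quasiminimal_QM1[OF QM(1) _ TU y(2)] y(1) T x AB Inv_cl[OF T] unfolding Inv_def by auto
    ultimately show ?thesis using T x unfolding Inv_def by auto
  qed
  have backw: "\<exists>x. Inv (insert (x, y) T)" if T: "Inv T" and y: "y \<in> ?B" for T y
  proof -
    have TU: "T\<inverse> \<subseteq> univ M \<times> univ M" using T AB unfolding Inv_def by auto
    have im: "fst ` (T\<inverse>) = snd ` T" "snd ` (T\<inverse>) = fst ` T" for T :: "('c \<times> 'c) set" by force+
    obtain x where x: "x \<in> univ M" "local_iso L M (insert (y, x) (T\<inverse>))"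
      using quasiminimal_QM5[OF QM(4) _ TU, of y] T y Inv_cl[OF T] unfolding Inv_def
      by (auto simp: local_iso_converse im)
    moreover have "x \<in> ?A"
      using quasiminimal_QM1[OF QM(1) _ TU x(2)] x(1) T y AB Inv_cl[OF T] unfolding Inv_def by (auto simp: im)
    moreover have "insert (y, x) (T\<inverse>) = (insert (x, y) T)\<inverse>" by auto
    ultimately show ?thesis using T y unfolding Inv_def by (auto simp: local_iso_converse)
  qed
  have "S \<subseteq> ?A \<times> ?B"
    using subset_fst_snd Sigma_mono[OF cl_ext[OF sub(1)] cl_ext[OF sub(2)]] by (rule order.trans)
  then have "Inv S" using S unfolding Inv_def by simp
  then have "\<exists>T. Inv T" ..
  define Next where "Next n T T' \<longleftrightarrow> T \<subseteq> T' \<and> (?A \<noteq> {} \<longrightarrow> from_nat_into ?A n \<in> fst ` T') \<and>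
      (?B \<noteq> {} \<longrightarrow> from_nat_into ?B n \<in> snd ` T')" for n T T'
  have step: "\<exists>T'. Inv T' \<and> Next n T T'" if "Inv T" for T n
  proof -
    have "\<exists>T'. Inv T' \<and> T \<subseteq> T' \<and> (?A \<noteq> {} \<longrightarrow> from_nat_into ?A n \<in> fst ` T')"
    proof (cases "?A = {}")
      case False
      from forth[OF that from_nat_into[OF False, of n]]
      obtain y where "Inv (insert (from_nat_into ?A n, y) T)" by blast
      then show ?thesis by (intro exI[of _ "insert (from_nat_into ?A n, y) T"]) auto
    qed (use that in auto)
    then obtain T' where T': "Inv T'" "T \<subseteq> T'" "?A \<noteq> {} \<longrightarrow> from_nat_into ?A n \<in> fst ` T'" by blast
    show ?thesis
    proof (cases "?B = {}")
      case False
      from backw[OF T'(1) from_nat_into[OF False, of n]]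
      obtain x where "Inv (insert (x, from_nat_into ?B n) T')" by blast
      then show ?thesis using T'(2,3) unfolding Next_def
        by (intro exI[of _ "insert (x, from_nat_into ?B n) T'"]) auto
    qed (use T' in \<open>auto simp: Next_def\<close>)
  qed
  obtain T where T_step: "\<And>n. Inv (T n)" "\<And>n. Next n (T n) (T (Suc n))"
    using dependent_nat_choice[of "\<lambda>_. Inv" Next, OF _ step] \<open>\<exists>T. Inv T\<close> by metis
  then have T: "\<And>n. Inv (T n)" "\<And>n. T n \<subseteq> T (Suc n)"
    "\<And>n. ?A \<noteq> {} \<longrightarrow> from_nat_into ?A n \<in> fst ` T (Suc n)"
    "\<And>n. ?B \<noteq> {} \<longrightarrow> from_nat_into ?B n \<in> snd ` T (Suc n)"
    unfolding Next_def by auto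
  let ?T = "\<Union>n. T n"
  have iso: "local_iso L M ?T" by (rule local_iso_chain) (use T in \<open>auto simp: Inv_def\<close>)
  have "fst ` ?T = ?A"
  proof
    show "fst ` ?T \<subseteq> ?A" using T(1) unfolding Inv_def by fastforce
    show "?A \<subseteq> fst ` ?T"
    proof
      fix x assume x: "x \<in> ?A"
      then obtain n where "x = from_nat_into ?A n" using from_nat_into_surj[OF count(1) x] by metis
      then have "x \<in> fst ` T (Suc n)" using T(3)[of n] x by auto
      then show "x \<in> fst ` ?T" by blast
    qed
  qed
  moreover have "snd ` ?T = ?B"
  proof
    show "snd ` ?T \<subseteq> ?B" using T(1) unfolding Inv_def by fastforce
    show "?B \<subseteq> snd ` ?T"
    proof
      fix x assume x: "x \<in> ?B"
      then obtain n where "x = from_nat_into ?B n" using from_nat_into_surj[OF count(2) x] by metis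
      then have "x \<in> snd ` T (Suc n)" using T(4)[of n] x by auto
      then show "x \<in> snd ` ?T" by blast
    qed
  qed
  moreover have "countable ?T" using T(1) unfolding Inv_def by (auto intro: countable_finite)
  ultimately obtain t t' :: "nat \<rightharpoonup> 'c" where t: "dom t = dom t'" "graph t t' = ?T" "ran t = ?A" "ran t' = ?B"
    using countable_tuples[of ?T] by metis
  have closed: "closed_in M ?A" "closed_in M ?B"
    using AB cl_idem sub unfolding closed_in_def by auto
  have "qftp L M t = qftp L M t'" unfolding qftp_eq_iff_local_iso using iso t by simp
  then have "qftp L M (join_tuple t [a]) = qftp L M (join_tuple t' [a'])"
    using QM(3) closed a a' unfolding QM4_def t(3,4)[symmetric] by blast
  then have "local_iso L M (insert (a, a') ?T)"
    unfolding qftp_join_tuple_eq_iff t by simp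
  moreover have "S \<subseteq> ?T" using T(1)[of 0] unfolding Inv_def by blast
  ultimately show ?thesis by (meson local_iso_mono insert_mono)
qed

lemma quasiminimal_finitely_homogeneous:
  assumes M: "quasiminimal_pg L M"
  shows "finitely_homogeneous L M"
  unfolding finitely_homogeneous_def
proof (intro conjI allI impI ballI)
  have QM: "is_pgstruct L M" "QM1 L M" "QM5 L M" using M by (auto simp: quasiminimal_pg_def)
  then interpret pregeom "univ M" "clo M"
    by unfold_locales (simp add: is_pgstruct_def)
  show "is_pgstruct L M" by fact
  fix S
  assume S: "finite S" "S \<subseteq> univ M \<times> univ M" "local_iso L M S"
  show "a \<in> clo M (fst ` S) \<longleftrightarrow> a' \<in> clo M (snd ` S)"
    if "a \<in> univ M" "a' \<in> univ M" "local_iso L M (insert (a, a') S)" for a a'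
    using quasiminimal_QM1[OF QM(2) S(1,2) that(3,1,2)] .
  show "\<exists>a' \<in> clo M (snd ` S). local_iso L M (insert (a, a') S)" if a: "a \<in> clo M (fst ` S)" for a
  proof -
    obtain a' where a': "a' \<in> univ M" "local_iso L M (insert (a, a') S)"
      using quasiminimal_QM5[OF QM(3) S a] by blast
    moreover have "a \<in> univ M" using a S(2) cl_subset[of "fst ` S"] by force
    ultimately show ?thesis using quasiminimal_QM1[OF QM(2) S(1,2) a'(2)] a by blast
  qed
  show "local_iso L M (insert (a, a') S)"
    if "a \<in> univ M - clo M (fst ` S)" "a' \<in> univ M - clo M (snd ` S)" for a a'
    using quasiminimal_generic_unique[OF M S that] .
qed

text \<open>The embedding of the closure of \<open>F\<close> is described through quantifier-free formulas instead of
substructures, which avoids asking whether a closure is nonempty or closed under the functions.\<close>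

definition locally_embeds :: "('f, 'r) lang \<Rightarrow> ('f, 'r, 'a) pgstruct \<Rightarrow> ('f, 'r, 'b) pgstruct \<Rightarrow> bool" where
  "locally_embeds L K M \<longleftrightarrow> is_pgstruct L K \<and> (\<forall>F. finite F \<longrightarrow> F \<subseteq> univ K \<longrightarrow>
     (\<exists>\<theta>. inj_on \<theta> (clo K F) \<and> \<theta> ` clo K F \<subseteq> univ M \<and>
        (\<forall>A. A \<subseteq> clo K F \<longrightarrow> \<theta> ` clo K A = clo M (\<theta> ` A)) \<and>
        (\<forall>(\<phi> :: ('f, 'r, nat) fm) s. wf_fm L \<phi> \<longrightarrow> qfree \<phi> \<longrightarrow> s ` fv \<phi> \<subseteq> clo K F \<longrightarrow>
           (sat K \<phi> s \<longleftrightarrow> sat M \<phi> (\<lambda>v. \<theta> (s v))))))"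

lemma tval_in_univ:
  assumes "is_struct L M" "wf_trm L t" "s ` vars t \<subseteq> univ M"
  shows "tval M s t \<in> univ M"
  using assms(2,3)
proof (induction t)
  case (Fn f ts)
  then have "map (tval M s) ts \<in> lists (univ M)" by (fastforce simp: list_all_iff)
  with Fn assms(1) show ?case by (auto simp: is_struct_def)
qed simp

lemma tval_closed_embedding:
  assumes \<theta>: "closed_embedding L \<theta> K M" and "wf_trm L t" "s ` vars t \<subseteq> univ K"
  shows "\<theta> (tval K s t) = tval M (\<lambda>v. \<theta> (s v)) t"
  using assms(2,3)
proof (induction t)
  case (Fn f ts)
  have K: "is_struct L K" using \<theta> by (auto simp: closed_embedding_def is_pgstruct_def)
  have "tval K s t \<in> univ K" if "t \<in> set ts" for t
    by (rule tval_in_univ[OF K]) (use Fn.prems that in \<open>auto simp: list_all_iff\<close>)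
  then have "map (tval K s) ts \<in> lists (univ K)" by auto
  then have "\<theta> (fint K f (map (tval K s) ts)) = fint M f (map \<theta> (map (tval K s) ts))"
    using \<theta> Fn.prems unfolding closed_embedding_def by auto
  moreover have "map \<theta> (map (tval K s) ts) = map (tval M (\<lambda>v. \<theta> (s v))) ts"
    using Fn by (auto simp: list_all_iff)
  ultimately show ?case by (simp only: tval.simps)
qed simp

lemma sat_closed_embedding:
  assumes \<theta>: "closed_embedding L \<theta> K M" and "wf_fm L \<phi>" "qfree \<phi>" "s ` fv \<phi> \<subseteq> univ K"
  shows "sat K \<phi> s \<longleftrightarrow> sat M \<phi> (\<lambda>v. \<theta> (s v))"
  using assms(2,3,4)
proof (induction \<phi>)
  case (Eq t u)
  have K: "is_struct L K" and inj: "inj_on \<theta> (univ K)"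
    using \<theta> by (auto simp: closed_embedding_def is_pgstruct_def)
  have "tval K s t \<in> univ K" "tval K s u \<in> univ K"
    by (rule tval_in_univ[OF K]; use Eq in auto)+
  moreover have "\<theta> (tval K s t) = tval M (\<lambda>v. \<theta> (s v)) t" "\<theta> (tval K s u) = tval M (\<lambda>v. \<theta> (s v)) u"
    by (rule tval_closed_embedding[OF \<theta>]; use Eq in auto)+
  ultimately show ?case using inj_on_eq_iff[OF inj] by (metis sat.simps(1))
next
  case (Rel r ts)
  have K: "is_struct L K"
    using \<theta> by (auto simp: closed_embedding_def is_pgstruct_def)
  have "tval K s t \<in> univ K" if "t \<in> set ts" for t
    by (rule tval_in_univ[OF K]) (use Rel.prems that in \<open>auto simp: list_all_iff\<close>)
  then have "map (tval K s) ts \<in> lists (univ K)" by auto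
  then have "map (tval K s) ts \<in> rint K r \<longleftrightarrow> map \<theta> (map (tval K s) ts) \<in> rint M r"
    using \<theta> Rel.prems unfolding closed_embedding_def by auto
  moreover have "\<theta> (tval K s t) = tval M (\<lambda>v. \<theta> (s v)) t" if "t \<in> set ts" for t
    by (rule tval_closed_embedding[OF \<theta>]) (use Rel.prems that in \<open>auto simp: list_all_iff\<close>)
  then have "map \<theta> (map (tval K s) ts) = map (tval M (\<lambda>v. \<theta> (s v))) ts" by simp
  ultimately show ?case by (simp only: sat.simps)
next
  case (Conj F)
  have "sat K (F n) s \<longleftrightarrow> sat M (F n) (\<lambda>v. \<theta> (s v))" for n
    by (rule Conj.IH) (use Conj.prems in \<open>auto simp: image_subset_iff\<close>)
  then show ?case by simp
qed auto

lemma locally_embeds_closed_embedding: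
  assumes \<theta>: "closed_embedding L \<theta> K K'" and K': "locally_embeds L K' M"
  shows "locally_embeds L K M"
  unfolding locally_embeds_def
proof (intro conjI allI impI)
  show K: "is_pgstruct L K" using \<theta> by (simp add: closed_embedding_def)
  interpret pregeom "univ K" "clo K" using K by unfold_locales (simp add: is_pgstruct_def)
  fix F assume F: "finite F" "F \<subseteq> univ K"
  have inj: "inj_on \<theta> (univ K)" and clo: "\<And>A. A \<subseteq> univ K \<Longrightarrow> \<theta> ` clo K A = clo K' (\<theta> ` A)"
    and sub: "\<theta> ` univ K \<subseteq> univ K'"
    using \<theta> by (auto simp: closed_embedding_def)
  have "\<theta> ` F \<subseteq> univ K'" using F sub by auto
  then obtain \<eta> where \<eta>: "inj_on \<eta> (clo K' (\<theta> ` F))" "\<eta> ` clo K' (\<theta> ` F) \<subseteq> univ M"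
      "\<And>A. A \<subseteq> clo K' (\<theta> ` F) \<Longrightarrow> \<eta> ` clo K' A = clo M (\<eta> ` A)"
      "\<And>(\<phi> :: ('a, 'b, nat) fm) s. wf_fm L \<phi> \<Longrightarrow> qfree \<phi> \<Longrightarrow> s ` fv \<phi> \<subseteq> clo K' (\<theta> ` F) \<Longrightarrow>
         sat K' \<phi> s \<longleftrightarrow> sat M \<phi> (\<lambda>v. \<eta> (s v))"
    using K' F(1) unfolding locally_embeds_def by (meson finite_imageI)
  have F': "clo K F \<subseteq> univ K" "\<theta> ` clo K F = clo K' (\<theta> ` F)" using cl_subset F clo by auto
  show "\<exists>\<theta>. inj_on \<theta> (clo K F) \<and> \<theta> ` clo K F \<subseteq> univ M \<and>
        (\<forall>A. A \<subseteq> clo K F \<longrightarrow> \<theta> ` clo K A = clo M (\<theta> ` A)) \<and>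
        (\<forall>(\<phi> :: ('a, 'b, nat) fm) s. wf_fm L \<phi> \<longrightarrow> qfree \<phi> \<longrightarrow> s ` fv \<phi> \<subseteq> clo K F \<longrightarrow>
           (sat K \<phi> s \<longleftrightarrow> sat M \<phi> (\<lambda>v. \<theta> (s v))))"
  proof (intro exI[of _ "\<eta> \<circ> \<theta>"] conjI allI impI)
    show "inj_on (\<eta> \<circ> \<theta>) (clo K F)"
      using inj F' \<eta>(1) by (intro comp_inj_on) (auto intro: inj_on_subset)
    show "(\<eta> \<circ> \<theta>) ` clo K F \<subseteq> univ M" using \<eta>(2) F'(2) unfolding image_comp[symmetric] by simp
    show "(\<eta> \<circ> \<theta>) ` clo K A = clo M ((\<eta> \<circ> \<theta>) ` A)" if "A \<subseteq> clo K F" for A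
    proof -
      have "A \<subseteq> univ K" "\<theta> ` A \<subseteq> clo K' (\<theta> ` F)" using that F' by auto
      then show ?thesis using clo \<eta>(3) unfolding image_comp[symmetric] by simp
    qed
    show "sat K \<phi> s \<longleftrightarrow> sat M \<phi> (\<lambda>v. (\<eta> \<circ> \<theta>) (s v))"
      if "wf_fm L \<phi>" "qfree \<phi>" "s ` fv \<phi> \<subseteq> clo K F" for \<phi> :: "('a, 'b, nat) fm" and s
    proof -
      have "sat K \<phi> s \<longleftrightarrow> sat K' \<phi> (\<lambda>v. \<theta> (s v))"
        by (rule sat_closed_embedding[OF \<theta>]) (use that F' in auto)
      also have "\<dots> \<longleftrightarrow> sat M \<phi> (\<lambda>v. \<eta> (\<theta> (s v)))"
        by (rule \<eta>(4)) (use that F'(2) in auto)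
      finally show ?thesis by simp
    qed
  qed
qed

lemma closed_embedding_inverse:
  assumes "pg_iso L \<theta> M N"
  shows "closed_embedding L (inv_into (univ M) \<theta>) N M"
proof -
  let ?\<eta> = "inv_into (univ M) \<theta>"
  have \<theta>: "is_pgstruct L M" "is_pgstruct L N" "inj_on \<theta> (univ M)" "\<theta> ` univ M = univ N"
    "\<And>f xs. f \<in> Funs L \<Longrightarrow> xs \<in> lists (univ M) \<Longrightarrow> length xs = farity L f \<Longrightarrow>
        \<theta> (fint M f xs) = fint N f (map \<theta> xs)"
    "\<And>r xs. r \<in> Rels L \<Longrightarrow> xs \<in> lists (univ M) \<Longrightarrow> length xs = rarity L r \<Longrightarrow>
        (xs \<in> rint M r \<longleftrightarrow> map \<theta> xs \<in> rint N r)"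
    "\<And>A. A \<subseteq> univ M \<Longrightarrow> \<theta> ` clo M A = clo N (\<theta> ` A)"
    using assms unfolding pg_iso_def closed_embedding_def by simp_all
  have inv: "?\<eta> (\<theta> x) = x" if "x \<in> univ M" for x using that \<theta>(3) by simp
  have inv': "\<theta> (?\<eta> y) = y" "?\<eta> y \<in> univ M" if "y \<in> univ N" for y
    using that \<theta>(4) by (auto simp: f_inv_into_f inv_into_into)
  have inv_l: "map \<theta> (map ?\<eta> ys) = ys" "map ?\<eta> ys \<in> lists (univ M)" if "ys \<in> lists (univ N)" for ys
    using that inv' by (auto simp: map_idI)
  have "?\<eta> (fint N f ys) = fint M f (map ?\<eta> ys)"
    if "f \<in> Funs L" "ys \<in> lists (univ N)" "length ys = farity L f" for f ys
  proof -
    have "\<theta> (fint M f (map ?\<eta> ys)) = fint N f ys"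
      using \<theta>(5)[of f "map ?\<eta> ys"] inv_l[of ys] that by simp
    moreover have "fint M f (map ?\<eta> ys) \<in> univ M"
      using \<theta>(1) that inv_l(2)[of ys] unfolding is_pgstruct_def is_struct_def by auto
    ultimately show ?thesis using inv by metis
  qed
  moreover have "ys \<in> rint N r \<longleftrightarrow> map ?\<eta> ys \<in> rint M r"
    if "r \<in> Rels L" "ys \<in> lists (univ N)" "length ys = rarity L r" for r ys
    using \<theta>(6)[of r "map ?\<eta> ys"] inv_l[of ys] that by simp
  moreover have "?\<eta> ` clo N A = clo M (?\<eta> ` A)" if A: "A \<subseteq> univ N" for A
  proof -
    interpret pregeom "univ M" "clo M" using \<theta>(1) by unfold_locales (simp add: is_pgstruct_def)
    have "?\<eta> ` A \<subseteq> univ M" using A inv' by auto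
    moreover have "\<theta> ` ?\<eta> ` A = (\<lambda>x. x) ` A"
      unfolding image_image by (rule image_cong) (use A inv' in auto)
    ultimately have "?\<eta> ` A \<subseteq> univ M" "\<theta> ` ?\<eta> ` A = A" by auto
    then have "?\<eta> ` clo N A = ?\<eta> ` \<theta> ` clo M (?\<eta> ` A)" using \<theta>(7)[of "?\<eta> ` A"] by simp
    also have "\<dots> = clo M (?\<eta> ` A)"
      using inv cl_subset[OF \<open>?\<eta> ` A \<subseteq> univ M\<close>] by (force simp: image_image)
    finally show ?thesis .
  qed
  moreover have "inj_on ?\<eta> (univ N)" "?\<eta> ` univ N \<subseteq> univ M"
    using \<theta>(4) inv' by (auto intro: inj_on_inv_into)
  ultimately show ?thesis using \<theta>(1,2) unfolding closed_embedding_def by blast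
qed

lemma finite_subset_chain_member:
  assumes "chain_union L \<K> U" "finite F" "F \<subseteq> univ U"
  shows "\<exists>K \<in> \<K>. F \<subseteq> univ K"
  using assms(2,3)
proof (induction F)
  case empty
  then show ?case using assms(1) by (auto simp: chain_union_def)
next
  case (insert x F)
  then obtain K where K: "K \<in> \<K>" "F \<subseteq> univ K" by auto
  have "x \<in> (\<Union>K \<in> \<K>. univ K)" using insert.prems assms(1) by (simp add: chain_union_def)
  then obtain K' where K': "K' \<in> \<K>" "x \<in> univ K'" by blast
  have "closed_sub L K K' \<or> closed_sub L K' K" using assms(1) K K' by (simp add: chain_union_def)
  then have "univ K \<subseteq> univ K' \<or> univ K' \<subseteq> univ K" by (auto simp: closed_sub_def closed_embedding_def)
  then show ?case using K K' by blast
qed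

text \<open>In a union of a chain, a finite set and its closure lie in one member of the chain.\<close>

lemma qm_class_locally_embeds:
  assumes M0: "is_pgstruct L M0" and "K \<in> qm_class L M0"
  shows "locally_embeds L K M0"
  using assms(2)
proof (induction K rule: qm_class.induct)
  case base
  interpret pregeom "univ M0" "clo M0" using M0 by unfold_locales (simp add: is_pgstruct_def)
  show ?case unfolding locally_embeds_def
    by (intro conjI M0 allI impI exI[of _ "\<lambda>x. x"]) (use cl_subset in auto)
next
  case (iso M \<theta> N)
  then show ?case using closed_embedding_inverse locally_embeds_closed_embedding by blast
next
  case (sub M N)
  then show ?case unfolding closed_sub_def using locally_embeds_closed_embedding by blast
next
  case (chain \<K> V)
  show ?case unfolding locally_embeds_def
  proof (intro conjI allI impI)
    show V: "is_pgstruct L V" using chain by (simp add: chain_union_def)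
    fix F assume F: "finite F" "F \<subseteq> univ V"
    then obtain K where K: "K \<in> \<K>" "F \<subseteq> univ K" using finite_subset_chain_member chain by blast
    then have sub: "closed_embedding L (\<lambda>x. x) K V" using chain by (simp add: chain_union_def closed_sub_def)
    then have clo: "clo K A = clo V A" if "A \<subseteq> univ K" for A
      using that unfolding closed_embedding_def by simp
    have Kpg: "is_pgstruct L K" using sub by (simp add: closed_embedding_def)
    interpret pregeom "univ K" "clo K" using Kpg by unfold_locales (simp add: is_pgstruct_def)
    obtain \<theta> where \<theta>: "inj_on \<theta> (clo K F)" "\<theta> ` clo K F \<subseteq> univ M0"
      "\<And>A. A \<subseteq> clo K F \<Longrightarrow> \<theta> ` clo K A = clo M0 (\<theta> ` A)"
      "\<And>(\<phi> :: ('a, 'b, nat) fm) s. wf_fm L \<phi> \<Longrightarrow> qfree \<phi> \<Longrightarrow> s ` fv \<phi> \<subseteq> clo K F \<Longrightarrow>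
         sat K \<phi> s \<longleftrightarrow> sat M0 \<phi> (\<lambda>v. \<theta> (s v))"
      using chain.IH[OF K(1)] F(1) K(2) unfolding locally_embeds_def by metis
    have KU: "clo K F \<subseteq> univ K" using cl_subset K(2) by blast
    have "sat V \<phi> s \<longleftrightarrow> sat M0 \<phi> (\<lambda>v. \<theta> (s v))"
      if "wf_fm L \<phi>" "qfree \<phi>" "s ` fv \<phi> \<subseteq> clo K F" for \<phi> :: "('a, 'b, nat) fm" and s
      using \<theta>(4)[OF that] sat_closed_embedding[OF sub that(1,2), of s] that KU by auto
    moreover have "\<theta> ` clo V A = clo M0 (\<theta> ` A)" if "A \<subseteq> clo K F" for A
      using \<theta>(3)[OF that] clo[of A] that KU by auto
    ultimately show "\<exists>\<theta>. inj_on \<theta> (clo V F) \<and> \<theta> ` clo V F \<subseteq> univ M0 \<and>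
        (\<forall>A. A \<subseteq> clo V F \<longrightarrow> \<theta> ` clo V A = clo M0 (\<theta> ` A)) \<and>
        (\<forall>(\<phi> :: ('a, 'b, nat) fm) s. wf_fm L \<phi> \<longrightarrow> qfree \<phi> \<longrightarrow> s ` fv \<phi> \<subseteq> clo V F \<longrightarrow>
           (sat V \<phi> s \<longleftrightarrow> sat M0 \<phi> (\<lambda>v. \<theta> (s v))))"
      using \<theta>(1,2) unfolding clo[OF K(2)] by blast
  qed
qed

text \<open>Any finite amount of data lies in one closure \<open>cl F\<close>, so each of the three properties can be carried
over along a single embedding.\<close>

lemma locally_embeds_finitely_homogeneous:
  assumes K: "locally_embeds L K M" and M: "finitely_homogeneous L M"
  shows "finitely_homogeneous L K"
  unfolding finitely_homogeneous_def
proof (intro conjI allI impI)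
  show Kpg: "is_pgstruct L K" using K by (simp add: locally_embeds_def)
  interpret pregeom "univ K" "clo K" using Kpg by unfold_locales (simp add: is_pgstruct_def)
  fix S assume S: "finite S" "S \<subseteq> univ K \<times> univ K" "local_iso L K S"
  have *: "(a \<in> clo K (fst ` S) \<longrightarrow> (\<exists>b' \<in> clo K (snd ` S). local_iso L K (insert (a, b') S))) \<and>
     (local_iso L K (insert (a, a') S) \<longrightarrow> (a \<in> clo K (fst ` S) \<longleftrightarrow> a' \<in> clo K (snd ` S))) \<and>
     (a \<notin> clo K (fst ` S) \<longrightarrow> a' \<notin> clo K (snd ` S) \<longrightarrow> local_iso L K (insert (a, a') S))"
    if a: "a \<in> univ K" "a' \<in> univ K" for a a'
  proof -
    define F where "F = insert a (insert a' (fst ` S \<union> snd ` S))"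
    have F: "finite F" "F \<subseteq> univ K" using S a unfolding F_def by auto
    obtain \<theta> where \<theta>: "inj_on \<theta> (clo K F)" "\<theta> ` clo K F \<subseteq> univ M"
      "\<And>A. A \<subseteq> clo K F \<Longrightarrow> \<theta> ` clo K A = clo M (\<theta> ` A)"
      "\<And>(\<phi> :: ('a, 'b, nat) fm) s. wf_fm L \<phi> \<Longrightarrow> qfree \<phi> \<Longrightarrow> s ` fv \<phi> \<subseteq> clo K F \<Longrightarrow>
         sat K \<phi> s \<longleftrightarrow> sat M \<phi> (\<lambda>v. \<theta> (s v))"
      using K F unfolding locally_embeds_def by metis
    let ?h = "map_prod \<theta> \<theta>"
    have transfer: "local_iso L K T \<longleftrightarrow> local_iso L M (?h ` T)" if T: "T \<subseteq> clo K F \<times> clo K F" for T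
    proof
      assume iso: "local_iso L K T"
      show "local_iso L M (?h ` T)" unfolding local_iso_def
      proof (intro allI impI)
        fix \<phi> :: "('a, 'b, nat) fm" and s s'
        assume \<phi>: "wf_fm L \<phi>" "qfree \<phi>" and "\<forall>v\<in>fv \<phi>. (s v, s' v) \<in> ?h ` T"
        then have "\<forall>v\<in>fv \<phi>. \<exists>p. p \<in> T \<and> s v = \<theta> (fst p) \<and> s' v = \<theta> (snd p)" by force
        then obtain p where p: "\<forall>v\<in>fv \<phi>. p v \<in> T \<and> s v = \<theta> (fst (p v)) \<and> s' v = \<theta> (snd (p v))"
          unfolding bchoice_iff by blast
        have "sat K \<phi> (\<lambda>v. fst (p v)) \<longleftrightarrow> sat K \<phi> (\<lambda>v. snd (p v))"
          by (rule local_isoD[OF iso \<phi>]) (use p in simp)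
        moreover have "sat K \<phi> (\<lambda>v. fst (p v)) \<longleftrightarrow> sat M \<phi> (\<lambda>v. \<theta> (fst (p v)))"
          by (rule \<theta>(4)[OF \<phi>]) (use p T in fastforce)
        moreover have "sat K \<phi> (\<lambda>v. snd (p v)) \<longleftrightarrow> sat M \<phi> (\<lambda>v. \<theta> (snd (p v)))"
          by (rule \<theta>(4)[OF \<phi>]) (use p T in fastforce)
        moreover have "sat M \<phi> (\<lambda>v. \<theta> (fst (p v))) \<longleftrightarrow> sat M \<phi> s" "sat M \<phi> (\<lambda>v. \<theta> (snd (p v))) \<longleftrightarrow> sat M \<phi> s'"
          using p by (auto intro!: sat_cong)
        ultimately show "sat M \<phi> s \<longleftrightarrow> sat M \<phi> s'" by simp
      qed
    next
      assume iso: "local_iso L M (?h ` T)"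
      show "local_iso L K T" unfolding local_iso_def
      proof (intro allI impI)
        fix \<phi> :: "('a, 'b, nat) fm" and s s'
        assume \<phi>: "wf_fm L \<phi>" "qfree \<phi>" and s: "\<forall>v\<in>fv \<phi>. (s v, s' v) \<in> T"
        have "sat M \<phi> (\<lambda>v. \<theta> (s v)) \<longleftrightarrow> sat M \<phi> (\<lambda>v. \<theta> (s' v))"
          by (rule local_isoD[OF iso \<phi>]) (use s in force)
        moreover have "sat K \<phi> s \<longleftrightarrow> sat M \<phi> (\<lambda>v. \<theta> (s v))"
          by (rule \<theta>(4)[OF \<phi>]) (use s T in auto)
        moreover have "sat K \<phi> s' \<longleftrightarrow> sat M \<phi> (\<lambda>v. \<theta> (s' v))"
          by (rule \<theta>(4)[OF \<phi>]) (use s T in auto)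
        ultimately show "sat K \<phi> s \<longleftrightarrow> sat K \<phi> s'" by simp
      qed
    qed
    have Fcl: "F \<subseteq> clo K F" using cl_ext F by blast
    have sub: "fst ` S \<subseteq> F" "snd ` S \<subseteq> F" "a \<in> F" "a' \<in> F" by (auto simp: F_def)
    have SF: "S \<subseteq> clo K F \<times> clo K F" using sub Fcl by force
    have im: "fst ` ?h ` S = \<theta> ` fst ` S" "snd ` ?h ` S = \<theta> ` snd ` S" by (force simp: image_image)+
    have cl_im: "\<theta> ` clo K (fst ` S) = clo M (fst ` ?h ` S)" "\<theta> ` clo K (snd ` S) = clo M (snd ` ?h ` S)"
      using \<theta>(3)[of "fst ` S"] \<theta>(3)[of "snd ` S"] sub(1,2)[THEN subset_trans, OF Fcl] unfolding im by simp_all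
    have cl_sub: "clo K (fst ` S) \<subseteq> clo K F" "clo K (snd ` S) \<subseteq> clo K F"
      using cl_mono sub F by blast+
    have mem: "x \<in> clo K (fst ` S) \<longleftrightarrow> \<theta> x \<in> clo M (fst ` ?h ` S)"
      "x \<in> clo K (snd ` S) \<longleftrightarrow> \<theta> x \<in> clo M (snd ` ?h ` S)" if "x \<in> clo K F" for x
      unfolding cl_im[symmetric] using that \<theta>(1) cl_sub by (simp_all add: inj_on_image_mem_iff)
    have hS: "finite (?h ` S)" "?h ` S \<subseteq> univ M \<times> univ M" "local_iso L M (?h ` S)"
      using S transfer[OF SF] SF \<theta>(2) by auto
    have aF: "a \<in> clo K F" "a' \<in> clo K F" using sub Fcl by auto
    have aM: "\<theta> a \<in> univ M" "\<theta> a' \<in> univ M" using aF \<theta>(2) by auto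
    have ins: "local_iso L K (insert (a, b) S) \<longleftrightarrow> local_iso L M (insert (\<theta> a, \<theta> b) (?h ` S))"
      if "b \<in> clo K F" for b
      using transfer[of "insert (a, b) S"] SF aF that by simp
    show ?thesis
    proof (intro conjI impI)
      assume "a \<in> clo K (fst ` S)"
      then have "\<theta> a \<in> clo M (fst ` ?h ` S)" using mem aF by blast
      then obtain b where b: "b \<in> clo M (snd ` ?h ` S)" "local_iso L M (insert (\<theta> a, b) (?h ` S))"
        using homogeneous_extend_closure[OF M hS] by blast
      then obtain b' where b': "b = \<theta> b'" "b' \<in> clo K (snd ` S)" unfolding cl_im[symmetric] by blast
      then show "\<exists>b'\<in>clo K (snd ` S). local_iso L K (insert (a, b') S)"
        using ins[of b'] b cl_sub by blast
    next
      assume "local_iso L K (insert (a, a') S)"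
      then have "local_iso L M (insert (\<theta> a, \<theta> a') (?h ` S))" using ins aF by blast
      then show "a \<in> clo K (fst ` S) \<longleftrightarrow> a' \<in> clo K (snd ` S)"
        using homogeneous_closure_iff[OF M hS aM] mem aF by blast
    next
      assume "a \<notin> clo K (fst ` S)" "a' \<notin> clo K (snd ` S)"
      then have "local_iso L M (insert (\<theta> a, \<theta> a') (?h ` S))"
        using homogeneous_extend_generic[OF M hS aM(1) _ aM(2)] mem aF by blast
      then show "local_iso L K (insert (a, a') S)" using ins aF by blast
    qed
  qed
  have sub: "clo K (fst ` S) \<subseteq> univ K" using S(2) by (intro cl_subset) auto
  show "\<forall>a\<in>univ K. \<forall>a'\<in>univ K. local_iso L K (insert (a, a') S) \<longrightarrow> (a \<in> clo K (fst ` S)) = (a' \<in> clo K (snd ` S))"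
    using * by blast
  show "\<forall>a\<in>clo K (fst ` S). \<exists>a'\<in>clo K (snd ` S). local_iso L K (insert (a, a') S)"
    using * sub by blast
  show "\<forall>a\<in>univ K - clo K (fst ` S). \<forall>a'\<in>univ K - clo K (snd ` S). local_iso L K (insert (a, a') S)"
    using * by blast
qed

lemma quasiminimal_class_finitely_homogeneous:
  assumes "quasiminimal_class L \<C>" "M \<in> \<C>"
  shows "finitely_homogeneous L M"
proof -
  obtain M0 where M0: "quasiminimal_pg L M0" "\<C> = qm_class L M0"
    using assms(1) by (auto simp: quasiminimal_class_def)
  then have "locally_embeds L M M0"
    using qm_class_locally_embeds assms(2) by (auto simp: quasiminimal_pg_def)
  then show ?thesis
    using locally_embeds_finitely_homogeneous quasiminimal_finitely_homogeneous M0(1) by blast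
qed

lemma quasiminimal_class_closed_sub:
  assumes "quasiminimal_class L \<C>" "M \<in> \<C>" "closed_sub L N M"
  shows "N \<in> \<C>"
  using assms qm_class.sub unfolding quasiminimal_class_def by blast


section \<open>The back-and-forth system of a pair\<close>

lemma lang_P_simps [simp]:
  "Funs (lang_P L) = Funs L" "farity (lang_P L) = farity L"
  "None \<in> Rels (lang_P L)" "Some r \<in> Rels (lang_P L) \<longleftrightarrow> r \<in> Rels L"
  "rarity (lang_P L) None = 1" "rarity (lang_P L) (Some r) = rarity L r"
  by (auto simp: lang_P_def)

lemma struct_P_simps [simp]:
  "univ (struct_P M P) = univ M" "fint (struct_P M P) = fint M"
  "rint (struct_P M P) None = (\<lambda>x. [x]) ` P" "rint (struct_P M P) (Some r) = rint M r"
  by (auto simp: struct_P_def)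

lemma wf_trm_lang_P [simp]: "wf_trm (lang_P L) t \<longleftrightarrow> wf_trm L t"
  by (induction t) (auto simp: list_all_iff)

lemma tval_struct_P [simp]: "tval (struct_P M P) s t = tval M s t"
proof (induction t)
  case (Fn f ts)
  then have "map (tval (struct_P M P) s) ts = map (tval M s) ts" by simp
  then show ?case by (simp only: tval.simps struct_P_simps)
qed simp

text \<open>The properties of a beautiful pair that the back-and-forth argument uses.\<close>

locale homogeneous_pair =
  fixes L :: "('f, 'r) lang" and M :: "('f, 'r, 'a) pgstruct" and P :: "'a set"
  assumes countable_L: "countable_lang L"
    and homogeneous: "finitely_homogeneous L M"
    and P_subset: "P \<subseteq> univ M"
    and P_closed: "clo M P = P"
    and dense_codense: "dense_codense M P"
begin

abbreviation U where "U \<equiv> univ M"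

abbreviation cl where "cl \<equiv> clo M"

sublocale pregeom U cl
  using homogeneous by unfold_locales (simp add: finitely_homogeneous_def is_pgstruct_def)

lemma is_struct: "is_struct L M"
  using homogeneous by (simp add: finitely_homogeneous_def is_pgstruct_def)

lemma cl_P_subset: "X \<subseteq> P \<Longrightarrow> cl X \<subseteq> P"
  using cl_closed_subset[OF _ P_subset P_closed] .

text \<open>For finite \<open>B\<close> this means that \<open>B\<close> has the same dimension over \<open>P\<close> as over the empty set.\<close>

definition P_free :: "'a set \<Rightarrow> bool" where
  "P_free B \<longleftrightarrow> B \<subseteq> U \<and> (\<forall>X \<subseteq> P. cl (X \<union> B) \<inter> P \<subseteq> cl X)"

lemma P_free_empty: "P_free {}"
  by (simp add: P_free_def)

lemma P_free_insert:
  assumes B: "P_free B" and x: "x \<in> U" "x \<notin> cl (P \<union> B)"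
  shows "P_free (insert x B)"
  unfolding P_free_def
proof (intro conjI allI impI subsetI)
  show "y \<in> U" if "y \<in> insert x B" for y using that B x by (auto simp: P_free_def)
  fix X y assume X: "X \<subseteq> P" and y: "y \<in> cl (X \<union> insert x B) \<inter> P"
  have XB: "X \<union> B \<subseteq> U" "P \<union> B \<subseteq> U" using X P_subset B by (auto simp: P_free_def)
  have "y \<in> cl (X \<union> B)"
  proof (rule ccontr)
    assume "y \<notin> cl (X \<union> B)"
    then have "x \<in> cl (insert y (X \<union> B))" using cl_exchange[OF XB(1) x(1)] y by simp
    moreover have "insert y (X \<union> B) \<subseteq> P \<union> B" using y X by auto
    ultimately show False using x(2) cl_mono XB(2) by blast
  qed
  then show "y \<in> cl X" using B X y by (auto simp: P_free_def)
qed

text \<open>The domain is spanned by its part in \<open>P\<close> and a part that is free over \<open>P\<close>, and both parts are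
matched with parts of the range of the same kind. Preservation of \<open>P\<close> itself is a consequence
(\<open>based_iso_P_iff\<close>).\<close>

definition based_iso :: "('a \<times> 'a) set \<Rightarrow> bool" where
  "based_iso S \<longleftrightarrow> finite S \<and> S \<subseteq> U \<times> U \<and> local_iso L M S \<and>
     (\<exists>B \<subseteq> S. P_free (fst ` B) \<and> P_free (snd ` B) \<and> fst ` S \<subseteq> cl (fst ` (S \<inter> P \<times> P \<union> B)))"

lemma based_isoD:
  assumes "based_iso S"
  shows "finite S" "S \<subseteq> U \<times> U" "local_iso L M S" "fst ` S \<subseteq> U" "snd ` S \<subseteq> U"
  using assms by (auto simp: based_iso_def)

lemma local_iso_closure_iff:
  assumes "local_iso L M S" "finite S" "S \<subseteq> U \<times> U" "T \<subseteq> S" "(a, a') \<in> S"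
  shows "a \<in> cl (fst ` T) \<longleftrightarrow> a' \<in> cl (snd ` T)"
proof (rule homogeneous_closure_iff[OF homogeneous])
  show "finite T" "T \<subseteq> U \<times> U" "local_iso L M T" "a \<in> U" "a' \<in> U"
    using assms by (auto intro: finite_subset local_iso_mono)
  show "local_iso L M (insert (a, a') T)" by (rule local_iso_mono[OF assms(1)]) (use assms in auto)
qed

lemma based_iso_converse:
  assumes "based_iso S"
  shows "based_iso (S\<inverse>)"
proof -
  have im: "fst ` (T\<inverse>) = snd ` T" "snd ` (T\<inverse>) = fst ` T" for T :: "('a \<times> 'a) set" by force+
  obtain B where B: "B \<subseteq> S" "P_free (fst ` B)" "P_free (snd ` B)" "fst ` S \<subseteq> cl (fst ` (S \<inter> P \<times> P \<union> B))"
    using assms by (auto simp: based_iso_def)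
  have conv: "S\<inverse> \<inter> P \<times> P \<union> B\<inverse> = (S \<inter> P \<times> P \<union> B)\<inverse>" by auto
  have "snd ` S \<subseteq> cl (snd ` (S \<inter> P \<times> P \<union> B))"
  proof
    fix y assume "y \<in> snd ` S"
    then obtain x where xy: "(x, y) \<in> S" by force
    then have "x \<in> cl (fst ` (S \<inter> P \<times> P \<union> B))" using B(4) by force
    then show "y \<in> cl (snd ` (S \<inter> P \<times> P \<union> B))"
      using local_iso_closure_iff[OF based_isoD(3,1,2)[OF assms] _ xy, of "S \<inter> P \<times> P \<union> B"] B(1) by auto
  qed
  then have "fst ` (S\<inverse>) \<subseteq> cl (fst ` (S\<inverse> \<inter> P \<times> P \<union> B\<inverse>))" unfolding conv im .
  then show ?thesis unfolding based_iso_def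
    using based_isoD[OF assms] B(1-3) by (auto simp: local_iso_converse im intro!: exI[of _ "B\<inverse>"])
qed

text \<open>As \<open>B\<close> is free, an element of \<open>P\<close> in the domain depends on the part of the domain in \<open>P\<close> alone.
Local isomorphisms preserve this dependence, and \<open>P\<close> is closed.\<close>

lemma based_iso_P_imp:
  assumes "based_iso S" "(a, a') \<in> S" "a \<in> P"
  shows "a' \<in> P"
proof -
  obtain B where B: "B \<subseteq> S" "P_free (fst ` B)" "fst ` S \<subseteq> cl (fst ` (S \<inter> P \<times> P \<union> B))"
    using assms by (auto simp: based_iso_def)
  have "fst ` (S \<inter> P \<times> P) \<subseteq> P" by auto
  moreover have "a \<in> cl (fst ` (S \<inter> P \<times> P) \<union> fst ` B)" using B(3) assms(2) by (force simp: image_Un)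
  ultimately have "a \<in> cl (fst ` (S \<inter> P \<times> P))" using B(2) assms(3) unfolding P_free_def by blast
  then have "a' \<in> cl (snd ` (S \<inter> P \<times> P))"
    using local_iso_closure_iff[OF based_isoD(3,1,2)[OF assms(1)] _ assms(2), of "S \<inter> P \<times> P"] by auto
  moreover have "snd ` (S \<inter> P \<times> P) \<subseteq> P" by auto
  ultimately show ?thesis using cl_P_subset by blast
qed

lemma based_iso_P_iff:
  assumes "based_iso S" "(a, a') \<in> S"
  shows "a \<in> P \<longleftrightarrow> a' \<in> P"
  using based_iso_P_imp[OF assms] based_iso_P_imp[OF based_iso_converse[OF assms(1)], of a' a] assms(2) by auto

lemma based_iso_insert_closure:
  assumes S: "based_iso S" and a: "a \<in> cl (fst ` S)"
  shows "\<exists>a' \<in> cl (snd ` S). based_iso (insert (a, a') S)"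
proof -
  obtain a' where a': "a' \<in> cl (snd ` S)" "local_iso L M (insert (a, a') S)"
    using homogeneous_extend_closure[OF homogeneous based_isoD(1-3)[OF S] a] by blast
  obtain B where B: "B \<subseteq> S" "P_free (fst ` B)" "P_free (snd ` B)" "fst ` S \<subseteq> cl (fst ` (S \<inter> P \<times> P \<union> B))"
    using S by (auto simp: based_iso_def)
  have sub: "fst ` (S \<inter> P \<times> P \<union> B) \<subseteq> fst ` (insert (a, a') S \<inter> P \<times> P \<union> B)" by auto
  have aU: "a \<in> U" "a' \<in> U" using a a' based_isoD[OF S] cl_subset by blast+
  have sub': "fst ` (insert (a, a') S \<inter> P \<times> P \<union> B) \<subseteq> U" using B(1) based_isoD(2)[OF S] P_subset by auto
  have "insert a (fst ` S) \<subseteq> cl (fst ` (S \<inter> P \<times> P \<union> B))"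
    using a B(4) cl_minimal[OF B(4) order.trans[OF sub sub']] by auto
  also have "\<dots> \<subseteq> cl (fst ` (insert (a, a') S \<inter> P \<times> P \<union> B))" using sub sub' by (rule cl_mono)
  finally have "based_iso (insert (a, a') S)" unfolding based_iso_def
    using based_isoD[OF S] a' aU B(1-3) by (auto intro!: exI[of _ B])
  then show ?thesis using a'(1) by blast
qed

lemma based_iso_insert_P:
  assumes S: "based_iso S" and a: "a \<in> P" "a \<notin> cl (fst ` S)" "a' \<in> P" "a' \<notin> cl (snd ` S)"
  shows "based_iso (insert (a, a') S)"
proof -
  have aU: "a \<in> U" "a' \<in> U" using a P_subset by auto
  have iso: "local_iso L M (insert (a, a') S)"
    using homogeneous_extend_generic[OF homogeneous based_isoD(1-3)[OF S]] a aU by simp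
  obtain B where B: "B \<subseteq> S" "P_free (fst ` B)" "P_free (snd ` B)" "fst ` S \<subseteq> cl (fst ` (S \<inter> P \<times> P \<union> B))"
    using S by (auto simp: based_iso_def)
  have sub: "fst ` (S \<inter> P \<times> P \<union> B) \<subseteq> fst ` (insert (a, a') S \<inter> P \<times> P \<union> B)" by auto
  have sub': "fst ` (insert (a, a') S \<inter> P \<times> P \<union> B) \<subseteq> U" using B(1) based_isoD(2)[OF S] P_subset a by auto
  have "a \<in> cl (fst ` (insert (a, a') S \<inter> P \<times> P \<union> B))" by (rule cl_base[OF _ sub']) (use a in auto)
  moreover have "fst ` S \<subseteq> cl (fst ` (insert (a, a') S \<inter> P \<times> P \<union> B))"
    using B(4) cl_mono[OF sub sub'] by (rule order.trans)
  ultimately show ?thesis unfolding based_iso_def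
    using based_isoD[OF S] iso aU B(1-3) by (auto intro!: exI[of _ B])
qed

lemma based_iso_insert_P_free:
  assumes S: "based_iso S" and a: "a \<in> U" "a \<notin> cl (P \<union> fst ` S)" "a' \<in> U" "a' \<notin> cl (P \<union> snd ` S)"
  shows "based_iso (insert (a, a') S)"
proof -
  obtain B where B: "B \<subseteq> S" "P_free (fst ` B)" "P_free (snd ` B)" "fst ` S \<subseteq> cl (fst ` (S \<inter> P \<times> P \<union> B))"
    using S by (auto simp: based_iso_def)
  have PU: "P \<union> fst ` S \<subseteq> U" "P \<union> snd ` S \<subseteq> U" using P_subset based_isoD[OF S] by auto
  have "a \<notin> cl (fst ` S)" "a' \<notin> cl (snd ` S)"
    using a cl_mono[OF _ PU(1), of "fst ` S"] cl_mono[OF _ PU(2), of "snd ` S"] by auto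
  then have iso: "local_iso L M (insert (a, a') S)"
    using homogeneous_extend_generic[OF homogeneous based_isoD(1-3)[OF S]] a by simp
  have PB: "P \<union> fst ` B \<subseteq> P \<union> fst ` S" "P \<union> snd ` B \<subseteq> P \<union> snd ` S" using B(1) by auto
  have "a \<notin> cl (P \<union> fst ` B)" "a' \<notin> cl (P \<union> snd ` B)"
    using a(2,4) cl_mono[OF PB(1) PU(1)] cl_mono[OF PB(2) PU(2)] by auto
  then have P_free: "P_free (fst ` insert (a, a') B)" "P_free (snd ` insert (a, a') B)"
    using P_free_insert B(2,3) a by auto
  have sub: "fst ` (S \<inter> P \<times> P \<union> B) \<subseteq> fst ` (insert (a, a') S \<inter> P \<times> P \<union> insert (a, a') B)" by auto
  have sub': "fst ` (insert (a, a') S \<inter> P \<times> P \<union> insert (a, a') B) \<subseteq> U"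
    using B(1) based_isoD(2)[OF S] P_subset a by auto
  have "a \<in> cl (fst ` (insert (a, a') S \<inter> P \<times> P \<union> insert (a, a') B))" by (rule cl_base[OF _ sub']) auto
  moreover have "fst ` S \<subseteq> cl (fst ` (insert (a, a') S \<inter> P \<times> P \<union> insert (a, a') B))"
    using B(4) cl_mono[OF sub sub'] by (rule order.trans)
  ultimately show ?thesis unfolding based_iso_def
    using based_isoD[OF S] iso a B(1) P_free by (intro conjI exI[of _ "insert (a, a') B"]) auto
qed

text \<open>A set \<open>W\<close> is independent from \<open>P\<close> over \<open>P \<inter> W\<close>, expressed through finite sets.\<close>

definition based :: "'a set \<Rightarrow> bool" where
  "based W \<longleftrightarrow> (\<forall>F. finite F \<longrightarrow> F \<subseteq> W \<longrightarrow>
     (\<exists>F' B. finite F' \<and> F \<subseteq> F' \<and> F' \<subseteq> W \<and> B \<subseteq> F' \<and> P_free B \<and> F' \<subseteq> cl (F' \<inter> P \<union> B)))"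

lemma based_extend_Id:
  assumes "based W" "W \<subseteq> U" "finite F" "F \<subseteq> W"
  obtains F' where "finite F'" "F \<subseteq> F'" "F' \<subseteq> W" "based_iso (Id_on F')" 
proof -
  obtain F' B where F': "finite F'" "F \<subseteq> F'" "F' \<subseteq> W" "B \<subseteq> F'" "P_free B" "F' \<subseteq> cl (F' \<inter> P \<union> B)"
    using assms(1)[unfolded based_def, rule_format, OF assms(3,4)] by blast
  have im: "fst ` Id_on X = X" "snd ` Id_on X = X" for X :: "'a set" by force+
  have "Id_on F' \<inter> P \<times> P \<union> Id_on B = Id_on (F' \<inter> P \<union> B)" by auto
  then have span: "fst ` Id_on F' \<subseteq> cl (fst ` (Id_on F' \<inter> P \<times> P \<union> Id_on B))" using F'(6) by (simp add: im)
  have fin: "finite (Id_on F')" using F'(1) by (simp add: Id_on_def)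
  have iso: "local_iso L M (Id_on F')" by (rule local_iso_Id) auto
  have "based_iso (Id_on F')" unfolding based_iso_def
    using F' fin iso span assms(2) by (intro conjI exI[of _ "Id_on B"]) (auto simp: im)
  then show thesis by (rule that[OF F'(1-3)])
qed

lemma based_if_independent:
  assumes W: "W \<subseteq> U"
    and ind: "\<And>F. finite F \<Longrightarrow> F \<subseteq> W \<Longrightarrow> cl (P \<union> F) \<inter> W \<subseteq> cl (P \<inter> W \<union> F)"
  shows "based W"
  unfolding based_def
proof (intro allI impI)
  fix F assume "finite F" "F \<subseteq> W"
  then show "\<exists>F' B. finite F' \<and> F \<subseteq> F' \<and> F' \<subseteq> W \<and> B \<subseteq> F' \<and> P_free B \<and> F' \<subseteq> cl (F' \<inter> P \<union> B)"
  proof (induction F)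
    case empty
    show ?case by (intro exI[of _ "{}"]) (simp add: P_free_empty)
  next
    case (insert x F)
    then obtain F' B where F': "finite F'" "F \<subseteq> F'" "F' \<subseteq> W" "B \<subseteq> F'" "P_free B" "F' \<subseteq> cl (F' \<inter> P \<union> B)"
      by auto
    have x: "x \<in> W" "x \<in> U" using insert.prems W by auto
    have U': "F' \<subseteq> U" "P \<union> F' \<subseteq> U" using F' W P_subset by auto
    show ?case
    proof (cases "x \<in> cl (P \<union> F')")
      case True
      then have "x \<in> cl (P \<inter> W \<union> F')" using ind[OF F'(1,3)] x by blast
      moreover have "P \<inter> W \<subseteq> U" using W by auto
      ultimately obtain P1 where P1: "finite P1" "P1 \<subseteq> P \<inter> W" "x \<in> cl (P1 \<union> F')"
        using cl_finitary_Un[OF _ U'(1)] by metis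
      let ?F = "insert x (P1 \<union> F')"
      have F_U: "?F \<inter> P \<union> B \<subseteq> U" using P_subset F'(4) U' by auto
      have "F' \<subseteq> cl (?F \<inter> P \<union> B)" using F'(6) cl_mono[of "F' \<inter> P \<union> B" "?F \<inter> P \<union> B"] F_U by auto
      moreover have "P1 \<subseteq> cl (?F \<inter> P \<union> B)" using cl_ext[OF F_U] P1(2) by auto
      ultimately have *: "P1 \<union> F' \<subseteq> cl (?F \<inter> P \<union> B)" by auto
      then have "?F \<subseteq> cl (?F \<inter> P \<union> B)" using cl_minimalD[OF P1(3) * F_U] by auto
      then show ?thesis
        using F' P1 x by (intro exI[of _ ?F] exI[of _ B]) auto
    next
      case False
      have "cl (P \<union> B) \<subseteq> cl (P \<union> F')" using F'(4) U' by (intro cl_mono) auto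
      then have fr: "P_free (insert x B)" using False x by (intro P_free_insert F'(5)) auto
      have F_U: "insert x F' \<inter> P \<union> insert x B \<subseteq> U" using P_subset F'(4) U' x by auto
      have "insert x F' \<subseteq> cl (insert x F' \<inter> P \<union> insert x B)"
        using F'(6) cl_mono[of "F' \<inter> P \<union> B", OF _ F_U] cl_ext[OF F_U] by auto
      then show ?thesis using F' fr x by (intro exI[of _ "insert x F'"] exI[of _ "insert x B"]) auto
    qed
  qed
qed

text \<open>The sets \<open>N\<close> for which \<open>(N, P \<inter> N)\<close> is an elementary sub-pair. Density and codensity are required
with respect to all finite subsets of \<open>M\<close>, which is how they are used; by \<open>richI\<close> the finite
subsets of \<open>W\<close> suffice.\<close>

definition rich :: "'a set \<Rightarrow> bool" where
  "rich W \<longleftrightarrow> W \<subseteq> U \<and> cl W = W \<and> based W \<and>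
     (\<forall>F. finite F \<longrightarrow> F \<subseteq> U \<longrightarrow> (\<exists>x \<in> P \<inter> W. x \<notin> cl F) \<and> (\<exists>x \<in> W. x \<notin> cl (P \<union> F)))"

lemma richD:
  assumes "rich W"
  shows "W \<subseteq> U" "cl W = W" "based W"
    and "finite F \<Longrightarrow> F \<subseteq> U \<Longrightarrow> \<exists>x \<in> P \<inter> W. x \<notin> cl F"
    and "finite F \<Longrightarrow> F \<subseteq> U \<Longrightarrow> \<exists>x \<in> W. x \<notin> cl (P \<union> F)"
  using assms by (auto simp: rich_def)

text \<open>By \<open>finite_cover\<close>, if a finite subset of \<open>M\<close> spanned \<open>P \<inter> W\<close>, or \<open>W\<close> over \<open>P\<close>, then so would a
finite subset of \<open>W\<close>.\<close>

lemma richI: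
  assumes W: "W \<subseteq> U" "cl W = W" "based W"
    and dense: "\<And>F. finite F \<Longrightarrow> F \<subseteq> W \<Longrightarrow> \<exists>x \<in> P \<inter> W. x \<notin> cl F"
    and codense: "\<And>F. finite F \<Longrightarrow> F \<subseteq> W \<Longrightarrow> \<exists>x \<in> W. x \<notin> cl (P \<union> F)"
  shows "rich W"
  unfolding rich_def
proof (intro conjI allI impI W)
  fix F assume F: "finite F" "F \<subseteq> U"
  show "\<exists>x \<in> P \<inter> W. x \<notin> cl F"
  proof (rule ccontr)
    assume "\<not> ?thesis"
    then have *: "P \<inter> W \<subseteq> cl ({} \<union> F)" by auto
    obtain F' where F': "finite F'" "F' \<subseteq> P \<inter> W" "P \<inter> W \<subseteq> cl ({} \<union> F')"
      using finite_cover[OF F _ _ *] W(1) by auto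
    then show False using dense[of F'] by auto
  qed
  show "\<exists>x \<in> W. x \<notin> cl (P \<union> F)"
  proof (rule ccontr)
    assume "\<not> ?thesis"
    then have *: "W \<subseteq> cl (P \<union> F)" by auto
    obtain F' where F': "finite F'" "F' \<subseteq> W" "W \<subseteq> cl (P \<union> F')"
      using finite_cover[OF F W(1) P_subset *] by auto
    then show False using codense[of F'] by auto
  qed
qed

lemma rich_univ: "rich U"
proof (rule richI)
  show "cl U = U" using cl_ext[of U] cl_subset[of U] by auto
  show "based U"
    by (rule based_if_independent) (use P_subset in \<open>auto simp: Int_absorb2\<close>)
  fix F assume F: "finite F" "F \<subseteq> U"
  then obtain fs where fs: "set fs = F" using finite_list by blast
  have "set fs \<subseteq> U" using fs F by simp
  then have "(\<exists>a \<in> P. a \<notin> cl (set fs)) \<and> (\<exists>a \<in> U. a \<notin> cl (set fs \<union> P))"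
    using dense_codense unfolding dense_codense_def by blast
  then show "\<exists>x \<in> P \<inter> U. x \<notin> cl F" "\<exists>x \<in> U. x \<notin> cl (P \<union> F)"
    using fs P_subset by (auto simp: Un_commute)
qed simp

text \<open>Elements of \<open>P\<close> outside the closure of the domain are sent to elements of \<open>P \<inter> W\<close> provided by density.\<close>

lemma based_iso_extend_P:
  assumes W: "rich W" and P1: "finite P1" "P1 \<subseteq> P" and S: "based_iso S" "snd ` S \<subseteq> W"
  shows "\<exists>T. based_iso T \<and> S \<subseteq> T \<and> snd ` T \<subseteq> W \<and> P1 \<subseteq> fst ` T"
  using P1
proof (induction P1)
  case empty
  then show ?case using S by auto
next
  case (insert x P1)
  then obtain T where T: "based_iso T" "S \<subseteq> T" "snd ` T \<subseteq> W" "P1 \<subseteq> fst ` T" by auto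
  have "\<exists>x' \<in> W. based_iso (insert (x, x') T)"
  proof (cases "x \<in> cl (fst ` T)")
    case True
    then obtain x' where "x' \<in> cl (snd ` T)" "based_iso (insert (x, x') T)"
      using based_iso_insert_closure[OF T(1)] by blast
    moreover have "cl (snd ` T) \<subseteq> W" using cl_closed_subset[OF T(3) richD(1,2)[OF W]] .
    ultimately show ?thesis by blast
  next
    case False
    obtain x' where "x' \<in> P \<inter> W" "x' \<notin> cl (snd ` T)"
      using richD(4)[OF W, of "snd ` T"] based_isoD[OF T(1)] by auto
    then show ?thesis using based_iso_insert_P[OF T(1) _ False] insert.prems by auto
  qed
  then obtain x' where "x' \<in> W" "based_iso (insert (x, x') T)" by blast
  then show ?case using T by (intro exI[of _ "insert (x, x') T"]) auto
qed

text \<open>One step of the back-and-forth, with the new image in a prescribed rich set. If \<open>a\<close> depends on the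
domain and \<open>P\<close>, the finitely many elements of \<open>P\<close> involved are added first; otherwise codensity
provides the image.\<close>

lemma based_iso_extend:
  assumes W: "rich W" and S: "based_iso S" "snd ` S \<subseteq> W" and a: "a \<in> U"
  shows "\<exists>a' \<in> W. \<exists>T. based_iso T \<and> insert (a, a') S \<subseteq> T \<and> snd ` T \<subseteq> W"
proof (cases "a \<in> cl (P \<union> fst ` S)")
  case True
  then obtain P1 where P1: "finite P1" "P1 \<subseteq> P" "a \<in> cl (P1 \<union> fst ` S)"
    by (rule cl_finitary_Un[OF P_subset based_isoD(4)[OF S(1)]])
  obtain T where T: "based_iso T" "S \<subseteq> T" "snd ` T \<subseteq> W" "P1 \<subseteq> fst ` T"
    using based_iso_extend_P[OF W P1(1,2) S] by blast
  have "P1 \<union> fst ` S \<subseteq> fst ` T" using T by auto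
  then have "a \<in> cl (fst ` T)" using cl_monoD[OF P1(3)] based_isoD(4)[OF T(1)] by blast
  then obtain a' where "a' \<in> cl (snd ` T)" "based_iso (insert (a, a') T)"
    using based_iso_insert_closure[OF T(1)] by blast
  moreover have "cl (snd ` T) \<subseteq> W" using cl_closed_subset[OF T(3) richD(1,2)[OF W]] .
  ultimately show ?thesis using T by (intro bexI[of _ a'] exI[of _ "insert (a, a') T"]) auto
next
  case False
  obtain a' where a': "a' \<in> W" "a' \<notin> cl (P \<union> snd ` S)"
    using richD(5)[OF W, of "snd ` S"] based_isoD[OF S(1)] by auto
  then have "based_iso (insert (a, a') S)"
    using based_iso_insert_P_free[OF S(1) a False] richD(1)[OF W] by auto
  then show ?thesis using S a' by (intro bexI[of _ a'] exI[of _ "insert (a, a') S"]) auto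
qed

definition pair_iso :: "('a \<times> 'a) set \<Rightarrow> bool" where
  "pair_iso S \<longleftrightarrow> (\<exists>T. based_iso T \<and> S \<subseteq> T)"

lemma pair_iso_mono: "pair_iso S \<Longrightarrow> T \<subseteq> S \<Longrightarrow> pair_iso T"
  unfolding pair_iso_def by blast

lemma pair_iso_forth: "pair_iso S \<Longrightarrow> a \<in> U \<Longrightarrow> \<exists>a' \<in> U. pair_iso (insert (a, a') S)"
proof -
  assume "pair_iso S" and a: "a \<in> U"
  then obtain T where T: "based_iso T" "S \<subseteq> T" by (auto simp: pair_iso_def)
  obtain a' T' where "a' \<in> U" "based_iso T'" "insert (a, a') T \<subseteq> T'"
    using based_iso_extend[OF rich_univ T(1) based_isoD(5)[OF T(1)] a] by blast
  then show ?thesis using T(2) unfolding pair_iso_def by (intro bexI[of _ a'] exI[of _ T']) auto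
qed

lemma pair_iso_converse: "pair_iso S \<Longrightarrow> pair_iso (S\<inverse>)"
  unfolding pair_iso_def using based_iso_converse by (metis converse_mono)

lemma pair_iso_back: "pair_iso S \<Longrightarrow> a' \<in> U \<Longrightarrow> \<exists>a \<in> U. pair_iso (insert (a, a') S)"
proof -
  assume "pair_iso S" "a' \<in> U"
  then obtain a where a: "a \<in> U" "pair_iso (insert (a', a) (S\<inverse>))"
    using pair_iso_forth[OF pair_iso_converse] by blast
  have "(insert (a', a) (S\<inverse>))\<inverse> = insert (a, a') S" by auto
  then show ?thesis using pair_iso_converse[OF a(2)] a(1) by auto
qed

text \<open>The usual induction for back-and-forth systems. The only atomic formulas that need more than a local
isomorphism are \<open>P(t)\<close> for a term \<open>t\<close>: the value of \<open>t\<close> is first added to the domain of the map.\<close>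

lemma pair_iso_sat:
  assumes "wf_fm (lang_P L) \<phi>" "finite (fv \<phi>)" "pair_iso ((\<lambda>v. (s v, s' v)) ` fv \<phi>)"
  shows "sat (struct_P M P) \<phi> s \<longleftrightarrow> sat (struct_P M P) \<phi> (s' :: nat \<Rightarrow> 'a)"
  using assms
proof (induction \<phi> arbitrary: s s')
  case (Eq t u)
  then obtain T where T: "based_iso T" "(\<lambda>v. (s v, s' v)) ` fv (Eq t u :: ('f, 'r, nat) fm) \<subseteq> T"
    unfolding pair_iso_def by auto
  have "sat M (Eq t u) s \<longleftrightarrow> sat M (Eq t u) s'"
    by (rule local_isoD[OF based_isoD(3)[OF T(1)]]) (use Eq T(2) in \<open>auto simp: wf_trm_lang_P\<close>)
  then show ?case by (simp add: tval_struct_P)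
next
  case (Rel r ts)
  then obtain T where T: "based_iso T" "(\<lambda>v. (s v, s' v)) ` fv (Rel r ts) \<subseteq> T"
    unfolding pair_iso_def by auto
  have tv: "map (tval (struct_P M P) s) ts = map (tval M s) ts" for s by (simp add: tval_struct_P)
  show ?case
  proof (cases r)
    case None
    then obtain t where t: "ts = [t]" "wf_trm L t"
      using Rel.prems(1) by (auto simp: length_Suc_conv)
    have "s v \<in> U" if "v \<in> vars t" for v using that T based_isoD(2)[OF T(1)] t by auto
    then have a: "tval M s t \<in> U" using tval_in_univ[OF is_struct t(2), of s] by auto
    obtain a' T' where T': "based_iso T'" "insert (tval M s t, a') T \<subseteq> T'"
      using based_iso_extend[OF rich_univ T(1) based_isoD(5)[OF T(1)] a] by blast
    \<comment> \<open>A variable that does not occur in \<open>t\<close>, to name its value.\<close>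
    define k where "k = Suc (Max (insert 0 (vars t)))"
    have k: "k \<notin> vars t"
    proof
      assume "k \<in> vars t"
      then have "k \<le> Max (insert 0 (vars t))" using finite_vars by (intro Max_ge) auto
      then show False by (simp add: k_def)
    qed
    let ?s = "s(k := tval M s t)" and ?s' = "s'(k := a')"
    have "sat M (Eq t (Var k)) ?s \<longleftrightarrow> sat M (Eq t (Var k)) ?s'"
      by (rule local_isoD[OF based_isoD(3)[OF T'(1)]]) (use t T T' k in auto)
    moreover have "tval M ?s t = tval M s t" "tval M ?s' t = tval M s' t"
      by (rule tval_cong; use k in auto)+
    ultimately have "tval M s' t = a'" by simp
    moreover have "tval M s t \<in> P \<longleftrightarrow> a' \<in> P" using based_iso_P_iff[OF T'(1)] T'(2) by blast
    ultimately show ?thesis using None t(1) by auto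
  next
    case (Some r')
    have "sat M (Rel r' ts) s \<longleftrightarrow> sat M (Rel r' ts) s'"
      by (rule local_isoD[OF based_isoD(3)[OF T(1)]])
        (use Rel.prems(1) Some T(2) in \<open>auto simp: list_all_iff\<close>)
    then show ?thesis unfolding sat.simps tv Some by simp
  qed
next
  case (Neg \<phi>)
  then have "sat (struct_P M P) \<phi> s \<longleftrightarrow> sat (struct_P M P) \<phi> s'" by (intro Neg.IH) auto
  then show ?case by (simp only: sat.simps)
next
  case (Conj F)
  have "sat (struct_P M P) (F n) s \<longleftrightarrow> sat (struct_P M P) (F n) s'" for n
  proof (rule Conj.IH)
    have sub: "fv (F n) \<subseteq> fv (Conj F)" by auto
    show "finite (fv (F n))" using finite_subset[OF sub Conj.prems(2)] .
    show "pair_iso ((\<lambda>v. (s v, s' v)) ` fv (F n))"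
      using pair_iso_mono[OF Conj.prems(3) image_mono[OF sub]] .
  qed (use Conj.prems in auto)
  then show ?case by (simp only: sat.simps)
next
  case (Ex v \<phi>)
  let ?S = "(\<lambda>v. (s v, s' v)) ` fv (Ex v \<phi>)"
  have step: "sat (struct_P M P) \<phi> (s(v := x)) \<longleftrightarrow> sat (struct_P M P) \<phi> (s'(v := x'))"
    if "pair_iso (insert (x, x') ?S)" for x x'
  proof (rule Ex.IH)
    show "wf_fm (lang_P L) \<phi>" "finite (fv \<phi>)" using Ex.prems by auto
    show "pair_iso ((\<lambda>w. ((s(v := x)) w, (s'(v := x')) w)) ` fv \<phi>)"
      by (rule pair_iso_mono[OF that]) auto
  qed
  have "(\<exists>x \<in> U. sat (struct_P M P) \<phi> (s(v := x))) \<longleftrightarrow> (\<exists>x \<in> U. sat (struct_P M P) \<phi> (s'(v := x)))"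
  proof
    assume "\<exists>x \<in> U. sat (struct_P M P) \<phi> (s(v := x))"
    then obtain x where x: "x \<in> U" "sat (struct_P M P) \<phi> (s(v := x))" by blast
    obtain x' where "x' \<in> U" "pair_iso (insert (x, x') ?S)" using pair_iso_forth[OF Ex.prems(3) x(1)] by blast
    then show "\<exists>x \<in> U. sat (struct_P M P) \<phi> (s'(v := x))" using step x(2) by blast
  next
    assume "\<exists>x \<in> U. sat (struct_P M P) \<phi> (s'(v := x))"
    then obtain x' where x': "x' \<in> U" "sat (struct_P M P) \<phi> (s'(v := x'))" by blast
    obtain x where "x \<in> U" "pair_iso (insert (x, x') ?S)" using pair_iso_back[OF Ex.prems(3) x'(1)] by blast
    then show "\<exists>x \<in> U. sat (struct_P M P) \<phi> (s(v := x))" using step x'(2) by blast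
  qed
  then show ?case unfolding sat.simps struct_P_simps .
qed

end


section \<open>Rich subsets are elementary\<close>

lemma restr_simps [simp]:
  "univ (restr M A) = A" "clo (restr M A) = clo M" "fint (restr M A) = fint M" "rint (restr M A) = rint M"
  "restr (restr M A) B = restr M B" "restr M (univ M) = M"
  by (simp_all add: restr_def)

lemma tval_restr [simp]: "tval (restr M A) s t = tval M s t"
proof (induction t)
  case (Fn f ts)
  then have "map (tval (restr M A) s) ts = map (tval M s) ts" by simp
  then show ?case by (simp only: tval.simps restr_simps)
qed simp

lemma sat_restr_atomic: "atomic \<phi> \<Longrightarrow> sat (restr M A) \<phi> s \<longleftrightarrow> sat M \<phi> s"
  by (auto simp: atomic_def cong: map_cong)

context homogeneous_pair
begin

text \<open>Two elements outside the closure of \<open>xs\<close> have the same type over \<open>xs\<close>, and there are at least two of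
them, so none is definable from \<open>xs\<close>.\<close>

lemma fint_in_closure:
  assumes "f \<in> Funs L" "xs \<in> lists U" "length xs = farity L f"
  shows "fint M f xs \<in> cl (set xs)"
proof (rule ccontr)
  let ?a = "fint M f xs"
  assume not: "?a \<notin> cl (set xs)"
  have xs: "set xs \<subseteq> U" using assms by auto
  have aU: "?a \<in> U" using is_struct assms unfolding is_struct_def by blast
  have axs: "insert ?a (set xs) \<subseteq> U" using aU xs by simp
  obtain b where b: "b \<in> P \<inter> U" "b \<notin> cl (insert ?a (set xs))"
    using richD(4)[OF rich_univ _ axs] by auto
  then have b': "b \<notin> cl (set xs)" using cl_mono[of "set xs", OF _ axs] by auto
  have im: "fst ` Id_on X = X" "snd ` Id_on X = X" for X :: "'a set" by force+
  have "finite (Id_on (set xs))" "Id_on (set xs) \<subseteq> U \<times> U" "local_iso L M (Id_on (set xs))"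
    using xs by (auto simp: Id_on_def intro: local_iso_Id)
  from homogeneous_extend_generic[OF homogeneous this] 
  have iso: "local_iso L M (insert (?a, b) (Id_on (set xs)))"
    using aU not b b' by (simp add: im)
  let ?\<phi> = "Eq (Fn f (map Var [0..<length xs])) (Var (length xs))"
  have val: "map ((!) (xs @ [y])) [0..<length xs] = xs" for y :: 'a
    by (rule nth_equalityI) (auto simp: nth_append)
  have "sat M ?\<phi> (nth (xs @ [?a])) \<longleftrightarrow> sat M ?\<phi> (nth (xs @ [b]))"
    by (rule local_isoD[OF iso]) (use assms in \<open>auto simp: list_all_iff nth_append\<close>)
  then have "?a = b" by (simp add: comp_def val)
  then show False using b(2) cl_ext[OF axs] by auto
qed

lemma is_struct_restr:
  assumes "A \<subseteq> U" "cl A = A" "A \<noteq> {}"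
  shows "is_struct L (restr M A)"
  unfolding is_struct_def
proof (intro conjI ballI impI)
  show "univ (restr M A) \<noteq> {}" using assms by simp
  fix f xs assume f: "f \<in> Funs L" "xs \<in> lists (univ (restr M A))" "length xs = farity L f"
  then have "set xs \<subseteq> A" by auto
  then have "cl (set xs) \<subseteq> A" using cl_closed_subset assms by blast
  moreover have "fint M f xs \<in> cl (set xs)" using f assms(1) by (intro fint_in_closure) auto
  ultimately show "fint (restr M A) f xs \<in> univ (restr M A)" by auto
qed

lemma is_pgstruct_restr:
  assumes "A \<subseteq> U" "cl A = A" "A \<noteq> {}"
  shows "is_pgstruct L (restr M A)"
  unfolding is_pgstruct_def restr_simps pregeometry_def
proof (intro conjI allI impI is_struct_restr[OF assms])
  fix X assume X: "X \<subseteq> A"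
  then have XU: "X \<subseteq> U" using assms by auto
  show "X \<subseteq> cl X" "cl (cl X) = cl X" using cl_ext[OF XU] cl_idem[OF XU] by auto
  show "cl X \<subseteq> A" using cl_closed_subset[OF X assms(1,2)] .
  show "\<exists>F. finite F \<and> F \<subseteq> X \<and> x \<in> cl F" if "x \<in> cl X" for x using cl_finitary[OF XU that] .
  show "y \<in> cl (insert x X)" if "y \<in> A" "x \<in> cl (insert y X)" "x \<notin> cl X" for x y
    using cl_exchange[OF XU] that assms(1) by blast
next
  fix X Y assume "X \<subseteq> Y" "Y \<subseteq> A"
  then show "cl X \<subseteq> cl Y" using assms(1) by (intro cl_mono) auto
qed

lemma closed_sub_restr:
  assumes "A \<subseteq> B" "B \<subseteq> U" "cl A = A" "cl B = B" "A \<noteq> {}"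
  shows "closed_sub L (restr M A) (restr M B)"
  using assms is_pgstruct_restr[of A] is_pgstruct_restr[of B]
  by (auto simp: closed_sub_def closed_embedding_def)

lemma rich_nonempty: "rich W \<Longrightarrow> P \<inter> W \<noteq> {}"
  using richD(4)[of W "{}"] by auto

text \<open>The Tarski-Vaught test: given a witness in \<open>M\<close>, the back-and-forth step over a finite subset of \<open>N\<close>
finds one of the same type in \<open>N\<close>.\<close>

lemma rich_sat_restr:
  assumes N: "rich N" and "wf_fm (lang_P L) \<phi>" "finite (fv \<phi>)" "range s \<subseteq> N"
  shows "sat (struct_P (restr M N) (P \<inter> N)) \<phi> s \<longleftrightarrow> sat (struct_P M P) \<phi> (s :: nat \<Rightarrow> 'a)"
  using assms(2-)
proof (induction \<phi> arbitrary: s)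
  case (Eq t u)
  show ?case by simp
next
  case (Rel r ts)
  have tv: "map (tval (struct_P (restr M N) (P \<inter> N)) s) ts = map (tval M s) ts"
    "map (tval (struct_P M P) s) ts = map (tval M s) ts" by simp_all
  show ?case
  proof (cases r)
    case None
    then obtain t where t: "ts = [t]" "wf_trm L t"
      using Rel.prems(1) by (auto simp: length_Suc_conv)
    have "is_struct L (restr M N)" using is_struct_restr[OF richD(1,2)[OF N]] rich_nonempty[OF N] by auto
    then have "tval (restr M N) s t \<in> univ (restr M N)"
      by (rule tval_in_univ[OF _ t(2)]) (use Rel.prems(3) in auto)
    then show ?thesis using None t by auto
  next
    case (Some r')
    then show ?thesis unfolding sat.simps tv by simp
  qed
next
  case (Neg \<phi>)
  then have "sat (struct_P (restr M N) (P \<inter> N)) \<phi> s \<longleftrightarrow> sat (struct_P M P) \<phi> s" by (intro Neg.IH) auto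
  then show ?case by (simp only: sat.simps)
next
  case (Conj F)
  have "sat (struct_P (restr M N) (P \<inter> N)) (F n) s \<longleftrightarrow> sat (struct_P M P) (F n) s" for n
  proof (rule Conj.IH)
    have sub: "fv (F n) \<subseteq> fv (Conj F)" by auto
    show "finite (fv (F n))" using finite_subset[OF sub Conj.prems(2)] .
  qed (use Conj.prems in auto)
  then show ?case by (simp only: sat.simps)
next
  case (Ex v \<phi>)
  have IH: "sat (struct_P (restr M N) (P \<inter> N)) \<phi> (s(v := x)) \<longleftrightarrow> sat (struct_P M P) \<phi> (s(v := x))"
    if "x \<in> N" for x
    by (rule Ex.IH) (use Ex.prems that in auto)
  have "(\<exists>x \<in> N. sat (struct_P M P) \<phi> (s(v := x))) \<longleftrightarrow> (\<exists>x \<in> U. sat (struct_P M P) \<phi> (s(v := x)))"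
  proof
    assume "\<exists>x \<in> N. sat (struct_P M P) \<phi> (s(v := x))"
    then show "\<exists>x \<in> U. sat (struct_P M P) \<phi> (s(v := x))" using richD(1)[OF N] by blast
  next
    assume "\<exists>x \<in> U. sat (struct_P M P) \<phi> (s(v := x))"
    then obtain x where x: "x \<in> U" "sat (struct_P M P) \<phi> (s(v := x))" by blast
    have F: "finite (s ` (fv \<phi> - {v}))" "s ` (fv \<phi> - {v}) \<subseteq> N" using Ex.prems by auto
    obtain F' where F': "finite F'" "s ` (fv \<phi> - {v}) \<subseteq> F'" "F' \<subseteq> N" "based_iso (Id_on F')"
      by (rule based_extend_Id[OF richD(3,1)[OF N] F])
    have "snd ` Id_on F' \<subseteq> N" using F'(3) by auto
    then obtain x' T where x': "x' \<in> N" "based_iso T" "insert (x, x') (Id_on F') \<subseteq> T"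
      using based_iso_extend[OF N F'(4) _ x(1)] by blast
    have "(\<lambda>w. ((s(v := x)) w, (s(v := x')) w)) ` fv \<phi> \<subseteq> insert (x, x') (Id_on F')"
      using F'(2) by (auto simp: image_subset_iff)
    then have "pair_iso ((\<lambda>w. ((s(v := x)) w, (s(v := x')) w)) ` fv \<phi>)"
      using x'(2,3) unfolding pair_iso_def by (meson order.trans)
    then have "sat (struct_P M P) \<phi> (s(v := x'))"
      using pair_iso_sat[of \<phi> "s(v := x)" "s(v := x')"] Ex.prems x(2) by simp
    then show "\<exists>x \<in> N. sat (struct_P M P) \<phi> (s(v := x))" using x'(1) by blast
  qed
  then show ?case using IH by simp
qed

end


section \<open>Formulas for dependence on the predicate\<close>

lemma sat_foldr_Ex:
  "sat M (foldr Ex vs \<phi>) s \<longleftrightarrow>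
     (\<exists>s'. (\<forall>v. v \<notin> set vs \<longrightarrow> s' v = s v) \<and> (\<forall>v \<in> set vs. s' v \<in> univ M) \<and> sat M \<phi> s')"
proof (induction vs arbitrary: s)
  case Nil
  have "s' = s" if "\<forall>v. s' v = s v" for s' using that by auto
  then show ?case by auto
next
  case (Cons v vs)
  show ?case (is "_ \<longleftrightarrow> ?R")
  proof
    assume "sat M (foldr Ex (v # vs) \<phi>) s"
    then obtain x where x: "x \<in> univ M" "sat M (foldr Ex vs \<phi>) (s(v := x))" by auto
    from x(2)[unfolded Cons.IH] obtain s' where s': "\<forall>w. w \<notin> set vs \<longrightarrow> s' w = (s(v := x)) w"
      "\<forall>w \<in> set vs. s' w \<in> univ M" "sat M \<phi> s'" by blast
    have "s' v \<in> univ M" using s'(1,2) x(1) by (cases "v \<in> set vs") auto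
    then show ?R using s' by (intro exI[of _ s']) auto
  next
    assume ?R
    then obtain s' where s': "\<forall>w. w \<notin> set (v # vs) \<longrightarrow> s' w = s w"
      "\<forall>w \<in> set (v # vs). s' w \<in> univ M" "sat M \<phi> s'" by blast
    then have "sat M (foldr Ex vs \<phi>) (s(v := s' v))" unfolding Cons.IH by (intro exI[of _ s']) auto
    then show "sat M (foldr Ex (v # vs) \<phi>) s" using s'(2) by auto
  qed
qed

lemma fv_foldr_Ex: "fv (foldr Ex vs \<phi>) = fv \<phi> - set vs"
  by (induction vs) auto

lemma wf_foldr_Ex: "wf_fm L (foldr Ex vs \<phi>) \<longleftrightarrow> wf_fm L \<phi>"
  by (induction vs) auto

text \<open>The iterates of \<open>step\<close> collect the terms of bounded depth.\<close>

lemma countable_wf_trm: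
  fixes L :: "('f, 'r) lang"
  assumes "countable_lang L"
  shows "countable {t :: ('f, nat) trm. wf_trm L t}"
proof -
  define step where "step X = range Var \<union> (\<lambda>(f, ts). Fn f ts) ` (Funs L \<times> lists X)" for X :: "('f, nat) trm set"
  define T where "T n = (step ^^ n) {}" for n
  have T_Suc: "T (Suc n) = step (T n)" for n by (simp add: T_def)
  have count: "countable (T n)" for n
  proof (induction n)
    case (Suc n)
    then show ?case unfolding T_Suc step_def
      using assms by (auto simp: countable_lang_def intro!: countable_image countable_SIGMA countable_lists)
  qed (simp add: T_def)
  have step_mono: "step X \<subseteq> step Y" if "X \<subseteq> Y" for X Y
    unfolding step_def using lists_mono[OF that] by auto
  have T_mono: "T n \<subseteq> T (Suc n)" for n
  proof (induction n)
    case (Suc n)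
    then show ?case unfolding T_Suc[of "Suc n"] T_Suc[of n] by (rule step_mono)
  qed (simp add: T_def)
  have "\<exists>n. t \<in> T n" if "wf_trm L t" for t
    using that
  proof (induction t)
    case (Var v)
    have "Var v \<in> T (Suc 0)" by (simp add: T_Suc step_def)
    then show ?case ..
  next
    case (Fn f ts)
    then have "\<forall>t \<in> set ts. \<exists>n. t \<in> T n" by (auto simp: list_all_iff)
    then obtain k where k: "\<forall>t \<in> set ts. t \<in> T (k t)" unfolding bchoice_iff by blast
    have "t \<in> T (Max (k ` set ts))" if "t \<in> set ts" for t
      using lift_Suc_mono_le[of T "k t" "Max (k ` set ts)"] T_mono k that by auto
    then have "Fn f ts \<in> T (Suc (Max (k ` set ts)))"
      using Fn.prems unfolding T_Suc step_def by auto
    then show ?case ..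
  qed
  then have "{t. wf_trm L t} \<subseteq> (\<Union>n. T n)" by auto
  then show ?thesis using count by (meson countable_UN countable_subset countableI_type)
qed

lemma countable_atomic_fm:
  fixes L :: "('f, 'r) lang"
  assumes "countable_lang L"
  shows "countable {\<phi> :: ('f, 'r, nat) fm. atomic \<phi> \<and> wf_fm L \<phi>}"
proof -
  let ?T = "{t :: ('f, nat) trm. wf_trm L t}"
  let ?A = "(\<lambda>(t, u). Eq t u) ` (?T \<times> ?T) \<union> (\<lambda>(r, ts). Rel r ts) ` (Rels L \<times> lists ?T)"
  have "countable ?T" by (rule countable_wf_trm[OF assms])
  then have "countable ?A"
    using assms by (auto simp: countable_lang_def intro!: countable_image countable_SIGMA countable_lists)
  moreover have "{\<phi> :: ('f, 'r, nat) fm. atomic \<phi> \<and> wf_fm L \<phi>} \<subseteq> ?A"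
    by (fastforce simp: atomic_def list_all_iff image_iff)
  ultimately show ?thesis by (rule countable_subset[rotated])
qed

abbreviation lift_fm :: "('f, 'r, 'v) fm \<Rightarrow> ('f, 'r option, 'v) fm" where
  "lift_fm \<equiv> map_fm (\<lambda>f. f) Some (\<lambda>v. v)"

lemma lift_fm_atomic:
  assumes "atomic \<phi>"
  shows "sat (struct_P M P) (lift_fm \<phi>) s \<longleftrightarrow> sat M \<phi> s"
    and "wf_fm (lang_P L) (lift_fm \<phi>) \<longleftrightarrow> wf_fm L \<phi>"
    and "fv (lift_fm \<phi>) = fv \<phi>"
  using assms by (auto simp: atomic_def trm.map_ident list_all_iff cong: map_cong)

text \<open>The formula \<open>\<exists>x\<^sub>n, \<dots>, x\<^bsub>n+k-1\<^esub> \<in> P. \<theta>\<close>, where \<open>\<theta>\<close> is the conjunction of the countably many literals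
that hold of \<open>\<sigma>\<close> in \<open>M\<close>. It lets \<open>(L\<^sub>P)\<^bsub>\<omega>\<^sub>1\<omega>\<^esub>\<close>-types detect dependence on \<open>P\<close>. The condition \<open>0 < n\<close>
ensures that there is a literal, so that the conjunction can be enumerated.\<close>

lemma witness_formula:
  fixes M :: "('f, 'r, 'a) pgstruct" and \<sigma> :: "nat \<Rightarrow> 'a"
  assumes L: "countable_lang L" and n: "0 < n"
  shows "\<exists>\<psi>. wf_fm (lang_P L) \<psi> \<and> fv \<psi> \<subseteq> {..<n} \<and>
    (\<forall>(N :: ('f, 'r, 'a) pgstruct) Q s. sat (struct_P N Q) \<psi> s \<longleftrightarrow>
      (\<exists>s'. (\<forall>i. i \<notin> {n..<n + k} \<longrightarrow> s' i = s i) \<and> (\<forall>i \<in> {n..<n + k}. s' i \<in> univ N \<inter> Q) \<and>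
        (\<forall>\<phi>. atomic \<phi> \<longrightarrow> wf_fm L \<phi> \<longrightarrow> fv \<phi> \<subseteq> {..<n + k} \<longrightarrow> (sat M \<phi> \<sigma> \<longleftrightarrow> sat N \<phi> s'))))"
proof -
  define A where "A = {\<phi> :: ('f, 'r, nat) fm. atomic \<phi> \<and> wf_fm L \<phi> \<and> fv \<phi> \<subseteq> {..<n + k}}"
  define lit where "lit \<phi> = (if sat M \<phi> \<sigma> then lift_fm \<phi> else Neg (lift_fm \<phi>))" for \<phi>
  define \<Gamma> where "\<Gamma> = lit ` A \<union> (\<lambda>i. Rel None [Var i]) ` {n..<n + k}"
  have "countable A"
    by (rule countable_subset[OF _ countable_atomic_fm[OF L]]) (auto simp: A_def)
  then have "countable \<Gamma>" by (simp add: \<Gamma>_def)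
  moreover have "Eq (Var 0) (Var 0) \<in> A" using n by (simp add: A_def atomic_def)
  then have "\<Gamma> \<noteq> {}" by (auto simp: \<Gamma>_def)
  ultimately have range: "range (from_nat_into \<Gamma>) = \<Gamma>" by (simp add: range_from_nat_into)
  define \<chi> where "\<chi> = Conj (from_nat_into \<Gamma>)"
  have wf: "wf_fm (lang_P L) \<gamma> \<and> fv \<gamma> \<subseteq> {..<n + k}" if "\<gamma> \<in> \<Gamma>" for \<gamma>
    using that by (auto simp: \<Gamma>_def lit_def A_def lift_fm_atomic)
  have sat_lit: "sat (struct_P N Q) (lit \<phi>) s \<longleftrightarrow> (sat M \<phi> \<sigma> \<longleftrightarrow> sat N \<phi> s)"
    if "\<phi> \<in> A" for \<phi> s Q and N :: "('f, 'r, 'a) pgstruct"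
    using that by (auto simp: lit_def A_def lift_fm_atomic)
  have "sat (struct_P N Q) \<chi> s \<longleftrightarrow> (\<forall>\<gamma> \<in> \<Gamma>. sat (struct_P N Q) \<gamma> s)"
    for s Q and N :: "('f, 'r, 'a) pgstruct"
  proof -
    have "sat (struct_P N Q) \<chi> s \<longleftrightarrow> (\<forall>\<gamma> \<in> range (from_nat_into \<Gamma>). sat (struct_P N Q) \<gamma> s)"
      by (simp add: \<chi>_def)
    then show ?thesis unfolding range .
  qed
  also have "(\<forall>\<gamma> \<in> \<Gamma>. sat (struct_P N Q) \<gamma> s) \<longleftrightarrow> (\<forall>\<phi> \<in> A. sat M \<phi> \<sigma> \<longleftrightarrow> sat N \<phi> s) \<and> (\<forall>i \<in> {n..<n + k}. s i \<in> Q)"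
    for s Q and N :: "('f, 'r, 'a) pgstruct"
    by (simp add: \<Gamma>_def ball_Un sat_lit image_iff)
  finally have sat: "sat (struct_P N Q) \<chi> s \<longleftrightarrow>
      (\<forall>\<phi> \<in> A. sat M \<phi> \<sigma> \<longleftrightarrow> sat N \<phi> s) \<and> (\<forall>i \<in> {n..<n + k}. s i \<in> Q)"
    for s Q and N :: "('f, 'r, 'a) pgstruct" .
  show ?thesis
  proof (intro exI[of _ "foldr Ex [n..<n + k] \<chi>"] conjI allI)
    have "wf_fm (lang_P L) (from_nat_into \<Gamma> i)" "fv (from_nat_into \<Gamma> i) \<subseteq> {..<n + k}" for i
      using wf range by blast+
    then show "wf_fm (lang_P L) (foldr Ex [n..<n + k] \<chi>)" "fv (foldr Ex [n..<n + k] \<chi>) \<subseteq> {..<n}"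
      by (force simp: wf_foldr_Ex fv_foldr_Ex \<chi>_def)+
    fix N :: "('f, 'r, 'a) pgstruct" and Q s
    show "sat (struct_P N Q) (foldr Ex [n..<n + k] \<chi>) s \<longleftrightarrow>
      (\<exists>s'. (\<forall>i. i \<notin> {n..<n + k} \<longrightarrow> s' i = s i) \<and> (\<forall>i \<in> {n..<n + k}. s' i \<in> univ N \<inter> Q) \<and>
        (\<forall>\<phi>. atomic \<phi> \<longrightarrow> wf_fm L \<phi> \<longrightarrow> fv \<phi> \<subseteq> {..<n + k} \<longrightarrow> (sat M \<phi> \<sigma> \<longleftrightarrow> sat N \<phi> s')))"
      unfolding sat_foldr_Ex sat set_upt struct_P_simps A_def by auto
  qed
qed


section \<open>Sub-pairs are the rich subsets\<close>

context homogeneous_pair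
begin

text \<open>With \<open>N = U\<close> and \<open>xs\<close>, \<open>ys\<close> of the same type this compares two tuples of \<open>M\<close>; with \<open>xs = ys\<close> in \<open>N\<close>
it exploits that \<open>N\<close> is elementary.\<close>

lemma transfer_witnesses:
  assumes len: "length xs = length ys" "xs \<noteq> []" and U: "set xs \<subseteq> U" "N \<subseteq> U"
    and ps: "set ps \<subseteq> P"
    and imp: "\<And>\<psi>. wf_fm (lang_P L) \<psi> \<Longrightarrow> fv \<psi> \<subseteq> {..<length xs} \<Longrightarrow>
      sat (struct_P M P) \<psi> (nth xs) \<Longrightarrow> sat (struct_P (restr M N) (P \<inter> N)) \<psi> (nth ys)"
  shows "\<exists>qs. length qs = length ps \<and> set qs \<subseteq> P \<inter> N \<and> local_iso L M (set (zip (xs @ ps) (ys @ qs)))"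
proof -
  let ?n = "length xs" and ?k = "length ps"
  have npos: "0 < ?n" using len(2) by simp
  obtain \<psi> where \<psi>: "wf_fm (lang_P L) \<psi>" "fv \<psi> \<subseteq> {..<?n}"
    and sat: "\<And>(N :: ('f, 'r, 'a) pgstruct) Q s. sat (struct_P N Q) \<psi> s \<longleftrightarrow>
      (\<exists>s'. (\<forall>i. i \<notin> {?n..<?n + ?k} \<longrightarrow> s' i = s i) \<and> (\<forall>i \<in> {?n..<?n + ?k}. s' i \<in> univ N \<inter> Q) \<and>
        (\<forall>\<phi>. atomic \<phi> \<longrightarrow> wf_fm L \<phi> \<longrightarrow> fv \<phi> \<subseteq> {..<?n + ?k} \<longrightarrow> (sat M \<phi> (nth (xs @ ps)) \<longleftrightarrow> sat N \<phi> s')))"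
    using witness_formula[OF countable_L npos, where k = ?k and M = M and \<sigma> = "nth (xs @ ps)"] by blast
  have "sat (struct_P M P) \<psi> (nth xs)"
    unfolding sat
  proof (intro exI[of _ "\<lambda>i. if i \<in> {?n..<?n + ?k} then ps ! (i - ?n) else xs ! i"] conjI allI ballI impI)
    fix i assume i: "i \<in> {?n..<?n + ?k}"
    then have "ps ! (i - ?n) \<in> set ps" by (intro nth_mem) auto
    then show "(if i \<in> {?n..<?n + ?k} then ps ! (i - ?n) else xs ! i) \<in> U \<inter> P"
      using i ps P_subset by auto
  next
    fix \<phi> :: "('f, 'r, nat) fm"
    assume "fv \<phi> \<subseteq> {..<?n + ?k}"
    then show "sat M \<phi> (nth (xs @ ps)) \<longleftrightarrow> sat M \<phi> (\<lambda>i. if i \<in> {?n..<?n + ?k} then ps ! (i - ?n) else xs ! i)"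
      by (intro sat_cong) (auto simp: nth_append)
  qed auto
  then have "sat (struct_P (restr M N) (P \<inter> N)) \<psi> (nth ys)" using imp \<psi> by blast
  then obtain s' where s': "\<And>i. i \<notin> {?n..<?n + ?k} \<Longrightarrow> s' i = ys ! i"
    "\<And>i. i \<in> {?n..<?n + ?k} \<Longrightarrow> s' i \<in> univ (restr M N) \<inter> (P \<inter> N)"
    "\<And>\<phi>. atomic \<phi> \<Longrightarrow> wf_fm L \<phi> \<Longrightarrow> fv \<phi> \<subseteq> {..<?n + ?k} \<Longrightarrow> sat M \<phi> (nth (xs @ ps)) \<longleftrightarrow> sat (restr M N) \<phi> s'"
    unfolding sat by blast
  define qs where "qs = map s' [?n..<?n + ?k]"
  have s'_nth: "s' i = (ys @ qs) ! i" if "i < ?n + ?k" for i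
    using that s'(1)[of i] len by (auto simp: qs_def nth_append)
  have "local_iso L M (set (zip (xs @ ps) (ys @ qs)))"
  proof (rule local_iso_zipI)
    show "length (xs @ ps) = length (ys @ qs)" using len by (simp add: qs_def)
    fix \<phi> :: "('f, 'r, nat) fm"
    assume \<phi>: "atomic \<phi>" "wf_fm L \<phi>" "fv \<phi> \<subseteq> {..<length (xs @ ps)}"
    then have "sat M \<phi> (nth (xs @ ps)) \<longleftrightarrow> sat M \<phi> s'" using s'(3)[of \<phi>] sat_restr_atomic by simp
    also have "\<dots> \<longleftrightarrow> sat M \<phi> (nth (ys @ qs))" using s'_nth \<phi>(3) by (intro sat_cong) auto
    finally show "sat M \<phi> (nth (xs @ ps)) \<longleftrightarrow> sat M \<phi> (nth (ys @ qs))" .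
  qed
  moreover have "set qs \<subseteq> P \<inter> N" using s'(2) by (auto simp: qs_def)
  ultimately show ?thesis by (intro exI[of _ qs]) (simp add: qs_def)
qed

lemma fst_snd_set_zip: "length xs = length ys \<Longrightarrow> fst ` set (zip xs ys) = set xs"
  "length xs = length ys \<Longrightarrow> snd ` set (zip xs ys) = set ys"
  by (simp_all flip: set_map)

text \<open>If \<open>a \<in> N\<close> depends on \<open>P\<close> and finitely many elements of \<open>N\<close>, elementarity moves the elements of \<open>P\<close>
involved into \<open>N\<close>. This independence of \<open>N\<close> from \<open>P\<close> also turns codensity of \<open>P \<inter> N\<close> in \<open>N\<close> into
codensity over the whole of \<open>P\<close>.\<close>

lemma sub_pair_rich:
  assumes "sub_pair L \<C> M P N"
  shows "rich N"
proof -
  have bp: "beautiful_pair L \<C> (restr M N) (P \<inter> N)" and cs: "closed_sub L (restr M N) M"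
    and elem: "elem_sub (lang_P L) (struct_P (restr M N) (P \<inter> N)) (struct_P M P)"
    using assms by (auto simp: sub_pair_def)
  have NU: "N \<subseteq> U" and pg: "pregeometry N cl"
    using cs by (auto simp: closed_sub_def closed_embedding_def is_pgstruct_def)
  interpret N: pregeom N cl using pg by unfold_locales
  have Ncl: "cl N = N" using N.cl_subset[of N] N.cl_ext[of N] by auto
  have ind: "cl (P \<union> F) \<inter> N \<subseteq> cl (P \<inter> N \<union> F)" if F: "finite F" "F \<subseteq> N" for F
  proof
    fix a assume a: "a \<in> cl (P \<union> F) \<inter> N"
    have FU: "F \<subseteq> U" using F NU by auto
    obtain P1 where P1: "finite P1" "P1 \<subseteq> P" "a \<in> cl (P1 \<union> F)"
      by (rule cl_finitary_Un[OF P_subset FU, of a]) (use a in auto)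
    obtain ps fs where ps: "set ps = P1" and fs: "set fs = F" using P1(1) F(1) finite_list by metis
    let ?xs = "a # fs"
    have xsN: "set ?xs \<subseteq> N" using a fs F by auto
    have "\<exists>qs. length qs = length ps \<and> set qs \<subseteq> P \<inter> N \<and> local_iso L M (set (zip (?xs @ ps) (?xs @ qs)))"
    proof (rule transfer_witnesses)
      show "set ?xs \<subseteq> U" "set ps \<subseteq> P" using xsN NU ps P1 by auto
      fix \<psi> :: "('f, 'r option, nat) fm"
      assume \<psi>: "wf_fm (lang_P L) \<psi>" "fv \<psi> \<subseteq> {..<length ?xs}" "sat (struct_P M P) \<psi> (nth ?xs)"
      let ?s = "\<lambda>i. if i < length ?xs then ?xs ! i else a"
      have cong: "sat K \<psi> (nth ?xs) \<longleftrightarrow> sat K \<psi> ?s" for K :: "('f, 'r option, 'a) struct"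
        using \<psi>(2) by (intro sat_cong) auto
      have sN: "?s i \<in> N" for i using xsN nth_mem[of i ?xs] by auto
      have rs: "range ?s \<subseteq> univ (struct_P (restr M N) (P \<inter> N))"
        unfolding struct_P_simps restr_simps by (intro image_subsetI sN)
      have "finite (fv \<psi>)" using \<psi>(2) finite_subset by blast
      from elem[unfolded elem_sub_def, THEN conjunct2, rule_format, OF \<psi>(1) this rs]
      show "sat (struct_P (restr M N) (P \<inter> N)) \<psi> (nth ?xs)" using \<psi>(3) cong by simp
    qed (use NU in auto)
    then obtain qs where qs: "length qs = length ps" "set qs \<subseteq> P \<inter> N"
      "local_iso L M (set (zip (?xs @ ps) (?xs @ qs)))" by blast
    let ?S = "set (zip (?xs @ ps) (?xs @ qs))" and ?T = "set (zip (fs @ ps) (fs @ qs))"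
    have dom: "fst ` ?S = set (?xs @ ps)" "snd ` ?S = set (?xs @ qs)"
      by (rule fst_snd_set_zip; use qs(1) in simp)+
    have dom_U: "set (?xs @ ps) \<subseteq> U" "set (?xs @ qs) \<subseteq> U" using xsN NU ps P1 P_subset qs(2) by auto
    have "?S \<subseteq> U \<times> U"
      by (rule order.trans[OF subset_fst_snd Sigma_mono]) (simp_all only: dom dom_U)
    then have "a \<in> cl (fst ` ?T) \<longleftrightarrow> a \<in> cl (snd ` ?T)"
      by (intro local_iso_closure_iff[OF qs(3)]) auto
    moreover have "fst ` ?T = set (fs @ ps)" "snd ` ?T = set (fs @ qs)"
      by (rule fst_snd_set_zip; use qs(1) in simp)+
    ultimately have "a \<in> cl (set (fs @ ps)) \<longleftrightarrow> a \<in> cl (set (fs @ qs))" by (simp only:)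
    then have "a \<in> cl (set qs \<union> F)" using P1(3) ps fs by (simp add: Un_commute)
    then show "a \<in> cl (P \<inter> N \<union> F)"
      by (rule cl_monoD) (use qs(2) NU FU in auto)
  qed
  have dc: "(\<exists>a \<in> P \<inter> N. a \<notin> cl F) \<and> (\<exists>a \<in> N. a \<notin> cl (F \<union> P \<inter> N))" if F: "finite F" "F \<subseteq> N" for F
  proof -
    obtain fs where fs: "set fs = F" using F(1) finite_list by metis
    have "dense_codense (restr M N) (P \<inter> N)" using bp by (simp add: beautiful_pair_def)
    then show ?thesis using fs F(2) unfolding dense_codense_def by auto
  qed
  show ?thesis
  proof (rule richI[OF NU Ncl])
    show "based N" using based_if_independent[OF NU ind] .
    fix F assume F: "finite F" "F \<subseteq> N"
    show "\<exists>x \<in> P \<inter> N. x \<notin> cl F" using dc[OF F] by blast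
    show "\<exists>x \<in> N. x \<notin> cl (P \<union> F)" using dc[OF F] ind[OF F] by (auto simp: Un_commute)
  qed
qed

lemma closed_P_Int: "N \<subseteq> U \<Longrightarrow> cl N = N \<Longrightarrow> cl (P \<inter> N) = P \<inter> N"
  using cl_closed_subset[of "P \<inter> N" N] cl_P_subset[of "P \<inter> N"] cl_ext[of "P \<inter> N"] by auto

lemma rich_beautiful_pair:
  assumes \<C>: "quasiminimal_class L \<C>" "M \<in> \<C>" and N: "rich N"
  shows "beautiful_pair L \<C> (restr M N) (P \<inter> N)"
  unfolding beautiful_pair_def
proof (intro conjI)
  note N' = richD(1,2)[OF N]
  have ne: "P \<inter> N \<noteq> {}" "N \<noteq> {}" using rich_nonempty[OF N] by auto
  have U: "cl U = U" using richD(2)[OF rich_univ] .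
  have "closed_sub L (restr M N) (restr M U)" using closed_sub_restr N' ne U by blast
  then show "restr M N \<in> \<C>" using quasiminimal_class_closed_sub[OF \<C>] by simp
  have "closed_sub L (restr M (P \<inter> N)) (restr M U)"
    using closed_sub_restr[OF _ _ closed_P_Int[OF N'] U ne(1)] N' by auto
  then show "restr (restr M N) (P \<inter> N) \<in> \<C>" using quasiminimal_class_closed_sub[OF \<C>] by simp
  have "closed_sub L (restr M (P \<inter> N)) (restr M N)"
    using closed_sub_restr[OF _ N'(1) closed_P_Int[OF N'] N'(2) ne(1)] by auto
  then show "closed_sub L (restr (restr M N) (P \<inter> N)) (restr M N)" by simp
  show "P \<inter> N \<subseteq> univ (restr M N)" by simp
  show "dense_codense (restr M N) (P \<inter> N)"
    unfolding dense_codense_def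
  proof (intro allI impI)
    fix bs assume "set bs \<subseteq> univ (restr M N)"
    then have bs: "set bs \<subseteq> U" using N' by auto
    obtain x y where x: "x \<in> P \<inter> N" "x \<notin> cl (set bs)" and y: "y \<in> N" "y \<notin> cl (P \<union> set bs)"
      using richD(4,5)[OF N _ bs] by blast
    have "cl (set bs \<union> P \<inter> N) \<subseteq> cl (P \<union> set bs)" using bs P_subset by (intro cl_mono) auto
    then show "(\<exists>a \<in> P \<inter> N. a \<notin> clo (restr M N) (set bs)) \<and>
        (\<exists>a \<in> univ (restr M N). a \<notin> clo (restr M N) (set bs \<union> P \<inter> N))"
      using x y by auto
  qed
qed

lemma rich_sub_pair:
  assumes \<C>: "quasiminimal_class L \<C>" "M \<in> \<C>" and N: "rich N" "rich N1" "N \<subseteq> N1"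
  shows "sub_pair L \<C> (restr M N1) (P \<inter> N1) N"
  unfolding sub_pair_def
proof (intro conjI)
  have PN: "P \<inter> N1 \<inter> N = P \<inter> N" using N(3) by auto
  show "beautiful_pair L \<C> (restr M N1) (P \<inter> N1)" using rich_beautiful_pair[OF \<C> N(2)] .
  show "beautiful_pair L \<C> (restr (restr M N1) N) (P \<inter> N1 \<inter> N)"
    unfolding PN using rich_beautiful_pair[OF \<C> N(1)] by simp
  show "closed_sub L (restr (restr M N1) N) (restr M N1)"
    using closed_sub_restr[OF N(3) richD(1)[OF N(2)] richD(2)[OF N(1)] richD(2)[OF N(2)]] rich_nonempty[OF N(1)]
    by auto
  show "elem_sub (lang_P L) (struct_P (restr (restr M N1) N) (P \<inter> N1 \<inter> N)) (struct_P (restr M N1) (P \<inter> N1))"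
    unfolding elem_sub_def PN restr_simps
  proof (intro conjI allI impI)
    show "univ (struct_P (restr M N) (P \<inter> N)) \<subseteq> univ (struct_P (restr M N1) (P \<inter> N1))" using N(3) by simp
    fix \<phi> :: "('f, 'r option, nat) fm" and s :: "nat \<Rightarrow> 'a"
    assume \<phi>: "wf_fm (lang_P L) \<phi>" "finite (fv \<phi>)" "range s \<subseteq> univ (struct_P (restr M N) (P \<inter> N))"
    show "sat (struct_P (restr M N) (P \<inter> N)) \<phi> s \<longleftrightarrow> sat (struct_P (restr M N1) (P \<inter> N1)) \<phi> s"
      using rich_sat_restr[OF N(1) \<phi>(1,2), of s] rich_sat_restr[OF N(2) \<phi>(1,2), of s] \<phi>(3) N(3) by auto
  qed
qed


section \<open>Types that do not split\<close>

lemma pair_iso_swap: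
  assumes iso: "pair_iso (insert (a, a') (Id_on (set xs)))"
    and \<phi>: "wf_fm (lang_P L) \<phi>" "fv \<phi> \<subseteq> {..<Suc (length xs)}"
  shows "sat (struct_P M P) \<phi> (nth (a # xs)) \<longleftrightarrow> sat (struct_P M P) \<phi> (nth (a' # xs))"
proof (rule pair_iso_sat[OF \<phi>(1)])
  show "finite (fv \<phi>)" using \<phi>(2) finite_subset by blast
  have "((a # xs) ! v, (a' # xs) ! v) \<in> insert (a, a') (Id_on (set xs))" if "v < Suc (length xs)" for v
    using that by (cases v) auto
  then have "(\<lambda>v. ((a # xs) ! v, (a' # xs) ! v)) ` fv \<phi> \<subseteq> insert (a, a') (Id_on (set xs))"
    using \<phi>(2) by blast
  then show "pair_iso ((\<lambda>v. ((a # xs) ! v, (a' # xs) ! v)) ` fv \<phi>)" by (rule pair_iso_mono[OF iso])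
qed

text \<open>The types of \<open>(a, bs)\<close> and \<open>(a, cs)\<close> over \<open>N\<close> are compared in three steps: from \<open>(a, bs)\<close> to \<open>(a', bs)\<close>;
then to \<open>(a', cs)\<close>, because \<open>a' \<in> N\<close> is a parameter for the common type of \<open>bs\<close> and \<open>cs\<close>; and back to
\<open>(a, cs)\<close>. The choice of \<open>a'\<close> depends on the finitely many parameters of the formula at hand.\<close>

lemma coheir_not_splits:
  assumes N: "N \<subseteq> N1"
    and coheir: "\<And>F. finite F \<Longrightarrow> F \<subseteq> N1 \<Longrightarrow> \<exists>a' \<in> N. pair_iso (insert (a, a') (Id_on F))"
  shows "\<not> lascar_splits L M P [a] N1 N"
proof
  assume "lascar_splits L M P [a] N1 N"
  then obtain bs cs where bc: "set bs \<subseteq> N1" "set cs \<subseteq> N1" "tp_P L M P bs N = tp_P L M P cs N"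
    "tp_P L M P ([a] @ bs) N \<noteq> tp_P L M P ([a] @ cs) N"
    unfolding lascar_splits_def by blast
  have sub: "tp_P L M P ([a] @ bs) N \<subseteq> tp_P L M P ([a] @ cs) N"
    if bc: "set bs \<subseteq> N1" "set cs \<subseteq> N1" and eq: "tp_P L M P bs N = tp_P L M P cs N" for bs cs
  proof
    fix q assume q: "q \<in> tp_P L M P ([a] @ bs) N"
    obtain \<phi> ds where "q = (\<phi>, ds)" by force
    with q have \<phi>: "wf_fm (lang_P L) \<phi>" "set ds \<subseteq> N" "fv \<phi> \<subseteq> {..<Suc (length bs + length ds)}"
      "sat (struct_P M P) \<phi> (nth (a # bs @ ds))"
      by (auto simp: tp_P_def itp_def)
    have len: "length bs = length cs"
    proof -
      have *: "(Eq (Var k) (Var k), []) \<in> tp_P L M P xs N \<longleftrightarrow> k < length xs" for k xs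
        by (auto simp: tp_P_def itp_def)
      have "k < length bs \<longleftrightarrow> k < length cs" for k
        using *[of k bs] *[of k cs] eq by simp
      then show ?thesis by (meson nat_neq_iff order_less_irrefl)
    qed
    obtain a' where a': "a' \<in> N" "pair_iso (insert (a, a') (Id_on (set bs \<union> set cs \<union> set ds)))"
      using coheir[of "set bs \<union> set cs \<union> set ds"] bc order.trans[OF \<phi>(2) N] by auto
    have swap: "sat (struct_P M P) \<phi> (nth (a # xs @ ds)) \<longleftrightarrow> sat (struct_P M P) \<phi> (nth (a' # xs @ ds))"
      if xs: "length xs = length bs" "set xs \<subseteq> set bs \<union> set cs" for xs
    proof (rule pair_iso_swap[OF _ \<phi>(1)])
      show "pair_iso (insert (a, a') (Id_on (set (xs @ ds))))"
        by (rule pair_iso_mono[OF a'(2)]) (use xs in auto)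
      show "fv \<phi> \<subseteq> {..<Suc (length (xs @ ds))}" using \<phi>(3) xs by simp
    qed
    define n where "n = length bs"
    \<comment> \<open>The permutation that moves the first entry of \<open>a' # xs @ ds\<close> behind \<open>xs\<close>, among the parameters.\<close>
    define h where "h i = (if i = 0 then n else if i \<le> n then i - 1 else i)" for i
    have inj: "inj h" by (rule injI) (auto simp: h_def split: if_splits)
    have h: "(xs @ a' # ds) ! h i = (a' # xs @ ds) ! i" if "length xs = n" for xs i
      using that by (cases i) (auto simp: h_def nth_append nth_Cons' Suc_diff_le not_less_eq_eq)
    have rename: "sat (struct_P M P) (rename h \<phi>) (nth (xs @ a' # ds)) \<longleftrightarrow>
        sat (struct_P M P) \<phi> (nth (a' # xs @ ds))" if "length xs = n" for xs
      using sat_map_fm[of h \<phi> "struct_P M P" "nth (xs @ a' # ds)"] inj h[OF that] by simp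
    have mem: "(rename h \<phi>, a' # ds) \<in> tp_P L M P xs N \<longleftrightarrow> sat (struct_P M P) \<phi> (nth (a' # xs @ ds))"
      if "length xs = n" for xs
    proof -
      have "h ` fv \<phi> \<subseteq> {..<n + length (a' # ds)}"
        using \<phi>(3) by (auto simp: h_def n_def)
      then show ?thesis
        using \<phi> a'(1) that rename[OF that] by (simp add: tp_P_def itp_def wf_map_fm fv_map_fm inj)
    qed
    have "sat (struct_P M P) \<phi> (nth (a' # bs @ ds))" using swap[of bs] \<phi>(4) by simp
    then have "sat (struct_P M P) \<phi> (nth (a' # cs @ ds))"
      using mem[of bs] mem[of cs] eq len by (simp add: n_def)
    then have "sat (struct_P M P) \<phi> (nth (a # cs @ ds))" using swap[of cs] len by simp
    then show "q \<in> tp_P L M P ([a] @ cs) N"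
      using \<open>q = (\<phi>, ds)\<close> \<phi> len by (simp add: tp_P_def itp_def)
  qed
  from sub[OF bc(1-3)] sub[OF bc(2,1) bc(3)[symmetric]] bc(4) show False by blast
qed

lemma member_not_splits:
  assumes N: "rich N1" "N \<subseteq> N1" and a: "a \<in> N"
  shows "\<not> lascar_splits L M P [a] N1 N"
proof (rule coheir_not_splits[OF N(2)])
  fix F assume F: "finite F" "F \<subseteq> N1"
  then have aF: "finite (insert a F)" "insert a F \<subseteq> N1" using a N(2) by auto
  obtain F' where "insert a F \<subseteq> F'" "based_iso (Id_on F')"
    by (rule based_extend_Id[OF richD(3,1)[OF N(1)] aF])
  then have "pair_iso (insert (a, a) (Id_on F))" unfolding pair_iso_def by (intro exI[of _ "Id_on F'"]) auto
  then show "\<exists>a' \<in> N. pair_iso (insert (a, a') (Id_on F))" using a by blast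
qed

text \<open>As \<open>N\<close> has infinite dimension over \<open>P\<close>, it contains elements as generic over a given finite set as \<open>a\<close>.\<close>

lemma generic_not_splits:
  assumes N: "rich N" "rich N1" "N \<subseteq> N1" and a: "a \<in> U" "a \<notin> cl (P \<union> N1)"
  shows "\<not> lascar_splits L M P [a] N1 N"
proof (rule coheir_not_splits[OF N(3)])
  fix F assume F: "finite F" "F \<subseteq> N1"
  obtain F' where F': "finite F'" "F \<subseteq> F'" "F' \<subseteq> N1" "based_iso (Id_on F')"
    by (rule based_extend_Id[OF richD(3,1)[OF N(2)] F])
  have im: "fst ` Id_on F' = F'" "snd ` Id_on F' = F'" by force+
  have "P \<union> N1 \<subseteq> U" using P_subset richD(1)[OF N(2)] by simp
  then have "cl (P \<union> F') \<subseteq> cl (P \<union> N1)" using F'(3) by (intro cl_mono) auto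
  then have a': "a \<notin> cl (P \<union> F')" using a by blast
  obtain b where b: "b \<in> N" "b \<notin> cl (P \<union> F')"
    using richD(5)[OF N(1) F'(1)] F'(3) richD(1)[OF N(2)] by auto
  have "based_iso (insert (a, b) (Id_on F'))"
    by (rule based_iso_insert_P_free[OF F'(4)]) (use a a' b richD(1)[OF N(1)] im in auto)
  then have "pair_iso (insert (a, b) (Id_on F))"
    unfolding pair_iso_def using F'(2) by (intro exI[of _ "insert (a, b) (Id_on F')"]) auto
  then show "\<exists>a' \<in> N. pair_iso (insert (a, a') (Id_on F))" using b by blast
qed

text \<open>As \<open>a\<close> is not in \<open>N1\<close>, neither is \<open>q\<close>, which can therefore be replaced by some \<open>r \<in> P \<inter> N\<close> outside the
closure of the given finite set. As \<open>m\<close> stays fixed, the image of \<open>a\<close> is in the closure of \<open>r\<close>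
and \<open>m\<close>, hence in \<open>N\<close>.\<close>

lemma line_not_splits:
  assumes N: "rich N" "rich N1" "N \<subseteq> N1"
    and a: "a \<notin> N1" "a \<in> cl (insert q m)" and q: "q \<in> P" and m: "finite m" "m \<subseteq> N"
  shows "\<not> lascar_splits L M P [a] N1 N"
proof (rule coheir_not_splits[OF N(3)])
  have q': "q \<notin> N1"
  proof
    assume "q \<in> N1"
    then have "insert q m \<subseteq> N1" using m N(3) by auto
    then show False using cl_closed_subset[OF _ richD(1,2)[OF N(2)]] a by blast
  qed
  fix F assume F: "finite F" "F \<subseteq> N1"
  then have Fm: "finite (F \<union> m)" "F \<union> m \<subseteq> N1" using m N(3) by auto
  obtain F' where F': "finite F'" "F \<union> m \<subseteq> F'" "F' \<subseteq> N1" "based_iso (Id_on F')"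
    by (rule based_extend_Id[OF richD(3,1)[OF N(2)] Fm])
  have im: "fst ` Id_on X = X" "snd ` Id_on X = X" for X :: "'a set" by force+
  have F'U: "F' \<subseteq> U" using F'(3) richD(1)[OF N(2)] by auto
  have qF': "q \<notin> cl F'" using q' cl_closed_subset[OF F'(3) richD(1,2)[OF N(2)]] by blast
  obtain r where r: "r \<in> P \<inter> N" "r \<notin> cl F'" using richD(4)[OF N(1) F'(1) F'U] by blast
  let ?S = "insert (q, r) (Id_on F')"
  have S: "based_iso ?S"
    by (rule based_iso_insert_P[OF F'(4) q]) (use r qF' in \<open>auto simp: im\<close>)
  have "insert q m \<subseteq> fst ` ?S" using F'(2) by (auto simp: im)
  then have "a \<in> cl (fst ` ?S)" using cl_monoD[OF a(2)] based_isoD(4)[OF S] by blast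
  then obtain b where b: "based_iso (insert (a, b) ?S)" using based_iso_insert_closure[OF S] by blast
  let ?T = "insert (q, r) (Id_on m)"
  have "?T \<subseteq> insert (a, b) ?S" using F'(2) by auto
  then have "a \<in> cl (fst ` ?T) \<longleftrightarrow> b \<in> cl (snd ` ?T)"
    by (intro local_iso_closure_iff[OF based_isoD(3,1,2)[OF b]]) auto
  then have "b \<in> cl (insert r m)" using a(2) by (simp add: im)
  moreover have "cl (insert r m) \<subseteq> N"
    by (rule cl_closed_subset[OF _ richD(1,2)[OF N(1)]]) (use r m in auto)
  moreover have "pair_iso (insert (a, b) (Id_on F))"
    unfolding pair_iso_def using b F'(2) by (intro exI[of _ "insert (a, b) ?S"]) auto
  ultimately show "\<exists>a' \<in> N. pair_iso (insert (a, a') (Id_on F))" by blast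
qed


section \<open>Upper bounds for the rank\<close>

lemma sub_pair_subset: "sub_pair L \<C> K Q N \<Longrightarrow> N \<subseteq> univ K"
  by (auto simp: sub_pair_def closed_sub_def closed_embedding_def)

text \<open>The second splitting shows \<open>a \<notin> N1\<close>. Then, in a disintegrated pregeometry, the closure of
\<open>P \<union> N1\<close> contains \<open>a\<close> only if the closure of a single element of \<open>P\<close> does, and the first splitting is impossible.\<close>

lemma disintegrated_rank:
  assumes dis: "disintegrated U cl" and a: "a \<in> U" and N0: "sub_pair L \<C> M P N0"
  shows "\<not> ULsp_ge L \<C> M P [a] 2 N0"
proof
  assume "ULsp_ge L \<C> M P [a] 2 N0"
  then obtain N1 N2 where N: "sub_pair L \<C> M P N1" "sub_pair L \<C> (restr M N1) (P \<inter> N1) N0"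
    "lascar_splits L M P [a] N1 N0" "sub_pair L \<C> M P N2" "sub_pair L \<C> (restr M N2) (P \<inter> N2) N1"
    "lascar_splits L M P [a] N2 N1"
    by (auto simp: numeral_2_eq_2)
  have rich: "rich N0" "rich N1" "rich N2" using sub_pair_rich N0 N(1,4) by auto
  have sub: "N0 \<subseteq> N1" "N1 \<subseteq> N2" using sub_pair_subset N(2,5) by fastforce+
  have aN1: "a \<notin> N1" using member_not_splits[OF rich(3) sub(2)] N(6) by blast
  have "a \<in> cl (P \<union> N1)" using generic_not_splits[OF rich(1,2) sub(1) a] N(3) by blast
  moreover have "P \<union> N1 \<subseteq> U" "P \<union> N1 \<noteq> {}" using P_subset richD(1)[OF rich(2)] rich_nonempty[OF rich(2)] by auto
  ultimately obtain x where x: "x \<in> P \<union> N1" "a \<in> cl {x}"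
    using dis unfolding disintegrated_def by blast
  have "x \<notin> N1" using x(2) aN1 cl_closed_subset[of "{x}", OF _ richD(1,2)[OF rich(2)]] by auto
  then have "x \<in> P" using x(1) by auto
  then have "\<not> lascar_splits L M P [a] N1 N0"
    using line_not_splits[OF rich(1,2) sub(1) aN1, of x "{}"] x(2) by simp
  then show False using N(3) by blast
qed

text \<open>The pregeometry becomes modular over an element \<open>e\<close> of \<open>P \<inter> N\<close>. As \<open>e\<close> belongs to \<open>P\<close>, the point
found in the closure of \<open>e\<close> and elements of \<open>P\<close> is again in \<open>P\<close>; as it belongs to \<open>N\<close>, it can be
counted among the elements \<open>m\<close>.\<close>

lemma locally_modular_line:
  assumes lm: "locally_modular U cl" and N: "rich N" and a: "a \<in> cl (P \<union> N)"
  shows "\<exists>q \<in> P. \<exists>m. finite m \<and> m \<subseteq> N \<and> a \<in> cl (insert q m)"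
proof -
  note NU = richD(1)[OF N]
  obtain e where e: "e \<in> P \<inter> N" "e \<notin> cl {}" using richD(4)[OF N, of "{}"] by auto
  have eU: "e \<in> U" "{e} \<subseteq> U" using e P_subset by auto
  let ?d = "localize cl {e}"
  interpret d: pregeom U ?d using pregeometry_localize[OF eU(2)] by unfold_locales
  have mod: "modular U ?d" using lm e eU by (auto simp: locally_modular_def)
  have PN: "P \<union> N \<subseteq> U" using P_subset NU by auto
  obtain G where G: "finite G" "G \<subseteq> P \<union> N" "a \<in> cl G" using cl_finitary[OF PN a] by blast
  obtain ps where ps: "set ps = G \<inter> P" using G(1) finite_list[of "G \<inter> P"] by auto
  obtain ns where ns: "set ns = G \<inter> N" using G(1) finite_list[of "G \<inter> N"] by auto
  have U: "set ps \<subseteq> U" "set ns \<subseteq> U" using ps ns P_subset NU by auto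
  have GU: "set ps \<union> set ns \<union> {e} \<subseteq> U" using U eU by auto
  have "G \<subseteq> set ps \<union> set ns \<union> {e}" using G(2) ps ns by auto
  then have a_d: "a \<in> ?d (set ps \<union> set ns)" using G(3) cl_mono[OF _ GU] by (auto simp: localize_def)
  show ?thesis
  proof (cases "a \<in> ?d (set ns)")
    case True
    then have "a \<in> cl (insert e (set ns))" by (simp add: localize_def)
    then show ?thesis using e ns G(1) by (intro bexI[of _ e] exI[of _ "set ns"]) auto
  next
    case False
    obtain q where q: "q \<in> ?d (set ps)" "a \<in> ?d (insert q (set ns))"
      using d.modular_point[OF mod U a_d False] by blast
    have "q \<in> P" using q(1) cl_P_subset[of "set ps \<union> {e}"] ps e by (auto simp: localize_def)
    moreover have "a \<in> cl (insert q (insert e (set ns)))" using q(2) by (simp add: localize_def insert_commute)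
    moreover have "finite (insert e (set ns))" "insert e (set ns) \<subseteq> N" using e ns G(1) by simp_all
    ultimately show ?thesis by blast
  qed
qed

text \<open>The third splitting gives \<open>a \<notin> N2\<close>, the first one \<open>a \<in> cl (P \<union> N1)\<close>; so \<open>a\<close> is on a line through a
point of \<open>P\<close> and \<open>N1\<close>, which contradicts the second one.\<close>

lemma locally_modular_rank:
  assumes lm: "locally_modular U cl" and a: "a \<in> U" and N0: "sub_pair L \<C> M P N0"
  shows "\<not> ULsp_ge L \<C> M P [a] 3 N0"
proof
  assume "ULsp_ge L \<C> M P [a] 3 N0"
  then obtain N1 N2 N3 where N: "sub_pair L \<C> M P N1" "sub_pair L \<C> (restr M N1) (P \<inter> N1) N0"
    "lascar_splits L M P [a] N1 N0" "sub_pair L \<C> M P N2" "sub_pair L \<C> (restr M N2) (P \<inter> N2) N1"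
    "lascar_splits L M P [a] N2 N1" "sub_pair L \<C> M P N3" "sub_pair L \<C> (restr M N3) (P \<inter> N3) N2"
    "lascar_splits L M P [a] N3 N2"
    by (auto simp: numeral_3_eq_3)
  have rich: "rich N0" "rich N1" "rich N2" "rich N3" using sub_pair_rich N0 N(1,4,7) by auto
  have sub: "N0 \<subseteq> N1" "N1 \<subseteq> N2" "N2 \<subseteq> N3" using sub_pair_subset N(2,5,8) by fastforce+
  have aN2: "a \<notin> N2" using member_not_splits[OF rich(4) sub(3)] N(9) by blast
  have "a \<in> cl (P \<union> N1)" using generic_not_splits[OF rich(1,2) sub(1) a] N(3) by blast
  then obtain q m where "q \<in> P" "finite m" "m \<subseteq> N1" "a \<in> cl (insert q m)"
    using locally_modular_line[OF lm rich(2)] by blast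
  then show False using line_not_splits[OF rich(2,3) sub(2) aN2] N(6) by blast
qed


section \<open>Two successive splittings\<close>

text \<open>Finite character reduces this to finite subsets of \<open>Y\<close>, which are built up by \<open>P_free_insert\<close>.\<close>

lemma P_free_if_independent:
  assumes Y: "Y \<subseteq> U" "\<And>y. y \<in> Y \<Longrightarrow> y \<notin> cl (P \<union> (Y - {y}))"
  shows "P_free Y"
proof -
  have PY: "P \<union> Y \<subseteq> U" using P_subset Y(1) by auto
  have fin: "P_free G" if "finite G" "G \<subseteq> Y" for G
    using that
  proof (induction G)
    case empty
    show ?case by (rule P_free_empty)
  next
    case (insert y G)
    have "P \<union> G \<subseteq> P \<union> (Y - {y})" using insert by auto
    then have "cl (P \<union> G) \<subseteq> cl (P \<union> (Y - {y}))" using PY by (intro cl_mono) auto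
    then show ?case using insert Y by (intro P_free_insert) auto
  qed
  show ?thesis
    unfolding P_free_def
  proof (intro conjI allI impI subsetI)
    fix X x assume X: "X \<subseteq> P" and x: "x \<in> cl (X \<union> Y) \<inter> P"
    have XU: "X \<subseteq> U" using X P_subset by auto
    have x': "x \<in> cl (Y \<union> X)" using x by (simp add: Un_commute)
    obtain G where G: "finite G" "G \<subseteq> Y" "x \<in> cl (G \<union> X)" by (rule cl_finitary_Un[OF Y(1) XU x'])
    then have "x \<in> cl (X \<union> G) \<inter> P" using x by (simp add: Un_commute)
    then show "x \<in> cl X" using fin[OF G(1,2)] X unfolding P_free_def by blast
  qed (use Y(1) in auto)
qed

text \<open>Infinite independent sequences provide density and codensity because a finite set cannot account
for infinitely many of their terms.\<close>

lemma rich_generated: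
  fixes f g :: "nat \<Rightarrow> 'a"
  assumes f: "range f \<subseteq> P" "\<And>i. f i \<notin> cl (f ` (UNIV - {i}))"
    and g: "range g \<subseteq> U" "\<And>i. g i \<notin> cl (P \<union> g ` (UNIV - {i}))"
    and IJ: "infinite I" "infinite J"
  shows "rich (cl (f ` I \<union> g ` J))"
proof (rule richI)
  let ?A = "f ` I \<union> g ` J"
  have A: "?A \<subseteq> U" using f(1) g(1) P_subset by (auto simp: image_subset_iff)
  show W: "cl ?A \<subseteq> U" "cl (cl ?A) = cl ?A" using cl_subset[OF A] cl_idem[OF A] by auto
  show "based (cl ?A)"
    unfolding based_def
  proof (intro allI impI)
    fix F assume F: "finite F" "F \<subseteq> cl ?A"
    then obtain G where G: "finite G" "G \<subseteq> ?A" "F \<subseteq> cl G" using finite_subset_span[OF A F] by blast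
    let ?F = "F \<union> G" and ?B = "G \<inter> g ` J"
    have "P_free ?B"
    proof (rule P_free_if_independent)
      show "?B \<subseteq> U" using g by auto
      fix y assume y: "y \<in> ?B"
      then obtain i where i: "y = g i" by auto
      have "P \<union> (?B - {y}) \<subseteq> P \<union> g ` (UNIV - {i})" using i by auto
      moreover have "P \<union> g ` (UNIV - {i}) \<subseteq> U" using P_subset g by auto
      ultimately show "y \<notin> cl (P \<union> (?B - {y}))" using g(2)[of i] i cl_mono by blast
    qed
    moreover have "?F \<subseteq> cl (?F \<inter> P \<union> ?B)"
    proof -
      have sub: "G \<subseteq> ?F \<inter> P \<union> ?B" using G(2) f(1) by blast
      have FU: "?F \<inter> P \<union> ?B \<subseteq> U" using P_subset G(2) A by auto
      have "cl G \<subseteq> cl (?F \<inter> P \<union> ?B)" by (rule cl_mono[OF sub FU])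
      then show ?thesis
        by (intro Un_least order.trans[OF G(3)] order.trans[OF sub cl_ext[OF FU]])
    qed
    moreover have "?F \<subseteq> cl ?A" by (rule Un_least[OF F(2) order.trans[OF G(2) cl_ext[OF A]]])
    ultimately show "\<exists>F' B. finite F' \<and> F \<subseteq> F' \<and> F' \<subseteq> cl ?A \<and> B \<subseteq> F' \<and> P_free B \<and> F' \<subseteq> cl (F' \<inter> P \<union> B)"
      using F(1) G(1) by (intro exI[of _ ?F] exI[of _ ?B]) auto
  qed
  fix F assume "finite F" "F \<subseteq> cl ?A"
  then have F: "finite F" "F \<subseteq> U" using W by auto
  have fU: "range f \<subseteq> U" "{} \<subseteq> U" using f(1) P_subset by auto
  have "f i \<notin> cl ({} \<union> f ` (UNIV - {i}))" for i using f(2) by simp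
  from independent_not_covered[OF fU(2,1) this IJ(1) F]
  obtain i where "i \<in> I" "f i \<notin> cl F" by auto
  moreover have "f i \<in> P \<inter> cl ?A" using f(1) cl_ext[OF A] \<open>i \<in> I\<close> by auto
  ultimately show "\<exists>x \<in> P \<inter> cl ?A. x \<notin> cl F" by blast
  from independent_not_covered[OF P_subset g IJ(2) F]
  obtain j where "j \<in> J" "g j \<notin> cl (P \<union> F)" by auto
  moreover have "g j \<in> cl ?A" using cl_ext[OF A] \<open>j \<in> J\<close> by auto
  ultimately show "\<exists>x \<in> cl ?A. x \<notin> cl (P \<union> F)" by blast
qed

text \<open>Any two independent tuples of the same length have the same type, by adding one generic element at
a time.\<close>

lemma independent_local_iso:
  assumes "length xs = length ys" "distinct xs" "distinct ys" "set xs \<subseteq> U" "set ys \<subseteq> U"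
    and "\<And>z. z \<in> set xs \<Longrightarrow> z \<notin> cl (set xs - {z})" "\<And>z. z \<in> set ys \<Longrightarrow> z \<notin> cl (set ys - {z})"
  shows "local_iso L M (set (zip xs ys))"
  using assms
proof (induction xs ys rule: list_induct2)
  case Nil
  show ?case by (rule local_iso_Id) simp
next
  case (Cons x xs y ys)
  have xy: "x \<notin> cl (set xs)" "y \<notin> cl (set ys)"
    using Cons.prems(1,2) Cons.prems(5)[of x] Cons.prems(6)[of y] by auto
  have "z \<notin> cl (set xs - {z})" if "z \<in> set xs" for z
    using Cons.prems(5)[of z] that Cons.prems(3) cl_mono[of "set xs - {z}" "set (x # xs) - {z}"] by auto
  moreover have "z \<notin> cl (set ys - {z})" if "z \<in> set ys" for z
    using Cons.prems(6)[of z] that Cons.prems(4) cl_mono[of "set ys - {z}" "set (y # ys) - {z}"] by auto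
  ultimately have iso: "local_iso L M (set (zip xs ys))" using Cons.IH Cons.prems by simp
  have z: "fst ` set (zip xs ys) = set xs" "snd ` set (zip xs ys) = set ys"
    by (rule fst_snd_set_zip[OF Cons.hyps])+
  have "set (zip xs ys) \<subseteq> U \<times> U"
    by (rule order.trans[OF subset_fst_snd Sigma_mono]) (use z Cons.prems in simp_all)
  then have "local_iso L M (insert (x, y) (set (zip xs ys)))"
    using homogeneous_extend_generic[OF homogeneous _ _ iso, of x y] xy z Cons.prems by simp
  then show ?case by simp
qed

lemma tp_P_singleton_eq:
  assumes iso: "\<And>F. finite F \<Longrightarrow> F \<subseteq> N \<Longrightarrow> pair_iso (insert (b, b') (Id_on F))"
  shows "tp_P L M P [b] N = tp_P L M P [b'] N"
proof -
  have "sat (struct_P M P) \<phi> (nth (b # ds)) \<longleftrightarrow> sat (struct_P M P) \<phi> (nth (b' # ds))"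
    if "wf_fm (lang_P L) \<phi>" "set ds \<subseteq> N" "fv \<phi> \<subseteq> {..<Suc (length ds)}" for \<phi> ds
    using iso[of "set ds"] that by (intro pair_iso_swap) auto
  then show ?thesis by (auto simp: tp_P_def itp_def)
qed

lemma tp_P_eq_generic:
  assumes N: "rich N" and b: "b \<in> U" "b \<notin> cl (P \<union> N)" "b' \<in> U" "b' \<notin> cl (P \<union> N)"
  shows "tp_P L M P [b] N = tp_P L M P [b'] N"
proof (rule tp_P_singleton_eq)
  fix F assume F: "finite F" "F \<subseteq> N"
  obtain F' where F': "finite F'" "F \<subseteq> F'" "F' \<subseteq> N" "based_iso (Id_on F')"
    by (rule based_extend_Id[OF richD(3,1)[OF N] F])
  have im: "fst ` Id_on F' = F'" "snd ` Id_on F' = F'" by force+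
  have "cl (P \<union> F') \<subseteq> cl (P \<union> N)" using F'(3) P_subset richD(1)[OF N] by (intro cl_mono) auto
  then have "based_iso (insert (b, b') (Id_on F'))"
    using b by (intro based_iso_insert_P_free[OF F'(4)]) (auto simp: im)
  then show "pair_iso (insert (b, b') (Id_on F))"
    unfolding pair_iso_def using F'(2) by (intro exI[of _ "insert (b, b') (Id_on F')"]) auto
qed

lemma tp_P_eq_P:
  assumes N: "rich N" and b: "b \<in> P - N" "b' \<in> P - N"
  shows "tp_P L M P [b] N = tp_P L M P [b'] N"
proof (rule tp_P_singleton_eq)
  fix F assume F: "finite F" "F \<subseteq> N"
  obtain F' where F': "finite F'" "F \<subseteq> F'" "F' \<subseteq> N" "based_iso (Id_on F')"
    by (rule based_extend_Id[OF richD(3,1)[OF N] F])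
  have im: "fst ` Id_on F' = F'" "snd ` Id_on F' = F'" by force+
  have "cl F' \<subseteq> N" by (rule cl_closed_subset[OF F'(3) richD(1,2)[OF N]])
  then have "based_iso (insert (b, b') (Id_on F'))"
    using b by (intro based_iso_insert_P[OF F'(4)]) (auto simp: im)
  then show "pair_iso (insert (b, b') (Id_on F))"
    unfolding pair_iso_def using F'(2) by (intro exI[of _ "insert (b, b') (Id_on F')"]) auto
qed

text \<open>Types over \<open>N\<close> determine dependence on \<open>N\<close> and \<open>P\<close>. This detects splitting.\<close>

lemma tp_P_eq_closure:
  assumes eq: "tp_P L M P [a, b] N = tp_P L M P [a, b'] N"
    and U: "a \<in> U" "b \<in> U" "b' \<in> U" "N \<subseteq> U" and ds: "set ds \<subseteq> N" and ps: "set ps \<subseteq> P"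
    and a: "a \<in> cl (insert b (set ds \<union> set ps))"
  shows "\<exists>qs. set qs \<subseteq> P \<and> length qs = length ps \<and> a \<in> cl (insert b' (set ds \<union> set qs))"
proof -
  let ?xs = "[a, b] @ ds" and ?ys = "[a, b'] @ ds"
  have PU: "P \<inter> U = P" using P_subset by auto
  have "\<exists>qs. length qs = length ps \<and> set qs \<subseteq> P \<inter> U \<and> local_iso L M (set (zip (?xs @ ps) (?ys @ qs)))"
  proof (rule transfer_witnesses)
    show "set ?xs \<subseteq> U" using U ds by auto
    fix \<psi> :: "('f, 'r option, nat) fm"
    assume \<psi>: "wf_fm (lang_P L) \<psi>" "fv \<psi> \<subseteq> {..<length ?xs}" "sat (struct_P M P) \<psi> (nth ?xs)"
    have "(\<psi>, ds) \<in> tp_P L M P [a, b] N" using \<psi> ds by (simp add: tp_P_def itp_def)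
    then have "(\<psi>, ds) \<in> tp_P L M P [a, b'] N" using eq by simp
    then show "sat (struct_P (restr M U) (P \<inter> U)) \<psi> (nth ?ys)" by (simp add: tp_P_def itp_def PU)
  qed (use ps in auto)
  then obtain qs where qs: "length qs = length ps" "set qs \<subseteq> P" "local_iso L M (set (zip (?xs @ ps) (?ys @ qs)))"
    by auto
  let ?S = "set (zip (?xs @ ps) (?ys @ qs))" and ?T = "set (zip (b # ds @ ps) (b' # ds @ qs))"
  have dom: "fst ` ?S = set (?xs @ ps)" "snd ` ?S = set (?ys @ qs)"
    by (rule fst_snd_set_zip; use qs(1) in simp)+
  have dom_U: "set (?xs @ ps) \<subseteq> U" "set (?ys @ qs) \<subseteq> U" using U ds ps qs(2) P_subset by auto
  have "?S \<subseteq> U \<times> U"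
    by (rule order.trans[OF subset_fst_snd Sigma_mono]) (simp_all only: dom dom_U)
  then have "a \<in> cl (fst ` ?T) \<longleftrightarrow> a \<in> cl (snd ` ?T)"
    by (intro local_iso_closure_iff[OF qs(3)]) auto
  moreover have "fst ` ?T = set (b # ds @ ps)" "snd ` ?T = set (b' # ds @ qs)"
    by (rule fst_snd_set_zip; use qs(1) in simp)+
  ultimately have "a \<in> cl (set (b # ds @ ps)) \<longleftrightarrow> a \<in> cl (set (b' # ds @ qs))" by (simp only:)
  then have "a \<in> cl (insert b' (set ds \<union> set qs))" using a by simp
  then show ?thesis using qs(1,2) by blast
qed

text \<open>The terms \<open>f 0\<close>, \<open>f 1\<close> of an independent sequence in \<open>P\<close> and \<open>g 0\<close>, \<open>g 1\<close> of a sequence independent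
over \<open>P\<close> are kept aside as \<open>q\<close>, \<open>q'\<close>, \<open>m\<close>, \<open>m'\<close>; the other terms generate \<open>N\<close>, and \<open>N1\<close> contains in
addition \<open>m\<close> and \<open>m'\<close>. An irredundant dependence is moved by homogeneity to one between \<open>q\<close>, \<open>m\<close> and
further terms \<open>ws\<close> of the first sequence.\<close>

lemma nontrivial_splitting_chain:
  assumes "\<not> disintegrated U cl"
  shows "\<exists>a \<in> U. \<exists>N N1. rich N \<and> rich N1 \<and> N \<subseteq> N1 \<and>
    lascar_splits L M P [a] N1 N \<and> lascar_splits L M P [a] U N1"
proof -
  have emp: "{} \<subseteq> U" by simp
  have "\<exists>x \<in> P. x \<notin> cl ({} \<union> F)" if "finite F" "F \<subseteq> P" for F
    using richD(4)[OF rich_univ that(1)] that(2) P_subset by auto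
  from independent_sequence_exists[OF P_subset emp this]
  obtain f :: "nat \<Rightarrow> 'a" where f: "range f \<subseteq> P" "\<And>i. f i \<notin> cl (f ` (UNIV - {i}))" by auto
  have "\<exists>x \<in> U. x \<notin> cl (P \<union> F)" if "finite F" "F \<subseteq> U" for F
    using richD(5)[OF rich_univ that] .
  from independent_sequence_exists[OF order.refl P_subset this]
  obtain g :: "nat \<Rightarrow> 'a" where g: "range g \<subseteq> U" "\<And>i. g i \<notin> cl (P \<union> g ` (UNIV - {i}))" by auto
  have fU: "range f \<subseteq> U" using f(1) P_subset by auto
  have fP: "f ` X \<subseteq> P" "f i \<in> P" for X i using f(1) by auto
  have XY: "f ` X \<union> g ` Y \<subseteq> U" "P \<union> g ` Y \<subseteq> U" for X Y using fU g(1) P_subset by auto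
  have P_free_g: "P_free (range g)"
  proof (rule P_free_if_independent[OF g(1)])
    fix y assume "y \<in> range g"
    then obtain i where i: "y = g i" by auto
    have "cl (P \<union> (range g - {y})) \<subseteq> cl (P \<union> g ` (UNIV - {i}))"
      using i XY by (intro cl_mono) auto
    then show "y \<notin> cl (P \<union> (range g - {y}))" using g(2)[of i] i by auto
  qed
  have f_ind: "f i \<notin> cl (f ` (UNIV - {i}) \<union> range g)" for i
    using P_free_g[unfolded P_free_def, THEN conjunct2, rule_format, OF fP(1)[of "UNIV - {i}"]] f(2)[of i] fP(2)[of i]
    by blast
  define q q' m m' where "q = f 0" and "q' = f 1" and "m = g 0" and "m' = g 1"
  define N where "N = cl (f ` {2..} \<union> g ` {2..})"
  define N1 where "N1 = cl (f ` {2..} \<union> range g)"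
  have rich: "rich N" "rich N1"
    unfolding N_def N1_def by (rule rich_generated[OF f g]; simp add: infinite_Ici)+
  have NU: "N \<subseteq> U" "N1 \<subseteq> U" using rich richD(1) by auto
  have NN1: "N \<subseteq> N1" unfolding N_def N1_def by (rule cl_mono[OF _ XY(1)]) auto
  have qm: "q \<in> P" "q' \<in> P" "q \<in> U" "q' \<in> U" "m \<in> U" "m' \<in> U" "m \<in> N1" "m' \<in> N1"
    using fP fU g(1) cl_ext[OF XY(1)[of "{2..}" UNIV]] by (auto simp: q_def q'_def m_def m'_def N1_def)
  have q: "q \<notin> cl (insert q' N1)"
  proof
    assume q_in: "q \<in> cl (insert q' N1)"
    have q_sub: "insert q' N1 \<subseteq> cl (f ` (UNIV - {0}) \<union> range g)"
    proof -
      have "N1 \<subseteq> cl (f ` (UNIV - {0}) \<union> range g)" unfolding N1_def by (rule cl_mono[OF _ XY(1)]) auto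
      then show ?thesis using cl_ext[OF XY(1)[of "UNIV - {0}" UNIV]] by (auto simp: q'_def)
    qed
    have "q \<in> cl (f ` (UNIV - {0}) \<union> range g)" by (rule cl_minimalD[OF q_in q_sub XY(1)])
    then show False using f_ind[of 0] by (simp add: q_def)
  qed
  have q'N1: "q' \<notin> N1"
  proof
    assume "q' \<in> N1"
    moreover have "N1 \<subseteq> cl (f ` (UNIV - {1}) \<union> range g)" unfolding N1_def by (rule cl_mono[OF _ XY(1)]) auto
    ultimately show False using f_ind[of 1] by (auto simp: q'_def)
  qed
  have qN1U: "insert q' N1 \<subseteq> U" using qm NU by auto
  have qN1: "q \<notin> N1" using q cl_ext[OF qN1U] by auto
  have m: "m \<notin> cl (insert m' (P \<union> N))"
  proof
    assume m_in: "m \<in> cl (insert m' (P \<union> N))"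
    have m_sub: "insert m' (P \<union> N) \<subseteq> cl (P \<union> g ` (UNIV - {0}))"
    proof -
      have "N \<subseteq> cl (P \<union> g ` (UNIV - {0}))"
        unfolding N_def by (rule cl_mono[OF _ XY(2)]) (use fP in auto)
      then show ?thesis using cl_ext[OF XY(2)[of "UNIV - {0}"]] by (auto simp: m'_def)
    qed
    have "m \<in> cl (P \<union> g ` (UNIV - {0}))" by (rule cl_minimalD[OF m_in m_sub XY(2)])
    then show False using g(2)[of 0] by (simp add: m_def)
  qed
  have PNU: "insert m' (P \<union> N) \<subseteq> U" using qm NU P_subset by auto
  have m_PN: "m \<notin> cl (P \<union> N)" using m cl_mono[OF _ PNU, of "P \<union> N"] by auto
  have m'_PN: "m' \<notin> cl (P \<union> N)"
  proof
    assume m'_in: "m' \<in> cl (P \<union> N)"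
    have m'_sub: "P \<union> N \<subseteq> cl (P \<union> g ` (UNIV - {1}))"
    proof -
      have "N \<subseteq> cl (P \<union> g ` (UNIV - {1}))"
        unfolding N_def by (rule cl_mono[OF _ XY(2)]) (use fP in auto)
      then show ?thesis using cl_ext[OF XY(2)[of "UNIV - {1}"]] by auto
    qed
    have "m' \<in> cl (P \<union> g ` (UNIV - {1}))" by (rule cl_minimalD[OF m'_in m'_sub XY(2)])
    then show False using g(2)[of 1] by (simp add: m'_def)
  qed

  obtain a0 A x y where A: "finite A" "A \<subseteq> U" "x \<in> A" "y \<in> A" "x \<noteq> y" "a0 \<in> cl A"
    "\<And>z. z \<in> A \<Longrightarrow> a0 \<notin> cl (A - {z})"
    using nontrivial_dependence[OF assms] by blast
  \<comment> \<open>An irredundant dependence is between independent elements.\<close>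
  have A_ind: "z \<notin> cl (A - {z})" if "z \<in> A" for z
  proof
    assume z: "z \<in> cl (A - {z})"
    have AzU: "A - {z} \<subseteq> U" using A(2) by auto
    have "A \<subseteq> cl (A - {z})" using z cl_ext[OF AzU] by auto
    then have "a0 \<in> cl (A - {z})" by (rule cl_minimalD[OF A(6) _ AzU])
    then show False using A(7)[OF that] by blast
  qed
  obtain zs where zs: "set zs = A - {x, y}" "distinct zs"
    using finite_distinct_list[of "A - {x, y}"] A(1) by auto
  define ws where "ws = map (\<lambda>i. f (i + 2)) [0..<length zs]"
  have ws: "set ws \<subseteq> f ` {2..}" "length ws = length zs" by (auto simp: ws_def)
  have wsN: "set ws \<subseteq> N" using ws(1) cl_ext[OF XY(1)] unfolding N_def by blast
  have wsU: "set ws \<subseteq> U" "set ws \<subseteq> P" using ws(1) fU f(1) by blast+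
  have f_inj: "inj f"
  proof (rule injI, rule ccontr)
    fix i j assume "f i = f j" "i \<noteq> j"
    then have "f i \<in> f ` (UNIV - {i})" by auto
    then show False using f(2)[of i] cl_base[of "f i" "f ` (UNIV - {i})"] fU by auto
  qed
  have m_notin: "m \<notin> P" using m_PN cl_ext[of "P \<union> N"] P_subset NU by auto
  let ?Y = "q # m # ws"
  have Y_ind: "z \<notin> cl (set ?Y - {z})" if z: "z \<in> set ?Y" for z
  proof (cases "z = m")
    case True
    then have "set ?Y - {z} \<subseteq> P \<union> N" using qm wsU by auto
    then have "cl (set ?Y - {z}) \<subseteq> cl (P \<union> N)" using P_subset NU by (intro cl_mono) auto
    then show ?thesis using m_PN True by auto
  next
    case False
    then obtain i where i: "z = f i" using z ws(1) by (auto simp: q_def)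
    have "set ws \<subseteq> range f" using ws(1) by blast
    then have "set ?Y \<subseteq> range f \<union> range g" by (auto simp: q_def m_def)
    moreover have "range f - {f i} \<subseteq> f ` (UNIV - {i})" by auto
    ultimately have "set ?Y - {z} \<subseteq> f ` (UNIV - {i}) \<union> range g" using i by blast
    then have "cl (set ?Y - {z}) \<subseteq> cl (f ` (UNIV - {i}) \<union> range g)" by (rule cl_mono[OF _ XY(1)])
    then show ?thesis using f_ind[of i] i by auto
  qed
  let ?X = "x # y # zs"
  have X: "set ?X = A" "distinct ?X" using zs A by auto
  have Y: "distinct ?Y" "set ?Y \<subseteq> U"
  proof -
    have "distinct ws" "q \<notin> set ws"
      unfolding ws_def q_def using f_inj by (auto simp: distinct_map inj_on_def dest: injD)
    then show "distinct ?Y" using m_notin wsU(2) qm(1) by auto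
    show "set ?Y \<subseteq> U" using wsU(1) qm by simp
  qed
  let ?S = "set (zip ?X ?Y)"
  have len: "length ?X = length ?Y" using ws by simp
  have iso: "local_iso L M ?S"
    using independent_local_iso[OF len X(2) Y(1)] X(1) A(2) A_ind Y(2) Y_ind by blast
  have dom: "fst ` ?S = A" "snd ` ?S = set ?Y" using fst_snd_set_zip[OF len] X(1) by auto
  have S_U: "?S \<subseteq> U \<times> U"
    by (rule order.trans[OF subset_fst_snd Sigma_mono]) (use dom A(2) Y(2) in \<open>simp_all only: dom\<close>)
  have "a0 \<in> cl (fst ` ?S)" using A(6) dom by simp
  then obtain a where a: "a \<in> cl (snd ` ?S)" "local_iso L M (insert (a0, a) ?S)"
    using homogeneous_extend_closure[OF homogeneous _ S_U iso] by blast
  have a0U: "a0 \<in> U" using A(2,6) cl_subset by blast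
  have aU: "a \<in> U" using a(1) dom Y(2) cl_subset by blast
  let ?W = "set ws"
  have a_qmW: "a \<in> cl (insert q (insert m ?W))" using a(1) dom by simp
  have transfer: "a0 \<in> cl (fst ` T) \<longleftrightarrow> a \<in> cl (snd ` T)" if "T \<subseteq> ?S" for T
    by (rule local_iso_closure_iff[OF a(2)]) (use that S_U a0U aU in auto)
  \<comment> \<open>The image of the dependence is irredundant at \<open>q\<close> and at \<open>m\<close>.\<close>
  have a_mW: "a \<notin> cl (insert m ?W)"
  proof -
    have "fst ` set (zip (y # zs) (m # ws)) = A - {x}" "snd ` set (zip (y # zs) (m # ws)) = insert m ?W"
      using fst_snd_set_zip[of "y # zs" "m # ws"] ws(2) X A(5) by auto
    then show ?thesis using transfer[of "set (zip (y # zs) (m # ws))"] A(7)[OF A(3)] by auto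
  qed
  have a_qW: "a \<notin> cl (insert q ?W)"
  proof -
    have "fst ` set (zip (x # zs) (q # ws)) = A - {y}" "snd ` set (zip (x # zs) (q # ws)) = insert q ?W"
      using fst_snd_set_zip[of "x # zs" "q # ws"] ws(2) X A(5) by auto
    then show ?thesis using transfer[of "set (zip (x # zs) (q # ws))"] A(7)[OF A(4)] by auto
  qed
  \<comment> \<open>So \<open>q\<close> and \<open>m\<close> can be recovered from \<open>a\<close>.\<close>
  have q_amW: "q \<in> cl (insert a (insert m ?W))"
    using cl_exchange[of "insert m ?W" q a] a_qmW a_mW qm wsU by auto
  have m_aqW: "m \<in> cl (insert a (insert q ?W))"
    using cl_exchange[of "insert q ?W" m a] a_qmW a_qW qm wsU by (auto simp: insert_commute)

  have "lascar_splits L M P [a] N1 N"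
    unfolding lascar_splits_def
  proof (rule exI[of _ "[m]"], rule exI[of _ "[m']"], intro conjI)
    show "set [m] \<subseteq> N1" "set [m'] \<subseteq> N1" using qm by auto
    show "tp_P L M P [m] N = tp_P L M P [m'] N" 
      by (rule tp_P_eq_generic[OF rich(1) qm(5) m_PN qm(6) m'_PN])
    show "tp_P L M P ([a] @ [m]) N \<noteq> tp_P L M P ([a] @ [m']) N"
    proof
      assume "tp_P L M P ([a] @ [m]) N = tp_P L M P ([a] @ [m']) N"
      then have eq: "tp_P L M P [a, m] N = tp_P L M P [a, m'] N" by simp
      have "a \<in> cl (insert m (set ws \<union> set [q]))" using a_qmW by (simp add: insert_commute)
      then obtain qs where qs: "set qs \<subseteq> P" "a \<in> cl (insert m' (set ws \<union> set qs))"
        using tp_P_eq_closure[OF eq aU qm(5,6) NU(1) wsN, of "[q]"] qm(1) by force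
      have "insert m' (set ws \<union> set qs) \<subseteq> insert m' (P \<union> N)" using qs(1) wsU by auto
      then have "a \<in> cl (insert m' (P \<union> N))" using qs(2) cl_mono[OF _ PNU] by blast
      then have "insert a (insert q ?W) \<subseteq> cl (insert m' (P \<union> N))" using cl_ext[OF PNU] qm wsU by auto
      then show False using cl_minimalD[OF m_aqW _ PNU] m by blast
    qed
  qed
  moreover have "lascar_splits L M P [a] U N1"
    unfolding lascar_splits_def
  proof (rule exI[of _ "[q]"], rule exI[of _ "[q']"], intro conjI)
    show "set [q] \<subseteq> U" "set [q'] \<subseteq> U" using qm by auto
    show "tp_P L M P [q] N1 = tp_P L M P [q'] N1" 
      by (rule tp_P_eq_P[OF rich(2)]) (use qm qN1 q'N1 in simp_all)
    show "tp_P L M P ([a] @ [q]) N1 \<noteq> tp_P L M P ([a] @ [q']) N1"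
    proof
      assume "tp_P L M P ([a] @ [q]) N1 = tp_P L M P ([a] @ [q']) N1"
      then have eq: "tp_P L M P [a, q] N1 = tp_P L M P [a, q'] N1" by simp
      have "a \<in> cl (insert q (set (m # ws) \<union> set []))" using a_qmW by simp
      moreover have mws: "set (m # ws) \<subseteq> N1" using qm wsN NN1 by auto
      ultimately have "a \<in> cl (insert q' (set (m # ws)))"
        using tp_P_eq_closure[OF eq aU qm(3,4) NU(2), of "m # ws" "[]"] by auto
      moreover have "insert q' (set (m # ws)) \<subseteq> insert q' N1" using mws by auto
      ultimately have "a \<in> cl (insert q' N1)" using cl_mono[OF _ qN1U] by blast
      then have "insert a (insert m ?W) \<subseteq> cl (insert q' N1)" using cl_ext[OF qN1U] mws by auto
      then show False using cl_minimalD[OF q_amW _ qN1U] q by blast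
    qed
  qed
  ultimately show ?thesis using aU rich NN1 by blast
qed

end


section \<open>The rank of a beautiful pair\<close>

lemma ULsp_ge_Suc: "ULsp_ge L \<C> M P as (Suc n) N \<Longrightarrow> ULsp_ge L \<C> M P as n N"
proof (induction n arbitrary: N)
  case (Suc n)
  then obtain N1 where "sub_pair L \<C> M P N1" "sub_pair L \<C> (restr M N1) (P \<inter> N1) N"
    "lascar_splits L M P as N1 N" "ULsp_ge L \<C> M P as (Suc n) N1"
    unfolding ULsp_ge.simps(2)[of L \<C> M P as "Suc n"] by blast
  then show ?case
    using Suc.IH[of N1] unfolding ULsp_ge.simps(2)[of L \<C> M P as n] by blast
qed simp

lemma ULsp_le:
  assumes "\<not> ULsp_ge L \<C> M P as (Suc n) N"
  shows "ULsp L \<C> M P as N \<le> enat n"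
proof -
  have mono: "ULsp_ge L \<C> M P as k N" if "ULsp_ge L \<C> M P as (k + j) N" for j k
    using that by (induction j) (auto dest: ULsp_ge_Suc simp del: ULsp_ge.simps)
  have "k \<le> n" if "ULsp_ge L \<C> M P as k N" for k
  proof (rule ccontr)
    assume "\<not> k \<le> n"
    then have "k = Suc n + (k - Suc n)" by simp
    then show False using mono[of "Suc n" "k - Suc n"] that assms by metis
  qed
  then show ?thesis unfolding ULsp_def by (intro Sup_least) auto
qed

lemma beautiful_pair_homogeneous:
  assumes "countable_lang L" "quasiminimal_class L \<C>" "beautiful_pair L \<C> M P"
  shows "homogeneous_pair L M P"
proof
  have M: "M \<in> \<C>" and P: "P \<subseteq> univ M" and dc: "dense_codense M P" and cs: "closed_sub L (restr M P) M"
    using assms(3) by (auto simp: beautiful_pair_def)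
  show "countable_lang L" by fact
  show "finitely_homogeneous L M" by (rule quasiminimal_class_finitely_homogeneous[OF assms(2) M])
  show "P \<subseteq> univ M" "dense_codense M P" by fact+
  have "pregeometry P (clo M)" using cs by (auto simp: closed_sub_def closed_embedding_def is_pgstruct_def)
  then interpret pregeom P "clo M" by unfold_locales
  show "clo M P = P" using cl_subset[of P] cl_ext[of P] by auto
qed

theorem theorem6p13:
  fixes L :: "('f, 'r) lang"
    and \<C> :: "('f, 'r, 'a) pgstruct set"
    and M :: "('f, 'r, 'a) pgstruct"
    and P :: "'a set"
  assumes "countable_lang L"
    and "quasiminimal_class L \<C>"
    and "beautiful_pair L \<C> M P"
  shows "(disintegrated (univ M) (clo M) \<longrightarrow> ULsp_pair_eq_1 L \<C> M P) \<and>
    (locally_modular (univ M) (clo M) \<and> \<not> disintegrated (univ M) (clo M) \<longrightarrow>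
       ULsp_pair_eq_2 L \<C> M P)"
proof (intro conjI impI)
  interpret homogeneous_pair L M P by (rule beautiful_pair_homogeneous[OF assms])
  have M: "M \<in> \<C>" using assms(3) by (simp add: beautiful_pair_def)
  {
    assume dis: "disintegrated (univ M) (clo M)"
    have "ULsp L \<C> M P [a] N \<le> enat 1" if "a \<in> univ M" "sub_pair L \<C> M P N" for a N
      by (rule ULsp_le) (unfold Suc_1, rule disintegrated_rank[OF dis that])
    then show "ULsp_pair_eq_1 L \<C> M P" by (simp add: ULsp_pair_eq_1_def one_enat_def)
  next
    assume lm: "locally_modular (univ M) (clo M) \<and> \<not> disintegrated (univ M) (clo M)"
    have le: "ULsp L \<C> M P [a] N \<le> enat 2" if "a \<in> univ M" "sub_pair L \<C> M P N" for a N
    proof (rule ULsp_le)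
      have three: "Suc 2 = 3" by simp
      show "\<not> ULsp_ge L \<C> M P [a] (Suc 2) N"
        unfolding three using lm by (intro locally_modular_rank that) simp
    qed
    obtain a N N1 where a: "a \<in> univ M" and N: "rich N" "rich N1" "N \<subseteq> N1"
      and splits: "lascar_splits L M P [a] N1 N" "lascar_splits L M P [a] U N1"
      using nontrivial_splitting_chain lm by blast
    have PU: "P \<inter> U = P" using P_subset by auto
    have sub: "sub_pair L \<C> M P K" if "rich K" for K
      using rich_sub_pair[OF assms(2) M that rich_univ richD(1)[OF that]] by (simp add: PU)
    have "ULsp_ge L \<C> M P [a] 1 N1"
      unfolding One_nat_def ULsp_ge.simps
      using sub[OF rich_univ] sub[OF N(2)] splits(2) by (intro exI[of _ U]) (simp add: PU)
    then have "ULsp_ge L \<C> M P [a] 2 N"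
      unfolding numeral_2_eq_2 One_nat_def ULsp_ge.simps(2)[of _ _ _ _ _ "Suc 0"]
      using sub[OF N(2)] rich_sub_pair[OF assms(2) M N] splits(1) by blast
    then have "enat 2 \<le> ULsp L \<C> M P [a] N" unfolding ULsp_def by (intro Sup_upper) auto
    then have "ULsp L \<C> M P [a] N = enat 2" using le[OF a sub[OF N(1)]] by simp
    then show "ULsp_pair_eq_2 L \<C> M P"
      using le a sub[OF N(1)] by (auto simp: ULsp_pair_eq_2_def numeral_eq_enat)
  }
qed

end
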